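(* Let $n,k,\ell$ be integers with $1\le k<n$ and $\ell\ge1$, and let $f$ be a measurable function on $\mathbb{R}^n$. Suppose that the right-hand side of the identity below exists in the Lebesgue sense; that is, the function $$F(x_0,\ldots,x_k)=\Big[\prod_{j=0}^{k} f(x_j)\Big]\Big[\prod_{j=k+1}^{k+\ell}\int_{\tau(x_0,\ldots,x_k)} f(y_j)\,d_\tau y_j\Big]$$ is well defined (with the inner integrals existing as Lebesgue integrals) for almost all $(x_0,\ldots,x_k)\in(\mathbb{R}^n)^{k+1}$, and $F\,\Delta_k^{\,k-n}\in L^1((\mathbb{R}^n)^{k+1})$. Then $$\int_{\mathcal{A}_{n,k}} [(R_kf)(\tau)]^{k+\ell+1}\,d\tau=\frac{(k!)^{k-n}\,\sigma_{k,k}}{\sigma_{n,k}}\int_{\mathbb{R}^n}\!\cdots\!\int_{\mathbb{R}^n} f(x_0)\cdots f(x_k)\Big[\prod_{j=k+1}^{k+\ell}\int_{\tau(x_0,\ldots,x_k)} f(y_j)\,d_\tau y_j\Big]\Delta_k^{\,k-n}(x_0,\ldots,x_k)\,dx_0\cdots dx_k .$$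
   Context: $\mathcal{A}_{n,k}$ is the Grassmannian bundle of affine $k$-planes $\tau$ in $\mathbb{R}^n$; each $\tau$ is written uniquely as $\tau=\xi+z$ with $\xi\in G_{n,k}$ (the Grassmann manifold of $k$-dimensional linear subspaces of $\mathbb{R}^n$) and $z\in\xi^\perp$, and the standard measure on $\mathcal{A}_{n,k}$ is $d\tau=d\xi\,dz$, with $d\xi$ the $O(n)$-invariant probability measure on $G_{n,k}$ and $dz$ Lebesgue measure on $\xi^\perp$. $d_\tau y$ is $k$-dimensional Lebesgue measure on $\tau$. The $k$-plane transform of $f$ is $(R_kf)(\tau)=\int_\tau f(y)\,d_\tau y$. $\tau(x_0,\ldots,x_k)$ is a $k$-plane containing the points $x_0,\ldots,x_k$; it is unique if these points are in general position, hence for almost all $(x_0,\ldots,x_k)$. $\Delta_k(x_0,\ldots,x_k)$ is the $k$-dimensional volume of the convex hull of $\{x_0,\ldots,x_k\}$, and $\Delta_k^{\,k-n}$ denotes its $(k-n)$-th power. For integers $m\ge k\ge1$, $$\sigma_{m,k}=\frac{2^k\pi^{mk/2}}{\Gamma_k(m/2)},\qquad \Gamma_k(\alpha)=\pi^{k(k-1)/4}\prod_{j=0}^{k-1}\Gamma(\alpha-j/2),$$ where $\Gamma$ is the Euler gamma function. *)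

theory Defs
  imports "HOL-Probability.Probability"
begin

section \<open>Lebesgue measure on affine subspaces\<close>

text \<open>
  For a nonempty affine set \<open>\<tau>\<close>, transport Lebesgue measure along the isometric parametrization
  given by a point of \<open>\<tau>\<close> and an orthonormal basis of its direction space; the result does not
  depend on these two choices. As for \<^const>\<open>lborel\<close>, the coordinates are indexed by the basis
  itself. The measure lives on the ambient space and is concentrated on \<open>\<tau>\<close>; in particular the
  integral of a function on the ambient space against it is its integral over \<open>\<tau>\<close>.
\<close>

definition orthonormal_basis_of :: "'a::euclidean_space set \<Rightarrow> 'a set" where
  "orthonormal_basis_of S =
     (SOME B. pairwise orthogonal B \<and> (\<forall>b\<in>B. norm b = 1) \<and> span B = S)"

definition flat_lebesgue :: "'a::euclidean_space set \<Rightarrow> 'a measure" where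
  "flat_lebesgue \<tau> =
     (let a = (SOME a. a \<in> \<tau>);
          B = orthonormal_basis_of ((\<lambda>y. y - a) ` \<tau>)
      in completion (distr (\<Pi>\<^sub>M b\<in>B. lborel) borel (\<lambda>u. a + (\<Sum>b\<in>B. u b *\<^sub>R b))))"

section \<open>The Grassmannian and the affine Grassmannian\<close>

definition grassmannian :: "nat \<Rightarrow> 'a::euclidean_space set set" where
  "grassmannian k = {\<xi>. subspace \<xi> \<and> dim \<xi> = k}"

definition affine_grassmannian :: "nat \<Rightarrow> 'a::euclidean_space set set" where
  "affine_grassmannian k = {\<tau>. affine \<tau> \<and> aff_dim \<tau> = int k}"

text \<open>
  For a closed convex set \<open>\<tau>\<close>, \<^term>\<open>closest_point \<tau>\<close> is the orthogonal projection onto \<open>\<tau>\<close>. Both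
  Grassmannians carry the topology that makes \<open>\<tau> \<mapsto> closest_point \<tau>\<close> an embedding into the affine
  maps of the ambient space (for \<open>\<tau> = \<xi> + z\<close> with \<open>z\<close> orthogonal to \<open>\<xi>\<close>, this is the pair of the
  projection matrix of \<open>\<xi>\<close> and \<open>z\<close>); its Borel sets are generated by the evaluations.
\<close>

definition flat_borel :: "'a::euclidean_space set set \<Rightarrow> 'a set measure" where
  "flat_borel \<Omega> = sigma \<Omega> {{\<tau> \<in> \<Omega>. closest_point \<tau> x \<in> A} | x A. A \<in> sets borel}"

definition grassmann_measure :: "nat \<Rightarrow> 'a::euclidean_space set measure" where
  "grassmann_measure k =
     (THE \<mu>. sets \<mu> = sets (flat_borel (grassmannian k)) \<and> prob_space \<mu> \<and>
        (\<forall>U. orthogonal_transformation U \<longrightarrow> distr \<mu> \<mu> ((`) U) = \<mu>))"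

text \<open>\<open>d\<tau> = d\<xi> dz\<close> under the bijection \<open>(\<xi>, z) \<mapsto> \<xi> + z\<close> with \<open>z\<close> orthogonal to \<open>\<xi>\<close>.\<close>

definition affine_grassmann_measure :: "nat \<Rightarrow> 'a::euclidean_space set measure" where
  "affine_grassmann_measure k =
     completion (measure_of (affine_grassmannian k) (sets (flat_borel (affine_grassmannian k)))
       (\<lambda>A. \<integral>\<^sup>+\<xi>. emeasure (flat_lebesgue (\<xi>\<^sup>\<bottom>)) {z \<in> \<xi>\<^sup>\<bottom>. (+) z ` \<xi> \<in> A} \<partial>grassmann_measure k))"

section \<open>The k-plane transform\<close>

definition plane_transform ::
  "('a::euclidean_space \<Rightarrow> 'b::{banach, second_countable_topology}) \<Rightarrow> 'a set \<Rightarrow> 'b" where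
  "plane_transform f \<tau> = (\<integral>y. f y \<partial>flat_lebesgue \<tau>)"

section \<open>Planes and simplices spanned by points\<close>

text \<open>A tuple \<open>(x\<^sub>0, \<dots>, x\<^sub>k)\<close> is a function on \<^term>\<open>{..k}\<close>.\<close>

definition plane_through :: "nat \<Rightarrow> (nat \<Rightarrow> 'a::euclidean_space) \<Rightarrow> 'a set" where
  "plane_through k x = (SOME \<tau>. \<tau> \<in> affine_grassmannian k \<and> x ` {..k} \<subseteq> \<tau>)"

definition simplex_volume :: "nat \<Rightarrow> (nat \<Rightarrow> 'a::euclidean_space) \<Rightarrow> real" where
  "simplex_volume k x = measure (flat_lebesgue (plane_through k x)) (convex hull (x ` {..k}))"

definition tuple_lebesgue :: "nat \<Rightarrow> (nat \<Rightarrow> 'a::euclidean_space) measure" where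
  "tuple_lebesgue k = completion (\<Pi>\<^sub>M j\<in>{..k}. lborel)"

section \<open>Constants\<close>

definition siegel_Gamma :: "nat \<Rightarrow> real \<Rightarrow> real" where
  "siegel_Gamma k \<alpha> = pi powr (real k * (real k - 1) / 4) * (\<Prod>j<k. Gamma (\<alpha> - real j / 2))"

definition stiefel_sigma :: "nat \<Rightarrow> nat \<Rightarrow> real" where
  "stiefel_sigma m k = 2 ^ k * pi powr (real m * real k / 2) / siegel_Gamma k (real m / 2)"

end

theory Submission
  imports Defs
begin

text \<open>
  Write \<open>\<tau>(x)\<close> for the plane through a tuple \<open>x = (x\<^sub>0, \<dots>, x\<^sub>k)\<close>. The identity is the affine
  Blaschke-Petkantschin formula (\<open>affine_blaschke_petkantschin\<close>), applied to
  \<open>H x = f(x\<^sub>0) \<cdots> f(x\<^sub>k) (R f (\<tau>(x)))\<^sup>l\<close>: choosing a plane \<open>\<tau>\<close> and then \<open>k + 1\<close> points of \<open>\<tau>\<close> amounts to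
  choosing \<open>k + 1\<close> points of space with a density proportional to \<open>\<Delta>\<^sub>k\<close> to the power \<open>k - n\<close>. Almost all
  tuples in \<open>\<tau>\<close> span \<open>\<tau>\<close>, so the integral of \<open>H\<close> over the tuples in \<open>\<tau>\<close> is
  \<open>(R f \<tau>)\<close> to the power \<open>(k + 1) + l\<close>.

  The formula is proved without coordinates on the Grassmannian and without determinants.
  A subspace \<open>S\<close> carries exactly one measure that is invariant under translations by \<open>S\<close> and gives the
  function \<open>exp (- \<pi> |x|\<^sup>2)\<close> the integral one (\<open>normalized_haar_unique\<close>), and this is Lebesgue measure on
  \<open>S\<close>. Consequently the Jacobian of a linear parametrisation \<open>a \<mapsto> \<Sum> a\<^sub>i Y\<^sub>i\<close> is the Gaussian integral
  \<open>inv_volume I Y\<close>, the reciprocal of the volume of the parallelepiped spanned by the \<open>Y\<^sub>i\<close>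
  (\<open>nn_integral_lincomb\<close>).

  The source of the formula is a symmetry. Let \<open>Y\<close> be a tuple of \<open>k\<close> vectors, with Lebesgue measure times
  \<open>inv_volume I Y\<close> to the power \<open>n - k\<close>, and let \<open>Z\<close> be a tuple of \<open>k\<close> vectors of the span of \<open>Y\<close>. The
  joint measure of \<open>(Y, Z)\<close> is symmetric (\<open>tuple_pairing_commute\<close>). It suffices to exchange one vector
  \<open>y\<close> of \<open>Y\<close> with one vector \<open>z = t y + L b\<close> of the span; this is an explicit substitution
  (\<open>exchange_affine_combination\<close>). Weighting one of the two tuples by Gaussians yields the linear formula,
  for planes that are spanned by Gaussian vectors. Its constant is a Gaussian moment of the volume, which
  is found by adding the vectors one by one (\<open>nn_integral_gauss_volume_power\<close>) and equals
  \<open>\<sigma>\<^sub>k\<^sub>,\<^sub>k / \<sigma>\<^sub>n\<^sub>,\<^sub>k\<close>.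

  The law of the span of a Gaussian tuple is invariant under rotations, and an invariant law is unique
  (\<open>rotation_invariant_unique\<close>), so it is the measure on the Grassmannian. Letting the plane and its first
  point sweep out the space (\<open>nn_integral_sweep\<close>) leads from linear planes to affine ones.

  It remains to pass from nonnegative Borel functions to \<open>f\<close>. A property of planes holds for almost every
  \<open>\<tau>\<close> if and only if it holds for \<open>\<tau>(x)\<close> for almost every \<open>x\<close> (\<open>AE_affine_flat_measure_iff\<close>); this turns the
  hypothesis on tuples into integrability of \<open>f\<close> on almost every plane, and makes a Borel representative of
  \<open>f\<close> harmless. As the formula exhibits a measure on tuples as a density of Lebesgue measure, it also holds
  for integrable functions (\<open>affine_blaschke_petkantschin_integral\<close>).
\<close>

section \<open>Orthogonal projection onto affine subspaces\<close>

lemma closest_point_affine_mem: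
  fixes S :: "'a::euclidean_space set"
  assumes "affine S" "S \<noteq> {}"
  shows "closest_point S x \<in> S"
  using assms by (intro closest_point_in_set affine_closed)

lemma closest_point_affine_orth:
  fixes S :: "'a::euclidean_space set"
  assumes S: "affine S" and s: "s \<in> S"
  shows "(x - closest_point S x) \<bullet> (s - closest_point S x) = 0"
proof -
  let ?p = "closest_point S x"
  have c: "convex S" "closed S" using S by (auto simp: affine_imp_convex affine_closed)
  have p: "?p \<in> S" using closest_point_affine_mem[OF S] s by blast
  have "2 *\<^sub>R ?p + (-1) *\<^sub>R s \<in> S"
    using p s by (intro mem_affine[OF S]) auto
  from closest_point_dot[OF c this, of x] closest_point_dot[OF c s, of x]
  show ?thesis by (simp add: inner_diff_right inner_add_right algebra_simps)
qed

lemma closest_point_affineI: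
  fixes S :: "'a::euclidean_space set"
  assumes S: "affine S" and y: "y \<in> S" and orth: "\<And>s. s \<in> S \<Longrightarrow> (x - y) \<bullet> (s - y) = 0"
  shows "closest_point S x = y"
proof -
  have "dist x y \<le> dist x z" if "z \<in> S" for z
  proof -
    have "(norm (x - z))\<^sup>2 = (norm (x - y))\<^sup>2 + (norm (z - y))\<^sup>2"
      using orth[OF that]
      by (simp add: power2_norm_eq_inner inner_diff_left inner_diff_right inner_commute algebra_simps)
    then have "(norm (x - y))\<^sup>2 \<le> (norm (x - z))\<^sup>2" by simp
    then show ?thesis by (simp add: dist_norm power_mono_iff)
  qed
  then show ?thesis
    using closest_point_unique[of S y x] S y by (auto simp: affine_imp_convex affine_closed)
qed

lemma closest_point_translation:
  fixes S :: "'a::euclidean_space set"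
  assumes "affine S" "S \<noteq> {}"
  shows "closest_point ((+) a ` S) x = a + closest_point S (x - a)"
proof (rule closest_point_affineI)
  show "affine ((+) a ` S)" using assms(1) affine_translation[of S a] by simp
  show "a + closest_point S (x - a) \<in> (+) a ` S"
    using closest_point_affine_mem[OF assms] by blast
  show "(x - (a + closest_point S (x - a))) \<bullet> (s - (a + closest_point S (x - a))) = 0"
    if "s \<in> (+) a ` S" for s
    using that closest_point_affine_orth[OF assms(1), of _ "x - a"]
    by (auto simp: algebra_simps)
qed

lemma closest_point_subspace_mem:
  fixes S :: "'a::euclidean_space set"
  assumes "subspace S"
  shows "closest_point S x \<in> S"
  using subspace_0[OF assms] by (intro closest_point_affine_mem subspace_imp_affine[OF assms]) auto

lemma closest_point_subspace_orth:
  fixes S :: "'a::euclidean_space set"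
  assumes "subspace S" "s \<in> S"
  shows "(x - closest_point S x) \<bullet> s = 0"
proof -
  have "closest_point S x + s \<in> S"
    by (intro subspace_add[OF assms(1)] closest_point_subspace_mem assms)
  from closest_point_affine_orth[OF subspace_imp_affine[OF assms(1)] this, of x] show ?thesis by simp
qed

lemma closest_point_subspaceI:
  fixes S :: "'a::euclidean_space set"
  assumes "subspace S" "y \<in> S" "\<And>s. s \<in> S \<Longrightarrow> (x - y) \<bullet> s = 0"
  shows "closest_point S x = y"
  using assms by (intro closest_point_affineI) (auto simp: subspace_imp_affine subspace_diff)

lemma linear_closest_point:
  fixes S :: "'a::euclidean_space set"
  assumes S: "subspace S"
  shows "linear (closest_point S)"
proof
  note m = closest_point_subspace_mem[OF S] and o = closest_point_subspace_orth[OF S]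
  show "closest_point S (x + y) = closest_point S x + closest_point S y" for x y
  proof (intro closest_point_subspaceI[OF S] subspace_add[OF S] m)
    show "(x + y - (closest_point S x + closest_point S y)) \<bullet> s = 0" if "s \<in> S" for s
      using o[OF that, of x] o[OF that, of y] by (simp add: inner_diff_left inner_add_left)
  qed
  show "closest_point S (r *\<^sub>R x) = r *\<^sub>R closest_point S x" for r x
  proof (intro closest_point_subspaceI[OF S] subspace_scale[OF S] m)
    show "(r *\<^sub>R x - r *\<^sub>R closest_point S x) \<bullet> s = 0" if "s \<in> S" for s
      using o[OF that, of x] by (simp add: inner_diff_left)
  qed
qed

lemma closest_point_add_subspace:
  fixes S :: "'a::euclidean_space set"
  assumes "subspace S" "v \<in> S"
  shows "closest_point S (v + x) = v + closest_point S x"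
  by (simp add: linear_add[OF linear_closest_point[OF assms(1)]] closest_point_self assms)

lemma norm_closest_point_pythagoras:
  fixes S :: "'a::euclidean_space set"
  assumes "subspace S"
  shows "(norm x)\<^sup>2 = (norm (closest_point S x))\<^sup>2 + (norm (x - closest_point S x))\<^sup>2"
  using closest_point_subspace_orth[OF assms closest_point_subspace_mem[OF assms], of x x]
  by (simp add: power2_norm_eq_inner inner_diff_left inner_diff_right inner_commute algebra_simps)

lemma closest_point_orthogonal_image:
  fixes S :: "'a::euclidean_space set"
  assumes U: "orthogonal_transformation (U :: 'a \<Rightarrow> 'a)" and S: "affine S" "S \<noteq> {}"
  shows "closest_point (U ` S) (U x) = U (closest_point S x)"
proof (rule closest_point_affineI)
  have "linear U" using U by (rule orthogonal_transformation_linear)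
  then show "affine (U ` S)" using S(1) affine_hull_linear_image[of U S]
    by (metis affine_hull_eq linear_linear)
  show "U (closest_point S x) \<in> U ` S" using closest_point_affine_mem[OF S] by blast
  fix s assume "s \<in> U ` S"
  then obtain t where t: "t \<in> S" "s = U t" by blast
  show "(U x - U (closest_point S x)) \<bullet> (s - U (closest_point S x)) = 0"
    using closest_point_affine_orth[OF S(1) t(1), of x] U \<open>linear U\<close>
    by (simp add: t orthogonal_transformation_def flip: linear_diff)
qed

text \<open>An affine map is determined by its values at the origin and at the basis vectors. For projections
  this upgrades measurability in the plane, for each fixed point, to joint measurability in plane and
  point.\<close>

lemma closest_point_affine_decomp:
  fixes T :: "'a::euclidean_space set"
  assumes T: "affine T" "T \<noteq> {}"
  shows "closest_point T x =
    closest_point T 0 + (\<Sum>b\<in>Basis. (x \<bullet> b) *\<^sub>R (closest_point T b - closest_point T 0))"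
proof -
  obtain a where a: "a \<in> T" using T by blast
  define S where "S = (+) (-a) ` T"
  have S: "subspace S" using affine_diffs_subspace[OF T(1) a] by (simp add: S_def)
  have TS: "T = (+) a ` S" by (auto simp: S_def image_image)
  have lin: "linear (closest_point S)" by (rule linear_closest_point[OF S])
  have cp: "closest_point T y = a + closest_point S y - closest_point S a" for y
    unfolding TS using S subspace_0[OF S]
    by (subst closest_point_translation)
       (auto simp: subspace_imp_affine linear_diff[OF lin])
  have "closest_point S x = closest_point S (\<Sum>b\<in>Basis. (x \<bullet> b) *\<^sub>R b)"
    by (simp add: euclidean_representation)
  also have "\<dots> = (\<Sum>b\<in>Basis. (x \<bullet> b) *\<^sub>R closest_point S b)"
    by (simp add: linear_sum[OF lin] linear_scale[OF lin])
  finally show ?thesis by (simp add: cp linear_0[OF lin])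
qed

lemma measurable_closest_point_pair:
  fixes T :: "'m \<Rightarrow> 'a::euclidean_space set"
  assumes T: "\<And>x. (\<lambda>m. closest_point (T m) x) \<in> borel_measurable M"
    and aff: "\<And>m. m \<in> space M \<Longrightarrow> affine (T m) \<and> T m \<noteq> {}"
    and f[measurable]: "f \<in> L \<rightarrow>\<^sub>M M" and g[measurable]: "g \<in> borel_measurable L"
  shows "(\<lambda>l. closest_point (T (f l)) (g l)) \<in> borel_measurable L"
proof -
  have [measurable]: "(\<lambda>l. closest_point (T (f l)) x) \<in> borel_measurable L" for x
    using measurable_compose[OF f T] .
  have "(\<lambda>l. closest_point (T (f l)) 0 + (\<Sum>b\<in>Basis. (g l \<bullet> b) *\<^sub>R
    (closest_point (T (f l)) b - closest_point (T (f l)) 0))) \<in> borel_measurable L"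
    by measurable
  then show ?thesis
    by (rule measurable_cong[THEN iffD1, rotated])
       (use measurable_space[OF f] aff in \<open>auto intro!: closest_point_affine_decomp[symmetric]\<close>)
qed

section \<open>Normalised invariant measures on subspaces\<close>

text \<open>With the factor \<open>\<pi>\<close> in the exponent the integral over a subspace is one in every dimension, zero
  included.\<close>

definition gauss :: "'a::euclidean_space \<Rightarrow> ennreal" where
  "gauss x = ennreal (exp (- pi * (norm x)\<^sup>2))"

lemma borel_measurable_gauss[measurable]: "gauss \<in> borel_measurable borel"
  unfolding gauss_def by measurable

lemma gauss_pos[simp]: "0 < gauss x" "gauss x \<noteq> 0" "gauss x \<noteq> \<infinity>" "gauss x < \<infinity>" "gauss x \<noteq> top"
  "gauss x < top"
  by (simp_all add: gauss_def)

lemma gauss_minus[simp]: "gauss (- x) = gauss x"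
  by (simp add: gauss_def)

lemma gauss_minus_commute: "gauss (x - y) = gauss (y - x)"
  by (simp only: gauss_def norm_minus_commute[of x y])

lemma gauss_orthogonal:
  assumes "(norm x)\<^sup>2 = (norm y)\<^sup>2 + (norm z)\<^sup>2"
  shows "gauss x = gauss y * gauss z"
proof -
  have "exp (- pi * (norm x)\<^sup>2) = exp (- pi * (norm y)\<^sup>2) * exp (- pi * (norm z)\<^sup>2)"
  unfolding assms by (simp add: exp_add[symmetric] algebra_simps)
  then show ?thesis by (simp add: gauss_def ennreal_mult')
qed

text \<open>A Gaussian normalisation needs no basis of \<open>S\<close> and is compatible with orthogonal sums, on which
  \<open>gauss\<close> is multiplicative.\<close>

definition normalized_haar :: "'a::euclidean_space set \<Rightarrow> 'a measure \<Rightarrow> bool" where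
  "normalized_haar S M \<longleftrightarrow> sets M = sets borel \<and> sigma_finite_measure M \<and> (AE x in M. x \<in> S) \<and>
     (\<forall>v\<in>S. distr M borel ((+) v) = M) \<and> (\<integral>\<^sup>+x. gauss x \<partial>M) = 1"

lemma normalized_haarD:
  assumes "normalized_haar S M"
  shows "sets M = sets borel" "sigma_finite_measure M" "AE x in M. x \<in> S"
    "\<And>v. v \<in> S \<Longrightarrow> distr M borel ((+) v) = M" "(\<integral>\<^sup>+x. gauss x \<partial>M) = 1"
proof -
  note h = assms[unfolded normalized_haar_def]
  show "sets M = sets borel" using h by (rule conjunct1)
  show "sigma_finite_measure M" using h by (elim conjE)
  show "AE x in M. x \<in> S" using h by (elim conjE)
  show "(\<integral>\<^sup>+x. gauss x \<partial>M) = 1" using h by (elim conjE)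
  show "distr M borel ((+) v) = M" if "v \<in> S" for v
    using h that by (elim conjE) (rule bspec)
qed

lemma subspace_borel[measurable]: "subspace S \<Longrightarrow> S \<in> sets (borel :: 'a::euclidean_space measure)"
  by (intro borel_closed closed_subspace)

lemma affine_borel: "affine S \<Longrightarrow> S \<in> sets (borel :: 'a::euclidean_space measure)"
  by (intro borel_closed affine_closed)

lemma measurable_plus_left[measurable]: "(+) v \<in> borel \<rightarrow>\<^sub>M (borel :: 'a::euclidean_space measure)"
  by (rule borel_measurable_continuous_onI) (intro continuous_intros)

lemma nn_integral_haar_translate:
  fixes M :: "'a::euclidean_space measure"
  assumes inv: "distr M borel ((+) v) = M" and [measurable_cong]: "sets M = sets borel"
    and [measurable]: "h \<in> borel_measurable borel"
  shows "(\<integral>\<^sup>+x. h (v + x) \<partial>M) = (\<integral>\<^sup>+x. h x \<partial>M)"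
proof -
  have "(\<integral>\<^sup>+x. h x \<partial>distr M borel ((+) v)) = (\<integral>\<^sup>+x. h (v + x) \<partial>M)"
    by (rule nn_integral_distr) measurable
  then show ?thesis unfolding inv by simp
qed

text \<open>Weil's argument for the uniqueness of Haar measure: the double integral of
  \<open>gauss y * g (x + y)\<close> equals the integral of \<open>g\<close> against \<open>M\<close> when \<open>x\<close> is integrated first, and the
  integral of \<open>g\<close> against \<open>N\<close> when \<open>x + y\<close> is taken as the new variable.\<close>

lemma normalized_haar_unique:
  fixes S :: "'a::euclidean_space set"
  assumes S: "subspace S" and M: "normalized_haar S M" and N: "normalized_haar S N"
  shows "M = N"
proof -
  have sM[measurable_cong]: "sets M = sets borel" and sN[measurable_cong]: "sets N = sets borel"
    by (rule normalized_haarD(1)[OF M], rule normalized_haarD(1)[OF N])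
  interpret M: sigma_finite_measure M using normalized_haarD(2)[OF M] .
  interpret N: sigma_finite_measure N using normalized_haarD(2)[OF N] .
  interpret MN: pair_sigma_finite M N ..
  have tM: "(\<integral>\<^sup>+x. h (v + x) \<partial>M) = (\<integral>\<^sup>+x. h x \<partial>M)"
    if "v \<in> S" "h \<in> borel_measurable borel" for v h
    using that by (intro nn_integral_haar_translate normalized_haarD[OF M])
  have tN: "(\<integral>\<^sup>+x. h (v + x) \<partial>N) = (\<integral>\<^sup>+x. h x \<partial>N)"
    if "v \<in> S" "h \<in> borel_measurable borel" for v h
    using that by (intro nn_integral_haar_translate normalized_haarD[OF N])
  have aM: "AE x in M. x \<in> S" and aN: "AE x in N. x \<in> S"
    and gM: "(\<integral>\<^sup>+x. gauss x \<partial>M) = 1" and gN: "(\<integral>\<^sup>+x. gauss x \<partial>N) = 1"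
    by (rule normalized_haarD(3)[OF M], rule normalized_haarD(3)[OF N], rule normalized_haarD(5)[OF M], rule normalized_haarD(5)[OF N])
  show ?thesis
  proof (rule measure_eqI)
    show "sets M = sets N" by (simp add: sM sN)
    fix A assume "A \<in> sets M"
    then have A[measurable]: "A \<in> sets borel" by (simp add: sM)
    define g where "g = (indicator A :: 'a \<Rightarrow> ennreal)"
    have [measurable]: "g \<in> borel_measurable borel" by (simp add: g_def)
    have "emeasure M A = (\<integral>\<^sup>+y. gauss y * (\<integral>\<^sup>+x. g x \<partial>M) \<partial>N)"
      by (simp add: nn_integral_multc gN sM g_def)
    also have "\<dots> = (\<integral>\<^sup>+y. gauss y * (\<integral>\<^sup>+x. g (y + x) \<partial>M) \<partial>N)"
    proof (intro nn_integral_cong_AE, use aN in eventually_elim)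
      fix y assume "y \<in> S"
      from tM[OF this, of g]
      show "gauss y * (\<integral>\<^sup>+x. g x \<partial>M) = gauss y * (\<integral>\<^sup>+x. g (y + x) \<partial>M)" by simp
    qed
    also have "\<dots> = (\<integral>\<^sup>+y. (\<integral>\<^sup>+x. gauss y * g (y + x) \<partial>M) \<partial>N)"
      by (rule nn_integral_cong, rule nn_integral_cmult[symmetric]) measurable
    also have "\<dots> = (\<integral>\<^sup>+x. (\<integral>\<^sup>+y. gauss y * g (y + x) \<partial>N) \<partial>M)"
      by (rule MN.Fubini') measurable
    also have "\<dots> = (\<integral>\<^sup>+x. (\<integral>\<^sup>+y. gauss (y - x) * g y \<partial>N) \<partial>M)"
    proof (intro nn_integral_cong_AE, use aM in eventually_elim)
      fix x assume "x \<in> S"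
      from tN[OF this, of "\<lambda>y. gauss (y - x) * g y"]
      show "(\<integral>\<^sup>+y. gauss y * g (y + x) \<partial>N) = (\<integral>\<^sup>+y. gauss (y - x) * g y \<partial>N)"
        by (simp add: add.commute)
    qed
    also have "\<dots> = (\<integral>\<^sup>+y. (\<integral>\<^sup>+x. gauss (y - x) * g y \<partial>M) \<partial>N)"
      by (rule MN.Fubini'[symmetric]) measurable
    also have "\<dots> = (\<integral>\<^sup>+y. (\<integral>\<^sup>+x. gauss (y - x) \<partial>M) * g y \<partial>N)"
      by (rule nn_integral_cong, rule nn_integral_multc) measurable
    also have "\<dots> = (\<integral>\<^sup>+y. g y \<partial>N)"
    proof (intro nn_integral_cong_AE, use aN in eventually_elim)
      fix y assume "y \<in> S"
      from tM[OF this, of "\<lambda>x. gauss (y - x)"]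
      show "(\<integral>\<^sup>+x. gauss (y - x) \<partial>M) * g y = g y" by (simp add: gM gauss_minus_commute[of y])
    qed
    also have "\<dots> = emeasure N A" by (simp add: sN g_def)
    finally show "emeasure M A = emeasure N A" .
  qed
qed

lemma nn_integral_gauss_real_scaled:
  assumes d: "d \<noteq> 0"
  shows "(\<integral>\<^sup>+t. gauss (t * d :: real) \<partial>lborel) = ennreal (1 / \<bar>d\<bar>)"
proof -
  define s where "s = 1 / (sqrt (2 * pi) * \<bar>d\<bar>)"
  have s: "s > 0" using d by (simp add: s_def)
  have s2: "2 * pi * s\<^sup>2 = 1 / d\<^sup>2" using d by (simp add: s_def power_mult_distrib power_divide field_simps)
  then have e: "2 * s\<^sup>2 = 1 / (pi * d\<^sup>2)" using d by (simp add: field_simps)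
  have "gauss (t * d) = ennreal (1 / \<bar>d\<bar>) * ennreal (normal_density 0 s t)" for t
    unfolding normal_density_def gauss_def using d
    by (simp add: s2 e real_sqrt_divide power_mult_distrib algebra_simps flip: ennreal_mult)
  then have "(\<integral>\<^sup>+t. gauss (t * d) \<partial>lborel) = ennreal (1 / \<bar>d\<bar>) * (\<integral>\<^sup>+t. ennreal (normal_density 0 s t) \<partial>lborel)"
    by (simp add: nn_integral_cmult)
  also have "(\<integral>\<^sup>+t. ennreal (normal_density 0 s t) \<partial>lborel) = 1"
    using integral_normal_density[OF s, of 0] integrable_normal_density[OF s, of 0]
    by (subst nn_integral_eq_integral) auto
  finally show ?thesis by simp
qed

lemma product_sigma_finite_lborel: "product_sigma_finite (\<lambda>_. lborel)"
  by (intro product_sigma_finite.intro sigma_finite_lborel)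

lemma gauss_sum:
  assumes "finite B" "pairwise orthogonal B" "\<forall>b\<in>B. norm b = 1"
  shows "gauss (\<Sum>b\<in>B. u b *\<^sub>R b) = (\<Prod>b\<in>B. gauss (u b :: real))"
proof -
  have "(norm (\<Sum>b\<in>B. u b *\<^sub>R b))\<^sup>2 = (\<Sum>b\<in>B. (norm (u b *\<^sub>R b))\<^sup>2)"
    using assms by (intro norm_sum_Pythagorean)
      (auto simp: pairwise_def orthogonal_def)
  also have "\<dots> = (\<Sum>b\<in>B. (u b)\<^sup>2)" using assms by (simp add: power_mult_distrib)
  finally show ?thesis
    using assms(1)
    by (simp add: gauss_def prod_ennreal exp_sum[symmetric] sum_distrib_left sum_negf)
qed

lemma PiM_lborel_translate:
  assumes I: "finite I"
  shows "distr (Pi\<^sub>M I (\<lambda>_. lborel)) (Pi\<^sub>M I (\<lambda>_. lborel)) (\<lambda>u. \<lambda>i\<in>I. c i + u i :: 'a::euclidean_space)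
    = Pi\<^sub>M I (\<lambda>_. lborel)"
proof -
  interpret product_sigma_finite "\<lambda>_::'i. lborel :: 'a measure" by (rule product_sigma_finite_lborel)
  show ?thesis
  proof (rule PiM_eqI)
    show "finite I" by fact
    fix A assume A: "\<And>i. i \<in> I \<Longrightarrow> A i \<in> sets (lborel :: 'a measure)"
    have tr: "(+) (c i) -` A i \<in> sets (lborel :: 'a measure)" if "i \<in> I" for i
      using measurable_sets_borel[of "(+) (c i)" borel "A i"] A[OF that] by simp
    have eq: "(\<lambda>u. \<lambda>i\<in>I. c i + u i) -` Pi\<^sub>E I A \<inter> space (Pi\<^sub>M I (\<lambda>_. lborel)) = (\<Pi>\<^sub>E i\<in>I. (+) (c i) -` A i)"
      by (auto simp: space_PiM PiE_iff)
    have "emeasure lborel ((+) (c i) -` A i) = emeasure lborel (A i)" if "i \<in> I" for i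
      using A[OF that] by (subst (2) lborel_distr_plus[of "c i", symmetric])
        (simp add: emeasure_distr)
    then show "emeasure (distr (Pi\<^sub>M I (\<lambda>_. lborel)) (Pi\<^sub>M I (\<lambda>_. lborel)) (\<lambda>u. \<lambda>i\<in>I. c i + u i)) (Pi\<^sub>E I A)
      = (\<Prod>i\<in>I. emeasure lborel (A i))"
      using A I tr by (simp add: emeasure_distr eq emeasure_PiM)
  qed simp
qed

lemma nn_integral_PiM_lborel_translate:
  fixes c :: "'i \<Rightarrow> 'a::euclidean_space"
  assumes I: "finite I" and h: "h \<in> borel_measurable (Pi\<^sub>M I (\<lambda>_. lborel))"
  shows "(\<integral>\<^sup>+u. h (\<lambda>i\<in>I. c i + u i) \<partial>Pi\<^sub>M I (\<lambda>_. lborel)) = (\<integral>\<^sup>+u. h u \<partial>Pi\<^sub>M I (\<lambda>_. lborel))"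
  using h by (subst (2) PiM_lborel_translate[OF I, of c, symmetric]) (simp add: nn_integral_distr)

section \<open>Lebesgue measure on a plane\<close>

text \<open>Lebesgue measure on the plane \<open>T\<close>, as the image of a measure on the whole space under orthogonal
  projection; across the plane a Gaussian weight of total mass one makes up for the dimensions that
  the projection collapses. No basis is chosen, so integrals over \<open>T\<close> depend on \<open>T\<close> only through the projection,
  which is what measurability in \<open>T\<close> requires.\<close>

definition flat_measure :: "'a::euclidean_space set \<Rightarrow> 'a measure" where
  "flat_measure T = distr (density lborel (\<lambda>x. gauss (x - closest_point T x))) borel (closest_point T)"

lemma sets_flat_measure[measurable_cong, simp]: "sets (flat_measure T) = sets borel"
  by (simp add: flat_measure_def)

lemma space_flat_measure[simp]: "space (flat_measure T) = UNIV"
  by (simp add: flat_measure_def)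

lemma borel_measurable_closest_point[measurable]:
  fixes T :: "'a::euclidean_space set"
  assumes "affine T" "T \<noteq> {}"
  shows "closest_point T \<in> borel_measurable borel"
  using assms by (intro borel_measurable_continuous_onI continuous_on_closest_point)
    (auto simp: affine_imp_convex affine_closed)

lemma nn_integral_flat_measure:
  assumes T: "affine T" "T \<noteq> {}" and [measurable]: "h \<in> borel_measurable borel"
  shows "(\<integral>\<^sup>+y. h y \<partial>flat_measure T) = (\<integral>\<^sup>+x. gauss (x - closest_point T x) * h (closest_point T x) \<partial>lborel)"
proof -
  note [measurable] = borel_measurable_closest_point[OF T]
  show ?thesis
    unfolding flat_measure_def by (simp add: nn_integral_distr nn_integral_density)
qed

lemma nn_integral_lborel_translate:
  "h \<in> borel_measurable borel \<Longrightarrow> (\<integral>\<^sup>+x. h (v + x) \<partial>lborel) = (\<integral>\<^sup>+x. h x \<partial>(lborel::'a::euclidean_space measure))"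
  by (rule nn_integral_haar_translate[OF lborel_distr_plus]) auto

lemma normalized_haar_UNIV: "normalized_haar UNIV (lborel :: 'a::euclidean_space measure)"
proof -
  interpret product_sigma_finite "\<lambda>_::'a. lborel :: real measure" by (rule product_sigma_finite_lborel)
  have "(\<integral>\<^sup>+x. gauss x \<partial>(lborel::'a measure)) =
    (\<integral>\<^sup>+u. (\<Prod>b\<in>Basis. gauss (u b :: real)) \<partial>(\<Pi>\<^sub>M b\<in>(Basis::'a set). lborel))"
    by (subst lborel_eq)
       (auto simp: nn_integral_distr gauss_sum pairwise_def orthogonal_def inner_Basis
          intro!: nn_integral_cong)
  also have "\<dots> = 1"
    using nn_integral_gauss_real_scaled[of 1]
    by (subst product_nn_integral_prod) auto
  finally show ?thesis
    by (simp add: normalized_haar_def sigma_finite_lborel lborel_distr_plus)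
qed

text \<open>On a ball \<open>gauss\<close> is bounded below, so a finite integral of \<open>gauss\<close> makes balls have finite
  measure.\<close>

lemma gauss_integral_imp_sigma_finite:
  fixes M :: "'a::euclidean_space measure"
  assumes sM[measurable_cong, simp]: "sets M = sets borel" and 1: "(\<integral>\<^sup>+x. gauss x \<partial>M) = 1"
  shows "sigma_finite_measure M"
proof (rule sigma_finite_measure.intro, rule exI[of _ "range (\<lambda>n::nat. ball 0 (real n))"], intro conjI ballI)
  have [simp]: "space M = UNIV" using sets_eq_imp_space_eq[OF sM] by simp
  show "\<Union> (range (\<lambda>n::nat. ball (0::'a) (real n))) = space M"
    using reals_Archimedean2 by auto
  fix a assume "a \<in> range (\<lambda>n::nat. ball (0::'a) (real n))"
  then obtain n where n: "a = ball 0 (real n)" by auto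
  have "ennreal (exp (- pi * (real n)\<^sup>2)) * emeasure M a
      = (\<integral>\<^sup>+x. ennreal (exp (- pi * (real n)\<^sup>2)) * indicator a x \<partial>M)"
    by (subst nn_integral_cmult_indicator) (auto simp: n)
  also have "\<dots> \<le> (\<integral>\<^sup>+x. gauss x \<partial>M)"
    by (intro nn_integral_mono) (auto simp: n gauss_def indicator_def intro!: power_mono)
  finally have "ennreal (exp (- pi * (real n)\<^sup>2)) * emeasure M a \<le> 1" by (simp add: 1)
  then show "emeasure M a \<noteq> \<infinity>"
    by (auto simp: ennreal_mult_eq_top_iff top_unique)
qed (auto simp: image_iff)

lemma normalized_haarI:
  assumes "sets M = sets borel" "AE x in M. x \<in> S"
    "\<And>v. v \<in> S \<Longrightarrow> distr M borel ((+) v) = M" "(\<integral>\<^sup>+x. gauss x \<partial>M) = 1"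
  shows "normalized_haar S M"
  unfolding normalized_haar_def using assms gauss_integral_imp_sigma_finite[OF assms(1,4)]
  by (intro conjI ballI)

text \<open>By Pythagoras \<open>gauss x\<close> is the product of \<open>gauss\<close> at the projection and \<open>gauss\<close> at the offset;
  the second factor is the weight, so that the normalisation is inherited.\<close>

lemma normalized_haar_project:
  fixes S :: "'a::euclidean_space set"
  assumes E: "subspace E" and S: "subspace S" and ES: "E \<subseteq> S" and M: "normalized_haar S M"
  shows "normalized_haar E (distr (density M (\<lambda>x. gauss (x - closest_point E x))) borel (closest_point E))"
    (is "normalized_haar E ?D")
proof -
  have Ea: "affine E" "E \<noteq> {}" using subspace_imp_affine[OF E] subspace_0[OF E] by auto
  note [measurable] = borel_measurable_closest_point[OF Ea] subspace_borel[OF E]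
  have sM[measurable_cong, simp]: "sets M = sets borel" using normalized_haarD(1)[OF M] .
  have [simp]: "space M = UNIV" using sets_eq_imp_space_eq[OF sM] by simp
  have D: "(\<integral>\<^sup>+y. h y \<partial>?D) = (\<integral>\<^sup>+x. gauss (x - closest_point E x) * h (closest_point E x) \<partial>M)"
    if [measurable]: "h \<in> borel_measurable borel" for h
    by (simp add: nn_integral_distr nn_integral_density)
  have 1: "(\<integral>\<^sup>+x. gauss x \<partial>?D) = 1"
    using normalized_haarD(5)[OF M] by (simp add: D mult.commute
      flip: gauss_orthogonal[OF norm_closest_point_pythagoras[OF E]])
  have 2: "AE x in ?D. x \<in> E"
    by (subst AE_distr_iff) (auto simp: closest_point_subspace_mem[OF E])
  have 3: "distr ?D borel ((+) v) = ?D" if v: "v \<in> E" for v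
  proof (rule measure_eqI)
    fix A assume "A \<in> sets (distr ?D borel ((+) v))"
    then have A[measurable]: "A \<in> sets borel" by simp
    define g where "g = (indicator A :: 'a \<Rightarrow> ennreal)"
    have [measurable]: "g \<in> borel_measurable borel" by (simp add: g_def)
    have "emeasure (distr ?D borel ((+) v)) A = (\<integral>\<^sup>+y. g y \<partial>distr ?D borel ((+) v))"
      by (simp add: g_def)
    also have "\<dots> = (\<integral>\<^sup>+y. g (v + y) \<partial>?D)" by (subst nn_integral_distr) auto
    also have "\<dots> = (\<integral>\<^sup>+x. gauss (x - closest_point E x) * g (v + closest_point E x) \<partial>M)"
      by (simp add: D)
    also have "\<dots> = (\<integral>\<^sup>+x. gauss ((v + x) - closest_point E (v + x)) * g (closest_point E (v + x)) \<partial>M)"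
      by (simp add: closest_point_add_subspace[OF E v])
    also have "\<dots> = (\<integral>\<^sup>+x. gauss (x - closest_point E x) * g (closest_point E x) \<partial>M)"
      using v ES by (intro nn_integral_haar_translate[where h="\<lambda>x. gauss (x - closest_point E x) * g (closest_point E x)"]
          normalized_haarD[OF M]) auto
    also have "\<dots> = (\<integral>\<^sup>+y. g y \<partial>?D)" by (rule D[symmetric]) measurable
    finally show "emeasure (distr ?D borel ((+) v)) A = emeasure ?D A" by (simp add: g_def)
  qed simp
  show ?thesis using 1 2 3 by (intro normalized_haarI) simp_all
qed

lemma normalized_haar_flat_measure:
  "subspace S \<Longrightarrow> normalized_haar S (flat_measure S)"
  unfolding flat_measure_def
  by (rule normalized_haar_project[OF _ subspace_UNIV _ normalized_haar_UNIV]) auto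

lemma flat_measure_project:
  assumes "subspace E" "subspace S" "E \<subseteq> S"
  shows "flat_measure E = distr (density (flat_measure S) (\<lambda>x. gauss (x - closest_point E x))) borel (closest_point E)"
  by (rule normalized_haar_unique[OF assms(1) normalized_haar_flat_measure[OF assms(1)]])
     (rule normalized_haar_project[OF assms normalized_haar_flat_measure[OF assms(2)]])

interpretation lborel_PiM: product_sigma_finite "\<lambda>_::'i. lborel :: 'a::euclidean_space measure"
  by (rule product_sigma_finite_lborel)

lemma nn_integral_flat_measure_translation:
  fixes S :: "'a::euclidean_space set"
  assumes S: "affine S" "S \<noteq> {}" and [measurable]: "h \<in> borel_measurable borel"
  shows "(\<integral>\<^sup>+y. h y \<partial>flat_measure ((+) a ` S)) = (\<integral>\<^sup>+y. h (a + y) \<partial>flat_measure S)"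
proof -
  have aS: "affine ((+) a ` S)" "(+) a ` S \<noteq> {}"
    using S affine_translation[of S a] by auto
  note [measurable] = borel_measurable_closest_point[OF S] borel_measurable_closest_point[OF aS]
  let ?k = "\<lambda>x. gauss (x - closest_point ((+) a ` S) x) * h (closest_point ((+) a ` S) x)"
  have "(\<integral>\<^sup>+y. h y \<partial>flat_measure ((+) a ` S)) = (\<integral>\<^sup>+x. ?k x \<partial>lborel)"
    by (rule nn_integral_flat_measure[OF aS]) measurable
  also have "\<dots> = (\<integral>\<^sup>+x. ?k (a + x) \<partial>lborel)"
    by (rule nn_integral_lborel_translate[symmetric]) measurable
  also have "\<dots> = (\<integral>\<^sup>+x. gauss (x - closest_point S x) * h (a + closest_point S x) \<partial>lborel)"
    by (simp add: closest_point_translation[OF S])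
  also have "\<dots> = (\<integral>\<^sup>+y. h (a + y) \<partial>flat_measure S)"
    by (rule nn_integral_flat_measure[OF S, symmetric]) measurable
  finally show ?thesis .
qed

lemma flat_measure_translation:
  fixes S :: "'a::euclidean_space set"
  assumes S: "affine S" "S \<noteq> {}"
  shows "flat_measure ((+) a ` S) = distr (flat_measure S) borel ((+) a)"
proof (rule measure_eqI)
  fix A assume "A \<in> sets (flat_measure ((+) a ` S))"
  then have A[measurable]: "A \<in> sets borel" by simp
  show "emeasure (flat_measure ((+) a ` S)) A = emeasure (distr (flat_measure S) borel ((+) a)) A"
    using nn_integral_flat_measure_translation[OF S, of "indicator A" a]
    by (simp add: nn_integral_distr[of "(+) a" _ borel "indicator A", symmetric])
qed simp

lemma ennreal_times_inverse: "x \<noteq> 0 \<Longrightarrow> x < \<infinity> \<Longrightarrow> x * inverse x = (1::ennreal)"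
  using ennreal_divide_self[of x] by (simp add: divide_ennreal_def)

section \<open>Linear combinations and the volume of a parallelepiped\<close>

definition lincomb :: "'i set \<Rightarrow> ('i \<Rightarrow> 'a::euclidean_space) \<Rightarrow> ('i \<Rightarrow> real) \<Rightarrow> 'a" where
  "lincomb I Y a = (\<Sum>i\<in>I. a i *\<^sub>R Y i)"

text \<open>The reciprocal of the volume of the parallelepiped spanned by \<open>Y\<close>; infinite exactly when \<open>Y\<close> is
  linearly dependent. The integral form makes measurability, scaling and the behaviour under
  isometries immediate.\<close>

definition inv_volume :: "'i set \<Rightarrow> ('i \<Rightarrow> 'a::euclidean_space) \<Rightarrow> ennreal" where
  "inv_volume I Y = (\<integral>\<^sup>+a. gauss (lincomb I Y a) \<partial>Pi\<^sub>M I (\<lambda>_. lborel))"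

lemma lincomb_cong: "(\<And>i. i \<in> I \<Longrightarrow> Y i = Z i) \<Longrightarrow> (\<And>i. i \<in> I \<Longrightarrow> a i = b i) \<Longrightarrow> lincomb I Y a = lincomb I Z b"
  by (simp add: lincomb_def)

lemma inv_volume_cong: "(\<And>i. i \<in> I \<Longrightarrow> Y i = Z i) \<Longrightarrow> inv_volume I Y = inv_volume I Z"
  unfolding inv_volume_def by (intro nn_integral_cong arg_cong[where f=gauss] lincomb_cong) auto

lemma lincomb_insert:
  "finite J \<Longrightarrow> j \<notin> J \<Longrightarrow> lincomb (insert j J) Y a = a j *\<^sub>R Y j + lincomb J Y a"
  by (simp add: lincomb_def)

lemma lincomb_upd: "j \<notin> J \<Longrightarrow> lincomb J (Y(j := y)) a = lincomb J Y a"
  "j \<notin> J \<Longrightarrow> lincomb J Y (a(j := t)) = lincomb J Y a"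
  by (auto simp: lincomb_def intro!: sum.cong)

lemma lincomb_add: "lincomb I Y (\<lambda>i\<in>I. c i + u i) = lincomb I Y c + lincomb I Y u"
  by (simp add: lincomb_def sum.distrib scaleR_add_left)

lemma lincomb_scale: "lincomb I Y (\<lambda>i\<in>I. r * u i) = r *\<^sub>R lincomb I Y u"
  by (simp add: lincomb_def scaleR_sum_right)

lemma span_eq_range_lincomb:
  assumes I: "finite I"
  shows "span (Y ` I) = range (lincomb I Y)"
proof (rule span_unique)
  show "Y ` I \<subseteq> range (lincomb I Y)"
  proof safe
    fix i assume i: "i \<in> I"
    have "lincomb I Y (\<lambda>j. if j = i then 1 else 0) = (\<Sum>j\<in>I. if j = i then Y j else 0)"
      unfolding lincomb_def by (intro sum.cong) auto
    then have "Y i = lincomb I Y (\<lambda>j. if j = i then 1 else 0)"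
      using i I by simp
    then show "Y i \<in> range (lincomb I Y)" by blast
  qed
  show "subspace (range (lincomb I Y))"
  proof (unfold subspace_def, intro conjI ballI allI)
    show "0 \<in> range (lincomb I Y)"
      by (rule image_eqI[of _ _ "\<lambda>_. 0"]) (simp_all add: lincomb_def)
    fix x y assume "x \<in> range (lincomb I Y)" "y \<in> range (lincomb I Y)"
    then show "x + y \<in> range (lincomb I Y)"
      by (auto simp: lincomb_add[symmetric])
  next
    fix r x assume "x \<in> range (lincomb I Y)"
    then show "r *\<^sub>R x \<in> range (lincomb I Y)"
      by (auto simp: lincomb_scale[symmetric])
  qed
  show "range (lincomb I Y) \<subseteq> T" if "Y ` I \<subseteq> T" "subspace T" for T
    using that by (auto simp: lincomb_def intro!: subspace_sum subspace_scale)
qed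

lemma lincomb_in_span: "finite I \<Longrightarrow> lincomb I Y a \<in> span (Y ` I)"
  by (auto simp: span_eq_range_lincomb)

lemma measurable_lincomb[measurable (raw)]:
  assumes "\<And>i. i \<in> I \<Longrightarrow> (\<lambda>l. f l i) \<in> borel_measurable L"
    and "\<And>i. i \<in> I \<Longrightarrow> (\<lambda>l. g l i) \<in> borel_measurable L"
  shows "(\<lambda>l. lincomb I (f l) (g l)) \<in> borel_measurable L"
  unfolding lincomb_def using assms by (intro borel_measurable_sum borel_measurable_scaleR) auto

lemma measurable_inv_volume[measurable (raw)]:
  assumes I: "finite I" and f: "\<And>i. i \<in> I \<Longrightarrow> (\<lambda>l. f l i) \<in> borel_measurable L"
  shows "(\<lambda>l. inv_volume I (f l)) \<in> borel_measurable L"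
proof -
  interpret P: sigma_finite_measure "Pi\<^sub>M I (\<lambda>_. lborel :: real measure)"
    by (rule lborel_PiM.sigma_finite[OF I])
  note [measurable] = f
  have "(\<lambda>(l, a). gauss (lincomb I (f l) a)) \<in> borel_measurable (L \<Otimes>\<^sub>M Pi\<^sub>M I (\<lambda>_. lborel))"
    unfolding lincomb_def case_prod_beta by measurable
  from P.borel_measurable_nn_integral[OF this] show ?thesis
    by (simp add: inv_volume_def)
qed

text \<open>The integral of \<open>gauss\<close> along the multiples of a vector of length \<open>d\<close>.\<close>

definition line_weight :: "real \<Rightarrow> ennreal" where
  "line_weight d = (if d = 0 then \<infinity> else ennreal (1 / \<bar>d\<bar>))"

lemma nn_integral_gauss_line: "(\<integral>\<^sup>+t. gauss (t *\<^sub>R q) \<partial>lborel) = line_weight (norm q)"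
proof (cases "q = 0")
  case True
  then show ?thesis by (simp add: line_weight_def gauss_def ennreal_mult_eq_top_iff)
next
  case False
  have "gauss (t *\<^sub>R q) = gauss (t * norm q)" for t
    by (simp add: gauss_def power_mult_distrib)
  then show ?thesis
    using False nn_integral_gauss_real_scaled[of "norm q"] by (simp add: line_weight_def)
qed

lemma line_weight_pos: "0 < line_weight d" "line_weight d \<noteq> 0"
  by (auto simp: line_weight_def)

lemma inv_volume_empty[simp]: "inv_volume {} Y = 1"
  by (simp add: inv_volume_def lincomb_def gauss_def space_PiM)

text \<open>Base times height. Translating the old coefficients replaces the new vector by its component
  orthogonal to the old span, and then the Gaussian factorises.\<close>

lemma inv_volume_insert:
  assumes J: "finite J" "j \<notin> J"
  shows "inv_volume (insert j J) Y =
    inv_volume J Y * line_weight (norm (Y j - closest_point (span (Y ` J)) (Y j)))"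
proof -
  define p where "p = closest_point (span (Y ` J)) (Y j)"
  define q where "q = Y j - p"
  have "p \<in> span (Y ` J)" unfolding p_def by (intro closest_point_subspace_mem subspace_span)
  then obtain c where c: "p = lincomb J Y c" using J by (auto simp: span_eq_range_lincomb)
  have orth: "q \<bullet> s = 0" if "s \<in> span (Y ` J)" for s
    unfolding q_def p_def by (intro closest_point_subspace_orth subspace_span that)
  have [measurable]: "(\<lambda>b. lincomb J Y b) \<in> borel_measurable (Pi\<^sub>M J (\<lambda>_. lborel))"
    by measurable
  have "inv_volume (insert j J) Y =
    (\<integral>\<^sup>+t. \<integral>\<^sup>+b. gauss (lincomb (insert j J) Y (b(j := t))) \<partial>Pi\<^sub>M J (\<lambda>_. lborel) \<partial>lborel)"
    unfolding inv_volume_def using J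
    by (intro lborel_PiM.product_nn_integral_insert_rev) (auto intro!: measurable_compose[OF _ borel_measurable_gauss] measurable_lincomb)
  also have "\<dots> = (\<integral>\<^sup>+t. gauss (t *\<^sub>R q) * inv_volume J Y \<partial>lborel)"
  proof (rule nn_integral_cong)
    fix t :: real
    have "(\<integral>\<^sup>+b. gauss (lincomb (insert j J) Y (b(j := t))) \<partial>Pi\<^sub>M J (\<lambda>_. lborel)) =
      (\<integral>\<^sup>+b. gauss (t *\<^sub>R q + lincomb J Y (\<lambda>i\<in>J. t * c i + b i)) \<partial>Pi\<^sub>M J (\<lambda>_. lborel))"
    proof (rule nn_integral_cong)
      fix b
      have "lincomb J Y (\<lambda>i\<in>J. t * c i + b i) = t *\<^sub>R p + lincomb J Y b"
        using lincomb_add[of J Y "\<lambda>i\<in>J. t * c i" b] lincomb_scale[of J Y t c]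
        by (simp add: c cong: restrict_cong)
      then show "gauss (lincomb (insert j J) Y (b(j := t))) =
        gauss (t *\<^sub>R q + lincomb J Y (\<lambda>i\<in>J. t * c i + b i))"
        by (simp add: lincomb_insert[OF J] lincomb_upd[OF J(2)] q_def scaleR_diff_right)
    qed
    also have "\<dots> = (\<integral>\<^sup>+b. gauss (t *\<^sub>R q + lincomb J Y b) \<partial>Pi\<^sub>M J (\<lambda>_. lborel))"
      by (rule nn_integral_PiM_lborel_translate[OF J(1), of "\<lambda>b. gauss (t *\<^sub>R q + lincomb J Y b)"]) measurable
    also have "\<dots> = (\<integral>\<^sup>+b. gauss (t *\<^sub>R q) * gauss (lincomb J Y b) \<partial>Pi\<^sub>M J (\<lambda>_. lborel))"
    proof (intro nn_integral_cong gauss_orthogonal)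
      fix b
      have "q \<bullet> lincomb J Y b = 0" by (intro orth lincomb_in_span J)
      then show "(norm (t *\<^sub>R q + lincomb J Y b))\<^sup>2 = (norm (t *\<^sub>R q))\<^sup>2 + (norm (lincomb J Y b))\<^sup>2"
        by (intro norm_add_Pythagorean) (simp add: orthogonal_def)
    qed
    also have "\<dots> = gauss (t *\<^sub>R q) * inv_volume J Y"
      unfolding inv_volume_def by (rule nn_integral_cmult) measurable
    finally show "(\<integral>\<^sup>+b. gauss (lincomb (insert j J) Y (b(j := t))) \<partial>Pi\<^sub>M J (\<lambda>_. lborel)) =
      gauss (t *\<^sub>R q) * inv_volume J Y" .
  qed
  also have "\<dots> = line_weight (norm q) * inv_volume J Y"
    by (subst nn_integral_multc) (auto simp: nn_integral_gauss_line)
  finally show ?thesis by (simp add: q_def p_def mult.commute)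
qed

lemma inv_volume_nonzero[simp]: "finite I \<Longrightarrow> inv_volume I Y \<noteq> 0"
  by (induction I rule: finite_induct) (auto simp: inv_volume_insert line_weight_pos)

lemma closest_point_eq_iff_span: "closest_point (span A) y = y \<longleftrightarrow> y \<in> span (A :: 'a::euclidean_space set)"
  by (metis closest_point_self closest_point_subspace_mem subspace_span)

lemma inv_volume_finite_iff:
  assumes "finite I"
  shows "inv_volume I Y < top \<longleftrightarrow> dim (Y ` I) = card I"
  using assms
proof (induction I rule: finite_induct)
  case (insert j J)
  have le: "dim (Y ` J) \<le> card J"
    using insert by (metis card_image_le dim_le_card' finite_imageI le_trans)
  show ?case
  proof (cases "Y j \<in> span (Y ` J)")
    case True
    then have "closest_point (span (Y ` J)) (Y j) = Y j" by (simp add: closest_point_eq_iff_span)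
    then show ?thesis using True insert le
      by (simp add: inv_volume_insert dim_insert line_weight_def ennreal_mult_top)
  next
    case False
    then have "Y j \<noteq> closest_point (span (Y ` J)) (Y j)" by (metis closest_point_eq_iff_span)
    then show ?thesis using False insert
      by (simp add: inv_volume_insert dim_insert line_weight_def ennreal_mult_less_top)
  qed
qed simp

text \<open>One step of Gram-Schmidt orthogonalisation. Where \<open>y\<close> lies in the span of \<open>A\<close>, the coefficient is
  \<open>0 / 0 = 0\<close> and the formula remains correct, so it can be iterated without case distinction.\<close>

lemma closest_point_span_insert:
  fixes A :: "'a::euclidean_space set"
  defines "P \<equiv> closest_point (span A)"
  shows "closest_point (span (insert y A)) x = P x + ((x \<bullet> (y - P y)) / ((y - P y) \<bullet> (y - P y))) *\<^sub>R (y - P y)"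
proof (rule closest_point_subspaceI[OF subspace_span])
  define q where "q = y - P y"
  have P: "P z \<in> span A" for z unfolding P_def by (intro closest_point_subspace_mem subspace_span)
  have PA: "P z \<in> span (insert y A)" for z
    using P[of z] span_mono[of A "insert y A"] by blast
  have q: "q \<in> span (insert y A)" unfolding q_def by (intro span_diff PA span_base) simp
  have o: "(z - P z) \<bullet> s = 0" if "s \<in> span A" for s z
    unfolding P_def by (intro closest_point_subspace_orth subspace_span that)
  have Pq: "P x \<bullet> q = 0" using o[OF P, of y x] by (simp add: q_def inner_commute)
  show "P x + ((x \<bullet> (y - P y)) / ((y - P y) \<bullet> (y - P y))) *\<^sub>R (y - P y) \<in> span (insert y A)"
    unfolding q_def[symmetric] by (intro span_add PA span_scale q)
  fix s assume "s \<in> span (insert y A)"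
  then obtain k where k: "s - k *\<^sub>R y \<in> span A" by (auto simp: span_insert)
  define r where "r = s - k *\<^sub>R y + k *\<^sub>R P y"
  have r: "r \<in> span A" unfolding r_def by (intro span_add k span_scale P)
  have s: "s = r + k *\<^sub>R q" by (simp add: r_def q_def scaleR_diff_right)
  have qr: "q \<bullet> r = 0" unfolding q_def by (rule o[OF r])
  have "((x \<bullet> q) / (q \<bullet> q)) * (q \<bullet> q) = x \<bullet> q" by simp
  then show "(x - (P x + ((x \<bullet> (y - P y)) / ((y - P y) \<bullet> (y - P y))) *\<^sub>R (y - P y))) \<bullet> s = 0"
    using o[OF r, of x] qr Pq unfolding s q_def[symmetric]
    by (simp add: inner_diff_left inner_add_left inner_add_right algebra_simps)
qed

lemma measurable_closest_point_span[measurable (raw)]: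
  assumes I: "finite I" and f: "\<And>i. i \<in> I \<Longrightarrow> (\<lambda>l. f l i) \<in> borel_measurable L"
    and g: "g \<in> borel_measurable L"
  shows "(\<lambda>l. closest_point (span (f l ` I)) (g l :: 'a::euclidean_space)) \<in> borel_measurable L"
  using I f g
proof (induction I arbitrary: g rule: finite_induct)
  case empty
  have "closest_point {0} x = 0" for x :: 'a
    using closest_point_subspace_mem[of "{0}" x] by (simp add: subspace_def)
  then show ?case by simp
next
  case (insert j J)
  have [measurable]: "(\<lambda>l. f l j) \<in> borel_measurable L" using insert.prems by simp
  have [measurable]: "(\<lambda>l. closest_point (span (f l ` J)) (f l j)) \<in> borel_measurable L"
    by (rule insert.IH) (use insert.prems in auto)
  have [measurable]: "(\<lambda>l. closest_point (span (f l ` J)) (g l)) \<in> borel_measurable L"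
    by (rule insert.IH) (use insert.prems in auto)
  have [measurable]: "g \<in> borel_measurable L" by fact
  show ?case by (simp add: closest_point_span_insert)
qed

text \<open>The coefficient measure is invariant under translations by the span because translations of the
  coefficients realise them. Normalising it costs the factor \<open>inv_volume I Y\<close>, which by uniqueness is therefore
  the Jacobian of the parametrisation.\<close>

lemma normalized_haar_lincomb:
  fixes Y :: "'i \<Rightarrow> 'a::euclidean_space"
  assumes I: "finite I" and fin: "inv_volume I Y < top"
  shows "normalized_haar (span (Y ` I))
    (density (distr (Pi\<^sub>M I (\<lambda>_. lborel)) borel (lincomb I Y)) (\<lambda>_. inverse (inv_volume I Y)))"
    (is "normalized_haar ?S ?D")
proof (rule normalized_haarI)
  have [measurable]: "lincomb I Y \<in> borel_measurable (Pi\<^sub>M I (\<lambda>_. lborel))"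
    by measurable
  have D: "(\<integral>\<^sup>+y. h y \<partial>?D) = inverse (inv_volume I Y) * (\<integral>\<^sup>+a. h (lincomb I Y a) \<partial>Pi\<^sub>M I (\<lambda>_. lborel))"
    if [measurable]: "h \<in> borel_measurable borel" for h
    by (simp add: nn_integral_density nn_integral_distr nn_integral_cmult)
  show "sets ?D = sets borel" by simp
  have "span (Y ` I) \<in> sets borel" by (intro subspace_borel subspace_span)
  then have "AE x in distr (Pi\<^sub>M I (\<lambda>_. lborel)) borel (lincomb I Y). x \<in> ?S"
    by (subst AE_distr_iff) (auto simp: lincomb_in_span[OF I])
  then show "AE x in ?D. x \<in> ?S"
    by (subst AE_density) auto
  show "(\<integral>\<^sup>+x. gauss x \<partial>?D) = 1"
    using fin I by (subst D) (auto simp flip: inv_volume_def simp: mult.commute ennreal_times_inverse)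
  fix v assume "v \<in> ?S"
  then obtain c where c: "v = lincomb I Y c" by (auto simp: span_eq_range_lincomb[OF I])
  show "distr ?D borel ((+) v) = ?D"
  proof (rule measure_eqI)
    fix A assume "A \<in> sets (distr ?D borel ((+) v))"
    then have [measurable]: "A \<in> sets borel" by simp
    define g where "g = (indicator A :: 'a \<Rightarrow> ennreal)"
    have [measurable]: "g \<in> borel_measurable borel" by (simp add: g_def)
    have "emeasure (distr ?D borel ((+) v)) A = (\<integral>\<^sup>+y. g y \<partial>distr ?D borel ((+) v))" by (simp add: g_def)
    also have "\<dots> = (\<integral>\<^sup>+y. g (v + y) \<partial>?D)" by (subst nn_integral_distr) auto
    also have "\<dots> = inverse (inv_volume I Y) * (\<integral>\<^sup>+a. g (lincomb I Y (\<lambda>i\<in>I. c i + a i)) \<partial>Pi\<^sub>M I (\<lambda>_. lborel))"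
      by (simp add: D c lincomb_add)
    also have "\<dots> = inverse (inv_volume I Y) * (\<integral>\<^sup>+a. g (lincomb I Y a) \<partial>Pi\<^sub>M I (\<lambda>_. lborel))"
      by (subst nn_integral_PiM_lborel_translate[OF I, of "\<lambda>a. g (lincomb I Y a)"]) auto
    also have "\<dots> = (\<integral>\<^sup>+y. g y \<partial>?D)" by (rule D[symmetric]) measurable
    finally show "emeasure (distr ?D borel ((+) v)) A = emeasure ?D A" by (simp add: g_def)
  qed simp
qed

lemma flat_measure_span:
  assumes "finite I" "inv_volume I Y < top"
  shows "flat_measure (span (Y ` I)) =
    density (distr (Pi\<^sub>M I (\<lambda>_. lborel)) borel (lincomb I Y)) (\<lambda>_. inverse (inv_volume I Y))"
  by (rule normalized_haar_unique[OF subspace_span normalized_haar_flat_measure[OF subspace_span]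
        normalized_haar_lincomb[OF assms]])

lemma nn_integral_lincomb:
  assumes I: "finite I" and fin: "inv_volume I Y < top" and [measurable]: "h \<in> borel_measurable borel"
  shows "(\<integral>\<^sup>+a. h (lincomb I Y a) \<partial>Pi\<^sub>M I (\<lambda>_. lborel)) = inv_volume I Y * (\<integral>\<^sup>+y. h y \<partial>flat_measure (span (Y ` I)))"
proof -
  have [measurable]: "lincomb I Y \<in> borel_measurable (Pi\<^sub>M I (\<lambda>_. lborel))"
    by measurable
  have "inv_volume I Y * inverse (inv_volume I Y) = 1"
    using I fin by (simp add: ennreal_times_inverse)
  then show ?thesis
    unfolding flat_measure_span[OF I fin]
    by (simp add: nn_integral_density nn_integral_distr nn_integral_cmult flip: mult.assoc)
qed

section \<open>Null sets\<close>

lemma flat_measure_UNIV: "flat_measure UNIV = (lborel :: 'a::euclidean_space measure)"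
  by (rule normalized_haar_unique[OF subspace_UNIV normalized_haar_flat_measure[OF subspace_UNIV] normalized_haar_UNIV])

text \<open>Projecting \<open>S\<close> onto a line of \<open>S\<close> orthogonal to \<open>E\<close> sends \<open>E\<close> to the origin, a null set of the
  line.\<close>

lemma AE_flat_measure_not_in_subspace:
  fixes S :: "'a::euclidean_space set"
  assumes S: "subspace S" and E: "subspace E" and v: "v \<in> S" "v \<notin> E" and ES: "E \<subseteq> S"
  shows "AE z in flat_measure S. z \<notin> E"
proof -
  define w where "w = v - closest_point E v"
  have "w \<in> S" unfolding w_def using v ES closest_point_subspace_mem[OF E, of v] by (intro subspace_diff[OF S]) auto
  have "w \<noteq> 0" using v closest_point_subspace_mem[OF E, of v] by (auto simp: w_def)
  have wE: "w \<bullet> s = 0" if "s \<in> E" for s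
    unfolding w_def by (intro closest_point_subspace_orth E that)
  define L where "L = span ((\<lambda>_::nat. w) ` {0::nat})"
  have L: "subspace L" "L \<subseteq> S" using \<open>w \<in> S\<close> S unfolding L_def by (simp, intro span_minimal) auto
  have LA: "affine L" "L \<noteq> {}" using L subspace_0[of L] by (auto intro: subspace_imp_affine)
  note [measurable] = borel_measurable_closest_point[OF LA]
  have fin: "inv_volume {0::nat} (\<lambda>_. w) < top"
    using \<open>w \<noteq> 0\<close> by (subst inv_volume_finite_iff) auto
  have z: "closest_point L z = 0" if "z \<in> E" for z
    using wE[OF that] by (intro closest_point_subspaceI[OF L(1)] subspace_0[OF L(1)])
      (auto simp: L_def span_singleton inner_commute)
  have "(\<integral>\<^sup>+y. indicator {0} y \<partial>flat_measure L) = 0"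
  proof -
    have "inv_volume {0::nat} (\<lambda>_. w) * (\<integral>\<^sup>+y. indicator {0} y \<partial>flat_measure L) =
       (\<integral>\<^sup>+a. indicator {0} (lincomb {0::nat} (\<lambda>_. w) a) \<partial>Pi\<^sub>M {0::nat} (\<lambda>_. lborel))"
      unfolding L_def by (rule nn_integral_lincomb[OF _ fin, symmetric]) auto
    also have "\<dots> = (\<integral>\<^sup>+a. indicator {0} (a 0 :: real) \<partial>Pi\<^sub>M {0::nat} (\<lambda>_. lborel))"
      using \<open>w \<noteq> 0\<close> by (intro nn_integral_cong) (auto simp: lincomb_def indicator_def)
    also have "\<dots> = 0"
      by (subst lborel_PiM.product_nn_integral_singleton) auto
    finally show ?thesis by simp
  qed
  then have "(\<integral>\<^sup>+z. gauss (z - closest_point L z) * indicator {0} (closest_point L z) \<partial>flat_measure S) = 0"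
    unfolding flat_measure_project[OF L(1) S L(2)]
    by (simp add: nn_integral_distr nn_integral_density del: nn_integral_indicator)
  then have "AE z in flat_measure S. gauss (z - closest_point L z) * indicator {0} (closest_point L z) = 0"
    by (subst (asm) nn_integral_0_iff_AE) auto
  then show ?thesis
    by eventually_elim (use z in auto)
qed

lemma sigma_finite_flat_measure: "subspace S \<Longrightarrow> sigma_finite_measure (flat_measure S)"
  using normalized_haarD(2)[OF normalized_haar_flat_measure] .

section \<open>Products of invariant measures\<close>

text \<open>The common source of the substitution rules for tuples below: scaling, translation, rotation,
  projection and Gaussian weights all act on one component at a time.\<close>

lemma PiM_eq_distr_density:
  assumes I: "finite I" and M: "product_sigma_finite M" and K: "product_sigma_finite K"
    and T: "\<And>i. T i \<in> M i \<rightarrow>\<^sub>M K i" and w: "\<And>i. w i \<in> borel_measurable (M i)"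
    and eq: "\<And>i h. h \<in> borel_measurable (K i) \<Longrightarrow> (\<integral>\<^sup>+y. h y \<partial>K i) = (\<integral>\<^sup>+x. w i x * h (T i x) \<partial>M i)"
  shows "Pi\<^sub>M I K = distr (density (Pi\<^sub>M I M) (\<lambda>x. \<Prod>i\<in>I. w i (x i))) (Pi\<^sub>M I K) (\<lambda>x. \<lambda>i\<in>I. T i (x i))"
    (is "_ = ?D")
proof -
  interpret M: product_sigma_finite M by fact
  interpret K: product_sigma_finite K by fact
  note [measurable] = T w
  show ?thesis
  proof (rule K.PiM_eqI[symmetric])
    show "finite I" "sets ?D = sets (Pi\<^sub>M I K)" using I by simp_all
    fix A assume A: "\<And>i. i \<in> I \<Longrightarrow> A i \<in> sets (K i)"
    then have PA[measurable]: "Pi\<^sub>E I A \<in> sets (Pi\<^sub>M I K)" using I by (intro sets_PiM_I_finite) auto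
    have "emeasure ?D (Pi\<^sub>E I A) = (\<integral>\<^sup>+y. indicator (Pi\<^sub>E I A) y \<partial>?D)" by simp
    also have "\<dots> = (\<integral>\<^sup>+x. (\<Prod>i\<in>I. w i (x i)) * indicator (Pi\<^sub>E I A) (\<lambda>i\<in>I. T i (x i)) \<partial>Pi\<^sub>M I M)"
      by (simp add: nn_integral_distr nn_integral_density del: nn_integral_indicator)
    also have "\<dots> = (\<integral>\<^sup>+x. (\<Prod>i\<in>I. w i (x i) * indicator (A i) (T i (x i))) \<partial>Pi\<^sub>M I M)"
    proof (rule nn_integral_cong)
      fix x
      have "indicator (Pi\<^sub>E I A) (\<lambda>i\<in>I. T i (x i)) = (\<Prod>i\<in>I. indicator (A i) (T i (x i)) :: ennreal)"
      proof (cases "\<forall>i\<in>I. T i (x i) \<in> A i")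
        case False
        then obtain i where "i \<in> I" "T i (x i) \<notin> A i" by auto
        then have "(\<Prod>i\<in>I. indicator (A i) (T i (x i)) :: ennreal) = 0"
          using I by (intro prod_zero) (auto intro!: bexI[of _ i])
        moreover have "(\<lambda>i\<in>I. T i (x i)) \<notin> Pi\<^sub>E I A" using \<open>i \<in> I\<close> \<open>T i (x i) \<notin> A i\<close> by auto
        ultimately show ?thesis by simp
      qed (auto simp: PiE_iff)
      then show "(\<Prod>i\<in>I. w i (x i)) * indicator (Pi\<^sub>E I A) (\<lambda>i\<in>I. T i (x i)) =
        (\<Prod>i\<in>I. w i (x i) * indicator (A i) (T i (x i)))"
        by (simp add: prod.distrib)
    qed
    also have "\<dots> = (\<Prod>i\<in>I. \<integral>\<^sup>+x. w i x * indicator (A i) (T i x) \<partial>M i)"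
    proof (rule M.product_nn_integral_prod[OF I])
      fix i assume "i \<in> I"
      note [measurable] = A[OF this]
      show "(\<lambda>x. w i x * indicator (A i) (T i x)) \<in> borel_measurable (M i)" by measurable
    qed
    also have "\<dots> = (\<Prod>i\<in>I. emeasure (K i) (A i))"
      using A by (intro prod.cong refl) (simp flip: eq)
    finally show "emeasure ?D (Pi\<^sub>E I A) = (\<Prod>i\<in>I. emeasure (K i) (A i))" .
  qed
qed

lemma nn_integral_PiM_lborel_scale:
  assumes J: "finite J" and r: "r \<noteq> 0" and k[measurable]: "k \<in> borel_measurable (Pi\<^sub>M J (\<lambda>_. lborel))"
  shows "(\<integral>\<^sup>+b. k b \<partial>Pi\<^sub>M J (\<lambda>_. lborel)) =
    ennreal (\<bar>r\<bar> ^ card J) * (\<integral>\<^sup>+b. k (\<lambda>i\<in>J. r * b i :: real) \<partial>Pi\<^sub>M J (\<lambda>_. lborel))"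
proof -
  have "Pi\<^sub>M J (\<lambda>_. lborel) = distr (density (Pi\<^sub>M J (\<lambda>_. lborel)) (\<lambda>x. \<Prod>i\<in>J. ennreal \<bar>r\<bar>))
      (Pi\<^sub>M J (\<lambda>_. lborel)) (\<lambda>x. \<lambda>i\<in>J. r * x i)"
  proof (rule PiM_eq_distr_density[OF J product_sigma_finite_lborel product_sigma_finite_lborel])
    fix h :: "real \<Rightarrow> ennreal" assume "h \<in> borel_measurable lborel"
    then have [measurable]: "h \<in> borel_measurable borel" by simp
    show "(\<integral>\<^sup>+y. h y \<partial>lborel) = (\<integral>\<^sup>+x. ennreal \<bar>r\<bar> * h (r * x) \<partial>lborel)"
      using nn_integral_real_affine[of h r 0] r by (simp add: nn_integral_cmult)
  qed auto
  then have "(\<integral>\<^sup>+b. k b \<partial>Pi\<^sub>M J (\<lambda>_. lborel)) = (\<integral>\<^sup>+b. k b \<partial>distr (density (Pi\<^sub>M J (\<lambda>_. lborel)) (\<lambda>x. \<Prod>i\<in>J. ennreal \<bar>r\<bar>))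
      (Pi\<^sub>M J (\<lambda>_. lborel)) (\<lambda>x. \<lambda>i\<in>J. r * x i))" by simp
  also have "\<dots> = ennreal (\<bar>r\<bar> ^ card J) * (\<integral>\<^sup>+b. k (\<lambda>i\<in>J. r * b i :: real) \<partial>Pi\<^sub>M J (\<lambda>_. lborel))"
    using J by (simp add: nn_integral_distr nn_integral_density nn_integral_cmult ennreal_power)
  finally show ?thesis .
qed

lemma sigma_finite_flat_measure_affine:
  fixes T :: "'a::euclidean_space set"
  assumes T: "affine T" "T \<noteq> {}"
  shows "sigma_finite_measure (flat_measure T)"
proof -
  obtain a where a: "a \<in> T" using T by blast
  have "sigma_finite_measure (distr (flat_measure T) borel ((+) (-a)))"
    using sigma_finite_flat_measure[OF affine_diffs_subspace[OF T(1) a]]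
    unfolding flat_measure_translation[OF T, symmetric] by simp
  then show ?thesis by (rule sigma_finite_measure_distr) simp
qed

lemma product_sigma_finite_flat_measure:
  "affine T \<Longrightarrow> T \<noteq> {} \<Longrightarrow> product_sigma_finite (\<lambda>_. flat_measure (T :: 'a::euclidean_space set))"
  by (intro product_sigma_finite.intro sigma_finite_flat_measure_affine)

lemma product_sigma_finite_flat_measure_subspace:
  "subspace T \<Longrightarrow> product_sigma_finite (\<lambda>_. flat_measure (T :: 'a::euclidean_space set))"
  by (intro product_sigma_finite.intro sigma_finite_flat_measure)

lemma PiM_flat_measure:
  fixes T :: "'a::euclidean_space set"
  assumes I: "finite I" and T: "affine T" "T \<noteq> {}"
  shows "Pi\<^sub>M I (\<lambda>_. flat_measure T) =
    distr (density (Pi\<^sub>M I (\<lambda>_. lborel)) (\<lambda>x. \<Prod>i\<in>I. gauss (x i - closest_point T (x i))))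
      (Pi\<^sub>M I (\<lambda>_. flat_measure T)) (\<lambda>x. \<lambda>i\<in>I. closest_point T (x i))"
proof -
  note [measurable] = borel_measurable_closest_point[OF T]
  show ?thesis
    by (rule PiM_eq_distr_density[OF I product_sigma_finite_lborel product_sigma_finite_flat_measure[OF T]])
       (auto intro!: nn_integral_flat_measure[OF T])
qed

lemma nn_integral_PiM_flat_measure:
  fixes T :: "'a::euclidean_space set"
  assumes I: "finite I" and T: "affine T" "T \<noteq> {}"
    and [measurable]: "G \<in> borel_measurable (Pi\<^sub>M I (\<lambda>_. borel))"
  shows "(\<integral>\<^sup>+x. G x \<partial>Pi\<^sub>M I (\<lambda>_. flat_measure T)) =
    (\<integral>\<^sup>+x. (\<Prod>i\<in>I. gauss (x i - closest_point T (x i))) * G (\<lambda>i\<in>I. closest_point T (x i)) \<partial>Pi\<^sub>M I (\<lambda>_. lborel))"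
proof -
  note [measurable] = borel_measurable_closest_point[OF T]
  show ?thesis
    by (subst PiM_flat_measure[OF I T]) (simp add: nn_integral_distr nn_integral_density)
qed

text \<open>A plane is encoded by its projection, as in the \<open>\<sigma>\<close>-algebra on the Grassmannian; this form covers
  planes that are given as points of a Grassmannian as well as spans of measurable tuples.\<close>

definition flat_family :: "'m measure \<Rightarrow> ('m \<Rightarrow> 'a::euclidean_space set) \<Rightarrow> bool" where
  "flat_family M T \<longleftrightarrow> (\<forall>x. (\<lambda>m. closest_point (T m) x) \<in> borel_measurable M) \<and>
     (\<forall>m\<in>space M. affine (T m) \<and> T m \<noteq> {})"

lemma flat_familyD:
  assumes "flat_family M T"
  shows "(\<lambda>m. closest_point (T m) x) \<in> borel_measurable M"
    "m \<in> space M \<Longrightarrow> affine (T m)" "m \<in> space M \<Longrightarrow> T m \<noteq> {}"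
  using assms by (auto simp: flat_family_def)

lemma flat_family_compose:
  "flat_family M T \<Longrightarrow> f \<in> L \<rightarrow>\<^sub>M M \<Longrightarrow> flat_family L (\<lambda>l. T (f l))"
  unfolding flat_family_def
  using measurable_compose[of f L M "\<lambda>m. closest_point (T m) _" borel] measurable_space[of f L M] by blast

lemma measurable_closest_point_family:
  assumes T: "flat_family M T" and "f \<in> L \<rightarrow>\<^sub>M M" and "g \<in> borel_measurable L"
  shows "(\<lambda>l. closest_point (T (f l)) (g l)) \<in> borel_measurable L"
  by (rule measurable_closest_point_pair[OF flat_familyD(1)[OF T] _ assms(2,3)])
     (simp add: flat_familyD[OF T])

lemma flat_family_span:
  assumes "finite I" "\<And>i. i \<in> I \<Longrightarrow> (\<lambda>l. f l i) \<in> borel_measurable L"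
  shows "flat_family L (\<lambda>l. span (f l ` I))"
  unfolding flat_family_def
proof (intro conjI allI ballI)
  show "(\<lambda>l. closest_point (span (f l ` I)) x) \<in> borel_measurable L" for x
    using assms by (intro measurable_closest_point_span) auto
  show "span (f l ` I) \<noteq> {}" for l using span_zero[of "f l ` I"] by blast
qed (simp add: subspace_imp_affine)

lemma measurable_nn_integral_PiM_flat_measure:
  fixes T :: "'m \<Rightarrow> 'a::euclidean_space set"
  assumes I: "finite I" and T: "flat_family M T"
    and [measurable]: "(\<lambda>(m, x). G m x) \<in> borel_measurable (M \<Otimes>\<^sub>M Pi\<^sub>M I (\<lambda>_. borel))"
  shows "(\<lambda>m. \<integral>\<^sup>+x. G m x \<partial>Pi\<^sub>M I (\<lambda>_. flat_measure (T m))) \<in> borel_measurable M"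
proof -
  interpret P: sigma_finite_measure "Pi\<^sub>M I (\<lambda>_. lborel :: 'a measure)"
    by (rule lborel_PiM.sigma_finite[OF I])
  have [measurable]: "(\<lambda>p. closest_point (T (fst p)) (snd p i)) \<in> borel_measurable (M \<Otimes>\<^sub>M Pi\<^sub>M I (\<lambda>_. lborel))"
    if "i \<in> I" for i
    using that by (intro measurable_closest_point_family[OF T]) auto
  have "(\<lambda>m. \<integral>\<^sup>+x. (\<Prod>i\<in>I. gauss (x i - closest_point (T m) (x i))) * G m (\<lambda>i\<in>I. closest_point (T m) (x i)) \<partial>Pi\<^sub>M I (\<lambda>_. lborel))
    \<in> borel_measurable M"
    by (rule P.borel_measurable_nn_integral) (simp add: case_prod_beta, measurable)
  then show ?thesis
  proof (rule measurable_cong[THEN iffD1, rotated])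
    fix m assume m: "m \<in> space M"
    have [measurable]: "G m \<in> borel_measurable (Pi\<^sub>M I (\<lambda>_. borel))"
      using measurable_Pair2[OF assms(3) m] by simp
    show "(\<integral>\<^sup>+x. (\<Prod>i\<in>I. gauss (x i - closest_point (T m) (x i))) * G m (\<lambda>i\<in>I. closest_point (T m) (x i)) \<partial>Pi\<^sub>M I (\<lambda>_. lborel))
      = (\<integral>\<^sup>+x. G m x \<partial>Pi\<^sub>M I (\<lambda>_. flat_measure (T m)))"
      by (rule nn_integral_PiM_flat_measure[OF I flat_familyD(2,3)[OF T m], symmetric]) measurable
  qed
qed

lemma measurable_nn_integral_flat_measure:
  assumes T: "flat_family M T"
    and [measurable]: "(\<lambda>(m, x). G m x) \<in> borel_measurable (M \<Otimes>\<^sub>M borel)"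
  shows "(\<lambda>m. \<integral>\<^sup>+x. G m x \<partial>flat_measure (T m)) \<in> borel_measurable M"
proof -
  have [measurable]: "(\<lambda>p. closest_point (T (fst p)) (snd p)) \<in> borel_measurable (M \<Otimes>\<^sub>M lborel)"
    by (intro measurable_closest_point_family[OF T]) auto
  have "(\<lambda>m. \<integral>\<^sup>+x. gauss (x - closest_point (T m) x) * G m (closest_point (T m) x) \<partial>lborel)
    \<in> borel_measurable M"
    by (rule lborel.borel_measurable_nn_integral) (simp add: case_prod_beta, measurable)
  then show ?thesis
  proof (rule measurable_cong[THEN iffD1, rotated])
    fix m assume m: "m \<in> space M"
    have [measurable]: "G m \<in> borel_measurable borel"
      using measurable_Pair2[OF assms(2) m] by simp
    show "(\<integral>\<^sup>+x. gauss (x - closest_point (T m) x) * G m (closest_point (T m) x) \<partial>lborel)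
      = (\<integral>\<^sup>+x. G m x \<partial>flat_measure (T m))"
      by (rule nn_integral_flat_measure[OF flat_familyD(2,3)[OF T m], symmetric]) measurable
  qed
qed

section \<open>Almost every tuple is linearly independent\<close>

lemma AE_PiM_insert:
  assumes M: "product_sigma_finite M" and I: "finite I" "i \<notin> I"
    and P[measurable]: "Measurable.pred (Pi\<^sub>M (insert i I) M) P"
    and ae: "AE x in Pi\<^sub>M I M. AE y in M i. P (x(i := y))"
  shows "AE x in Pi\<^sub>M (insert i I) M. P x"
proof -
  interpret product_sigma_finite M by fact
  interpret pair_sigma_finite "Pi\<^sub>M I M" "M i"
    using sigma_finite[OF I(1)] sigma_finite_measures[of i] by (simp add: pair_sigma_finite_def)
  let ?h = "\<lambda>x. indicator {x. \<not> P x} x :: ennreal"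
  have hm: "?h \<in> borel_measurable (Pi\<^sub>M (insert i I) M)"
    unfolding indicator_def by measurable
  have "(\<integral>\<^sup>+x. ?h x \<partial>Pi\<^sub>M (insert i I) M) = (\<integral>\<^sup>+x. \<integral>\<^sup>+y. ?h (x(i := y)) \<partial>M i \<partial>Pi\<^sub>M I M)"
    by (rule product_nn_integral_insert[OF I hm])
  also have "\<dots> = (\<integral>\<^sup>+x. 0 \<partial>Pi\<^sub>M I M)"
  proof (intro nn_integral_cong_AE, use ae in eventually_elim)
    fix x assume "AE y in M i. P (x(i := y))"
    then have "(\<integral>\<^sup>+y. ?h (x(i := y)) \<partial>M i) = (\<integral>\<^sup>+y. 0 \<partial>M i)"
    proof (intro nn_integral_cong_AE, eventually_elim)
      fix y assume "P (x(i := y))"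
      then show "?h (x(i := y)) = 0" by simp
    qed
    then show "(\<integral>\<^sup>+y. ?h (x(i := y)) \<partial>M i) = 0" by simp
  qed
  finally have "(\<integral>\<^sup>+x. ?h x \<partial>Pi\<^sub>M (insert i I) M) = 0" by simp
  then have "AE x in Pi\<^sub>M (insert i I) M. ?h x = 0"
    using nn_integral_0_iff_AE[OF hm] by simp
  then show ?thesis
  proof eventually_elim
    fix x assume "?h x = 0" then show "P x" by (cases "P x") simp_all
  qed
qed

text \<open>Choose the vectors one at a time: each has to avoid the span of the earlier ones, a proper
  subspace as long as their number is below the dimension.\<close>

lemma AE_PiM_flat_measure_independent:
  fixes S :: "'a::euclidean_space set"
  assumes S: "subspace S" and I: "finite I" "card I \<le> dim S"
  shows "AE Y in Pi\<^sub>M I (\<lambda>_. flat_measure S). (\<forall>i\<in>I. Y i \<in> S) \<and> inv_volume I Y < top"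
  using I
proof (induction I rule: finite_induct)
  case empty
  show ?case by simp
next
  case (insert j J)
  note [measurable] = subspace_borel[OF S]
  interpret product_sigma_finite "\<lambda>_. flat_measure S"
    by (rule product_sigma_finite_flat_measure_subspace[OF S])
  have J: "finite (insert j J)" using insert by simp
  show ?case
  proof (rule AE_PiM_insert[OF product_sigma_finite_flat_measure_subspace[OF S] insert.hyps])
    show "Measurable.pred (Pi\<^sub>M (insert j J) (\<lambda>_. flat_measure S)) (\<lambda>Y. (\<forall>i\<in>insert j J. Y i \<in> S) \<and> inv_volume (insert j J) Y < top)"
      using J by measurable
    have "AE X in Pi\<^sub>M J (\<lambda>_. flat_measure S). (\<forall>i\<in>J. X i \<in> S) \<and> inv_volume J X < top"
      using insert by simp
    then show "AE X in Pi\<^sub>M J (\<lambda>_. flat_measure S). AE y in flat_measure S.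
      (\<forall>i\<in>insert j J. (X(j := y)) i \<in> S) \<and> inv_volume (insert j J) (X(j := y)) < top"
    proof eventually_elim
      fix X assume X: "(\<forall>i\<in>J. X i \<in> S) \<and> inv_volume J X < top"
      let ?E = "span (X ` J)"
      have dE: "dim ?E = card J" using X insert.hyps by (simp add: inv_volume_finite_iff)
      have ES: "?E \<subseteq> S" using X S by (intro span_minimal) auto
      have "?E \<noteq> S" using dE insert by auto
      then obtain v where v: "v \<in> S" "v \<notin> ?E" using ES by blast
      have "AE y in flat_measure S. y \<notin> ?E"
        by (rule AE_flat_measure_not_in_subspace[OF S subspace_span v ES])
      moreover have "AE y in flat_measure S. y \<in> S"
        by (rule normalized_haarD(3)[OF normalized_haar_flat_measure[OF S]])
      ultimately show "AE y in flat_measure S.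
        (\<forall>i\<in>insert j J. (X(j := y)) i \<in> S) \<and> inv_volume (insert j J) (X(j := y)) < top"
      proof eventually_elim
        fix y assume y: "y \<notin> ?E" "y \<in> S"
        have im: "(X(j := y)) ` insert j J = insert y (X ` J)" using insert.hyps by (auto simp: image_iff)
        have "inv_volume (insert j J) (X(j := y)) < top"
          unfolding inv_volume_finite_iff[OF J] im
          using y dE insert.hyps by (simp add: dim_insert)
        then show "(\<forall>i\<in>insert j J. (X(j := y)) i \<in> S) \<and> inv_volume (insert j J) (X(j := y)) < top"
          using X y insert.hyps by auto
      qed
    qed
  qed
qed

lemma AE_lborel_independent:
  assumes "finite I" "card I \<le> DIM('a::euclidean_space)"
  shows "AE Y in Pi\<^sub>M I (\<lambda>_. lborel :: 'a measure). inv_volume I Y < top"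
  using AE_PiM_flat_measure_independent[of "UNIV :: 'a set" I] assms
  unfolding flat_measure_UNIV by simp

section \<open>Exchanging a vector of a tuple with a vector of its span\<close>

lemma nn_integral_multiplicative_haar_scale:
  fixes \<psi> :: "real \<Rightarrow> ennreal"
  assumes [measurable]: "\<psi> \<in> borel_measurable borel" and r: "r \<noteq> 0"
  shows "(\<integral>\<^sup>+t. \<psi> (r * t) * ennreal (1 / \<bar>t\<bar>) \<partial>lborel) = (\<integral>\<^sup>+t. \<psi> t * ennreal (1 / \<bar>t\<bar>) \<partial>lborel)"
proof -
  have "(\<integral>\<^sup>+t. \<psi> t * ennreal (1 / \<bar>t\<bar>) \<partial>lborel) = ennreal \<bar>r\<bar> * (\<integral>\<^sup>+t. \<psi> (r * t) * ennreal (1 / \<bar>r * t\<bar>) \<partial>lborel)"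
    using nn_integral_real_affine[of "\<lambda>t. \<psi> t * ennreal (1 / \<bar>t\<bar>)" r 0] r by simp
  also have "\<dots> = (\<integral>\<^sup>+t. \<psi> (r * t) * (ennreal \<bar>r\<bar> * ennreal (1 / \<bar>r * t\<bar>)) \<partial>lborel)"
    by (subst nn_integral_cmult[symmetric]) (auto simp: ac_simps)
  also have "\<dots> = (\<integral>\<^sup>+t. \<psi> (r * t) * ennreal (1 / \<bar>t\<bar>) \<partial>lborel)"
  proof (rule nn_integral_cong)
    fix t
    have "ennreal \<bar>r\<bar> * ennreal (1 / \<bar>r * t\<bar>) = ennreal (1 / \<bar>t\<bar>)"
      using r by (simp add: abs_mult flip: ennreal_mult)
    then show "\<psi> (r * t) * (ennreal \<bar>r\<bar> * ennreal (1 / \<bar>r * t\<bar>)) = \<psi> (r * t) * ennreal (1 / \<bar>t\<bar>)"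
      by simp
  qed
  finally show ?thesis ..
qed

text \<open>Inversion preserves a measure on the multiplicative group that is invariant under scaling:
  integrate against an auxiliary function of total mass one and use scaling twice.\<close>

lemma nn_integral_multiplicative_haar_inverse:
  fixes \<phi> :: "real \<Rightarrow> ennreal"
  assumes [measurable]: "\<phi> \<in> borel_measurable borel"
  shows "(\<integral>\<^sup>+t. \<phi> (1 / t) * ennreal (1 / \<bar>t\<bar>) \<partial>lborel) = (\<integral>\<^sup>+t. \<phi> t * ennreal (1 / \<bar>t\<bar>) \<partial>lborel)"
proof -
  define w where "w t = ennreal (1 / \<bar>t::real\<bar>)" for t
  have [measurable]: "w \<in> borel_measurable borel" unfolding w_def by measurable
  \<comment> \<open>Any function with integral one against \<open>dt / |t|\<close> will do.\<close>
  define \<psi> :: "real \<Rightarrow> ennreal" where "\<psi> t = ennreal \<bar>t\<bar> * indicator {0<..1} t" for t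
  have [measurable]: "\<psi> \<in> borel_measurable borel" unfolding \<psi>_def by measurable
  have "(\<integral>\<^sup>+t. \<psi> t * w t \<partial>lborel) = (\<integral>\<^sup>+t. indicator {0<..1::real} t \<partial>lborel)"
    by (intro nn_integral_cong) (auto simp: \<psi>_def w_def indicator_def simp flip: ennreal_mult)
  then have \<psi>1: "(\<integral>\<^sup>+t. \<psi> t * w t \<partial>lborel) = 1" by simp
  have scale: "(\<integral>\<^sup>+t. f (r * t) * w t \<partial>lborel) = (\<integral>\<^sup>+t. f t * w t \<partial>lborel)"
    if "f \<in> borel_measurable borel" "r \<noteq> 0" for f r
    unfolding w_def by (rule nn_integral_multiplicative_haar_scale[OF that])
  have nz: "AE t in lborel. t \<noteq> (0::real)" by (rule AE_lborel_singleton)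
  have "(\<integral>\<^sup>+s. \<phi> (1 / s) * w s \<partial>lborel) = (\<integral>\<^sup>+s. (\<phi> (1 / s) * w s) * (\<integral>\<^sup>+r. \<psi> r * w r \<partial>lborel) \<partial>lborel)"
    by (simp add: \<psi>1)
  also have "\<dots> = (\<integral>\<^sup>+s. (\<phi> (1 / s) * w s) * (\<integral>\<^sup>+r. \<psi> (s * r) * w r \<partial>lborel) \<partial>lborel)"
    by (intro nn_integral_cong_AE, use nz in eventually_elim) (simp add: scale)
  also have "\<dots> = (\<integral>\<^sup>+s. \<integral>\<^sup>+r. (\<phi> (1 / s) * w s) * (\<psi> (s * r) * w r) \<partial>lborel \<partial>lborel)"
    by (rule nn_integral_cong, rule nn_integral_cmult[symmetric]) measurable
  also have "\<dots> = (\<integral>\<^sup>+r. \<integral>\<^sup>+s. (\<phi> (1 / s) * w s) * (\<psi> (s * r) * w r) \<partial>lborel \<partial>lborel)"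
    by (rule lborel_pair.Fubini') measurable
  also have "\<dots> = (\<integral>\<^sup>+r. w r * (\<integral>\<^sup>+s. \<phi> (r / (r * s)) * \<psi> (r * s) * w s \<partial>lborel) \<partial>lborel)"
  proof (intro nn_integral_cong_AE, use nz in eventually_elim)
    fix r :: real assume "r \<noteq> 0"
    then show "(\<integral>\<^sup>+s. (\<phi> (1 / s) * w s) * (\<psi> (s * r) * w r) \<partial>lborel) =
      w r * (\<integral>\<^sup>+s. \<phi> (r / (r * s)) * \<psi> (r * s) * w s \<partial>lborel)"
      by (subst nn_integral_cmult[symmetric]) (auto simp: ac_simps)
  qed
  also have "\<dots> = (\<integral>\<^sup>+r. w r * (\<integral>\<^sup>+s. \<phi> (r / s) * \<psi> s * w s \<partial>lborel) \<partial>lborel)"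
  proof (intro nn_integral_cong_AE, use nz in eventually_elim)
    fix r :: real assume "r \<noteq> 0"
    then show "w r * (\<integral>\<^sup>+s. \<phi> (r / (r * s)) * \<psi> (r * s) * w s \<partial>lborel) = w r * (\<integral>\<^sup>+s. \<phi> (r / s) * \<psi> s * w s \<partial>lborel)"
      by (subst scale[of "\<lambda>s. \<phi> (r / s) * \<psi> s" r]) auto
  qed
  also have "\<dots> = (\<integral>\<^sup>+r. \<integral>\<^sup>+s. w r * (\<phi> (r / s) * \<psi> s * w s) \<partial>lborel \<partial>lborel)"
    by (rule nn_integral_cong, rule nn_integral_cmult[symmetric]) measurable
  also have "\<dots> = (\<integral>\<^sup>+s. \<integral>\<^sup>+r. w r * (\<phi> (r / s) * \<psi> s * w s) \<partial>lborel \<partial>lborel)"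
    by (rule lborel_pair.Fubini') measurable
  also have "\<dots> = (\<integral>\<^sup>+s. (\<psi> s * w s) * (\<integral>\<^sup>+r. \<phi> ((1 / s) * r) * w r \<partial>lborel) \<partial>lborel)"
    by (intro nn_integral_cong, subst nn_integral_cmult[symmetric]) (auto simp: ac_simps)
  also have "\<dots> = (\<integral>\<^sup>+s. (\<psi> s * w s) * (\<integral>\<^sup>+r. \<phi> r * w r \<partial>lborel) \<partial>lborel)"
  proof (intro nn_integral_cong_AE, use nz in eventually_elim)
    fix s :: real assume "s \<noteq> 0"
    then show "(\<psi> s * w s) * (\<integral>\<^sup>+r. \<phi> ((1 / s) * r) * w r \<partial>lborel) = (\<psi> s * w s) * (\<integral>\<^sup>+r. \<phi> r * w r \<partial>lborel)"
      by (subst scale[of \<phi> "1 / s"]) auto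
  qed
  also have "\<dots> = (\<integral>\<^sup>+r. \<phi> r * w r \<partial>lborel)"
    by (subst nn_integral_multc) (auto simp: \<psi>1)
  finally show ?thesis by (simp add: w_def)
qed

text \<open>The map \<open>t \<mapsto> 1 / t\<close> is not monotone across the origin; the substitution is read off from the
  invariance of \<open>dt / |t|\<close> under inversion.\<close>

lemma nn_integral_inverse_substitution:
  fixes \<phi> :: "real \<Rightarrow> ennreal"
  assumes [measurable]: "\<phi> \<in> borel_measurable borel"
  shows "(\<integral>\<^sup>+t. ennreal (1 / t\<^sup>2) * \<phi> (1 / t) \<partial>lborel) = (\<integral>\<^sup>+t. \<phi> t \<partial>lborel)"
proof -
  have nz: "AE t in lborel. t \<noteq> (0::real)" by (rule AE_lborel_singleton)
  have "(\<integral>\<^sup>+t. ennreal (1 / t\<^sup>2) * \<phi> (1 / t) \<partial>lborel) =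
    (\<integral>\<^sup>+t. (ennreal \<bar>1 / t\<bar> * \<phi> (1 / t)) * ennreal (1 / \<bar>t\<bar>) \<partial>lborel)"
  proof (rule nn_integral_cong)
    fix t :: real
    have "ennreal (1 / t\<^sup>2) = ennreal \<bar>1 / t\<bar> * ennreal (1 / \<bar>t\<bar>)"
      by (subst ennreal_mult[symmetric]) (auto simp: power2_eq_square)
    then show "ennreal (1 / t\<^sup>2) * \<phi> (1 / t) = (ennreal \<bar>1 / t\<bar> * \<phi> (1 / t)) * ennreal (1 / \<bar>t\<bar>)"
      by (simp add: ac_simps)
  qed
  also have "\<dots> = (\<integral>\<^sup>+t. (ennreal \<bar>t\<bar> * \<phi> t) * ennreal (1 / \<bar>t\<bar>) \<partial>lborel)"
    by (rule nn_integral_multiplicative_haar_inverse[of "\<lambda>t. ennreal \<bar>t\<bar> * \<phi> t"]) measurable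
  also have "\<dots> = (\<integral>\<^sup>+t. \<phi> t \<partial>lborel)"
  proof (intro nn_integral_cong_AE, use nz in eventually_elim)
    fix t :: real assume "t \<noteq> 0"
    then have "ennreal \<bar>t\<bar> * ennreal (1 / \<bar>t\<bar>) = 1"
      by (subst ennreal_mult[symmetric]) auto
    then show "(ennreal \<bar>t\<bar> * \<phi> t) * ennreal (1 / \<bar>t\<bar>) = \<phi> t"
      by (metis mult.assoc mult.commute mult.right_neutral)
  qed
  finally show ?thesis .
qed

lemma measurable_curried:
  assumes "(\<lambda>(x, y). g x y) \<in> A \<Otimes>\<^sub>M B \<rightarrow>\<^sub>M N" "u \<in> M \<rightarrow>\<^sub>M A" "v \<in> M \<rightarrow>\<^sub>M B"
  shows "(\<lambda>l. g (u l) (v l)) \<in> M \<rightarrow>\<^sub>M N"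
  using measurable_compose[OF measurable_Pair[OF assms(2,3)] assms(1)] by simp

lemma measurable_fun_upd_PiM:
  assumes "f \<in> M \<rightarrow>\<^sub>M Pi\<^sub>M I N" "g \<in> M \<rightarrow>\<^sub>M N j" "j \<in> I"
  shows "(\<lambda>l. (f l)(j := g l)) \<in> M \<rightarrow>\<^sub>M Pi\<^sub>M I N"
  using measurable_compose[OF measurable_Pair[OF assms(1,2)] measurable_add_dim] assms(3)
  by (simp add: insert_absorb)

lemma nn_integral_lborel_affine:
  fixes h :: "'a::euclidean_space \<Rightarrow> ennreal"
  assumes [measurable]: "h \<in> borel_measurable borel" and c: "c \<noteq> 0"
  shows "(\<integral>\<^sup>+x. h x \<partial>lborel) = ennreal (\<bar>c\<bar> ^ DIM('a)) * (\<integral>\<^sup>+x. h (v + c *\<^sub>R x) \<partial>lborel)"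
  by (subst lborel_affine[OF c, of v]) (simp add: nn_integral_density nn_integral_distr nn_integral_cmult)

text \<open>The heart of the symmetry argument. Solving \<open>z = t y + L b\<close> for \<open>y\<close> gives
  \<open>y = t\<^sup>-\<^sup>1 z - t\<^sup>-\<^sup>1 L b\<close>, an equation of the same shape; the powers of \<open>t\<close> produced by the
  substitutions in \<open>y\<close>, \<open>b\<close> and \<open>t\<close> and by the weight cancel exactly.\<close>

lemma exchange_affine_combination:
  fixes L :: "('i \<Rightarrow> real) \<Rightarrow> 'a::euclidean_space" and \<omega> :: "'a \<Rightarrow> ennreal"
  assumes J: "finite J" and [measurable]: "L \<in> borel_measurable (Pi\<^sub>M J (\<lambda>_. lborel))"
    and Lr: "\<And>r b. L (\<lambda>i\<in>J. r * b i) = r *\<^sub>R L b"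
    and [measurable]: "\<omega> \<in> borel_measurable borel"
    and \<omega>: "\<And>t z b. t \<noteq> 0 \<Longrightarrow> \<omega> (t *\<^sub>R z + L b) = ennreal ((1 / \<bar>t\<bar>) ^ q) * \<omega> z"
    and g: "(\<lambda>(y, z). g y z) \<in> borel_measurable (borel \<Otimes>\<^sub>M borel)"
    and N: "q + card J + 2 = DIM('a)"
  shows "(\<integral>\<^sup>+y. \<integral>\<^sup>+b. \<integral>\<^sup>+t. \<omega> y * g y (t *\<^sub>R y + L b) \<partial>lborel \<partial>Pi\<^sub>M J (\<lambda>_. lborel) \<partial>lborel) =
    (\<integral>\<^sup>+y. \<integral>\<^sup>+b. \<integral>\<^sup>+t. \<omega> y * g (t *\<^sub>R y + L b) y \<partial>lborel \<partial>Pi\<^sub>M J (\<lambda>_. lborel) \<partial>lborel)"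
proof -
  let ?P = "Pi\<^sub>M J (\<lambda>_. lborel :: real measure)"
  interpret P: sigma_finite_measure ?P by (rule lborel_PiM.sigma_finite[OF J])
  interpret Pt: pair_sigma_finite ?P "lborel :: real measure" ..
  interpret Py: pair_sigma_finite ?P "lborel :: 'a measure" ..
  note [measurable (raw)] = measurable_curried[OF g]
  have inner: "(\<integral>\<^sup>+b. \<integral>\<^sup>+y. \<omega> y * g (t *\<^sub>R y + L b) y \<partial>lborel \<partial>?P) =
    ennreal (1 / t\<^sup>2) * (\<integral>\<^sup>+z. \<integral>\<^sup>+b. \<omega> z * g z ((1 / t) *\<^sub>R z + L b) \<partial>?P \<partial>lborel)"
    if t: "t \<noteq> 0" for t
  proof -
    let ?d = "DIM('a)"
    let ?c = "\<bar>1 / t\<bar> ^ ?d * \<bar>t\<bar> ^ q"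
    have step: "(\<integral>\<^sup>+y. \<omega> y * g (t *\<^sub>R y + L b) y \<partial>lborel) =
      ennreal ?c * (\<integral>\<^sup>+z. \<omega> z * g z ((1 / t) *\<^sub>R (z - L b)) \<partial>lborel)" for b
    proof -
      have "(\<integral>\<^sup>+y. \<omega> y * g (t *\<^sub>R y + L b) y \<partial>lborel) =
        ennreal (\<bar>1 / t\<bar> ^ ?d) * (\<integral>\<^sup>+z. \<omega> (- (1 / t) *\<^sub>R L b + (1 / t) *\<^sub>R z) *
          g (t *\<^sub>R (- (1 / t) *\<^sub>R L b + (1 / t) *\<^sub>R z) + L b) (- (1 / t) *\<^sub>R L b + (1 / t) *\<^sub>R z) \<partial>lborel)"
        using t by (intro nn_integral_lborel_affine) auto
      also have "\<dots> = ennreal (\<bar>1 / t\<bar> ^ ?d) * (\<integral>\<^sup>+z. ennreal (\<bar>t\<bar> ^ q) * (\<omega> z * g z ((1 / t) *\<^sub>R (z - L b))) \<partial>lborel)"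
      proof (rule arg_cong[where f="\<lambda>x. _ * x"], rule nn_integral_cong)
        fix z
        define y where "y = (1 / t) *\<^sub>R (z - L b)"
        have y: "- (1 / t) *\<^sub>R L b + (1 / t) *\<^sub>R z = y" by (simp add: y_def scaleR_diff_right)
        have z: "t *\<^sub>R y + L b = z" using t by (simp add: y_def)
        have "ennreal (\<bar>t\<bar> ^ q) * \<omega> z = ennreal (\<bar>t\<bar> ^ q) * (ennreal ((1 / \<bar>t\<bar>) ^ q) * \<omega> y)"
          using \<omega>[OF t, of y b] by (simp add: z)
        also have "\<dots> = \<omega> y"
          using t by (simp add: power_divide flip: mult.assoc ennreal_mult)
        finally show "\<omega> (- (1 / t) *\<^sub>R L b + (1 / t) *\<^sub>R z) *
          g (t *\<^sub>R (- (1 / t) *\<^sub>R L b + (1 / t) *\<^sub>R z) + L b) (- (1 / t) *\<^sub>R L b + (1 / t) *\<^sub>R z) =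
          ennreal (\<bar>t\<bar> ^ q) * (\<omega> z * g z ((1 / t) *\<^sub>R (z - L b)))"
          unfolding y z y_def[symmetric] by (simp flip: mult.assoc)
      qed
      also have "\<dots> = ennreal ?c * (\<integral>\<^sup>+z. \<omega> z * g z ((1 / t) *\<^sub>R (z - L b)) \<partial>lborel)"
        by (subst nn_integral_cmult) (measurable, simp add: ennreal_mult mult.assoc)
      finally show ?thesis .
    qed
    have "(\<integral>\<^sup>+b. \<integral>\<^sup>+y. \<omega> y * g (t *\<^sub>R y + L b) y \<partial>lborel \<partial>?P) =
      (\<integral>\<^sup>+b. ennreal ?c * (\<integral>\<^sup>+z. \<omega> z * g z ((1 / t) *\<^sub>R (z - L b)) \<partial>lborel) \<partial>?P)"
      by (simp only: step)
    also have "\<dots> = ennreal ?c * (\<integral>\<^sup>+b. \<integral>\<^sup>+z. \<omega> z * g z ((1 / t) *\<^sub>R (z - L b)) \<partial>lborel \<partial>?P)"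
      by (rule nn_integral_cmult) measurable
    also have "(\<integral>\<^sup>+b. \<integral>\<^sup>+z. \<omega> z * g z ((1 / t) *\<^sub>R (z - L b)) \<partial>lborel \<partial>?P) =
      (\<integral>\<^sup>+z. \<integral>\<^sup>+b. \<omega> z * g z ((1 / t) *\<^sub>R (z - L b)) \<partial>?P \<partial>lborel)"
      by (rule Py.Fubini'[symmetric]) measurable
    also have "\<dots> = (\<integral>\<^sup>+z. ennreal (\<bar>t\<bar> ^ card J) * (\<integral>\<^sup>+b. \<omega> z * g z ((1 / t) *\<^sub>R z + L b) \<partial>?P) \<partial>lborel)"
    proof (rule nn_integral_cong)
      fix z
      have "(\<integral>\<^sup>+b. \<omega> z * g z ((1 / t) *\<^sub>R (z - L b)) \<partial>?P) = ennreal (\<bar>- t\<bar> ^ card J) *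
        (\<integral>\<^sup>+b. \<omega> z * g z ((1 / t) *\<^sub>R (z - L (\<lambda>i\<in>J. - t * b i))) \<partial>?P)"
        using t by (intro nn_integral_PiM_lborel_scale[OF J, where k="\<lambda>b. \<omega> z * g z ((1 / t) *\<^sub>R (z - L b))"]) (simp, measurable)
      moreover have "(1 / t) *\<^sub>R (z - L (\<lambda>i\<in>J. - t * b i)) = (1 / t) *\<^sub>R z + L b" for b
        unfolding Lr using t by (simp add: scaleR_add_right)
      ultimately show "(\<integral>\<^sup>+b. \<omega> z * g z ((1 / t) *\<^sub>R (z - L b)) \<partial>?P) =
        ennreal (\<bar>t\<bar> ^ card J) * (\<integral>\<^sup>+b. \<omega> z * g z ((1 / t) *\<^sub>R z + L b) \<partial>?P)" by simp
    qed
    also have "\<dots> = ennreal (\<bar>t\<bar> ^ card J) * (\<integral>\<^sup>+z. \<integral>\<^sup>+b. \<omega> z * g z ((1 / t) *\<^sub>R z + L b) \<partial>?P \<partial>lborel)"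
      by (rule nn_integral_cmult) measurable
    also have "ennreal ?c * (ennreal (\<bar>t\<bar> ^ card J) * (\<integral>\<^sup>+z. \<integral>\<^sup>+b. \<omega> z * g z ((1 / t) *\<^sub>R z + L b) \<partial>?P \<partial>lborel)) =
      ennreal (?c * \<bar>t\<bar> ^ card J) * (\<integral>\<^sup>+z. \<integral>\<^sup>+b. \<omega> z * g z ((1 / t) *\<^sub>R z + L b) \<partial>?P \<partial>lborel)"
      by (simp add: ennreal_mult mult.assoc)
    \<comment> \<open>The factor \<open>t\<^sup>-\<^sup>2\<close> that is left over is the one that the substitution of \<open>1 / t\<close> for \<open>t\<close> absorbs.\<close>
    also have "?c * \<bar>t\<bar> ^ card J = 1 / t\<^sup>2"
      using t unfolding N[symmetric]
      by (simp add: power_add power_divide power2_eq_square field_simps)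
    finally show ?thesis .
  qed
  have nz: "AE t in lborel. t \<noteq> (0::real)" by (rule AE_lborel_singleton)
  define \<phi> where "\<phi> s = (\<integral>\<^sup>+z. \<integral>\<^sup>+b. \<omega> z * g z (s *\<^sub>R z + L b) \<partial>?P \<partial>lborel)" for s
  have [measurable]: "\<phi> \<in> borel_measurable borel" unfolding \<phi>_def by measurable
  have "(\<integral>\<^sup>+y. \<integral>\<^sup>+b. \<integral>\<^sup>+t. \<omega> y * g (t *\<^sub>R y + L b) y \<partial>lborel \<partial>?P \<partial>lborel) =
    (\<integral>\<^sup>+y. \<integral>\<^sup>+t. \<integral>\<^sup>+b. \<omega> y * g (t *\<^sub>R y + L b) y \<partial>?P \<partial>lborel \<partial>lborel)"
    by (rule nn_integral_cong, rule Pt.Fubini'[symmetric]) measurable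
  also have "\<dots> = (\<integral>\<^sup>+t. \<integral>\<^sup>+y. \<integral>\<^sup>+b. \<omega> y * g (t *\<^sub>R y + L b) y \<partial>?P \<partial>lborel \<partial>lborel)"
    by (rule lborel_pair.Fubini'[symmetric]) measurable
  also have "\<dots> = (\<integral>\<^sup>+t. \<integral>\<^sup>+b. \<integral>\<^sup>+y. \<omega> y * g (t *\<^sub>R y + L b) y \<partial>lborel \<partial>?P \<partial>lborel)"
    by (rule nn_integral_cong, rule Py.Fubini') measurable
  also have "\<dots> = (\<integral>\<^sup>+t. ennreal (1 / t\<^sup>2) * \<phi> (1 / t) \<partial>lborel)"
  proof (intro nn_integral_cong_AE, use nz in eventually_elim)
    fix t :: real assume "t \<noteq> 0"
    from inner[OF this] show "(\<integral>\<^sup>+b. \<integral>\<^sup>+y. \<omega> y * g (t *\<^sub>R y + L b) y \<partial>lborel \<partial>?P) = ennreal (1 / t\<^sup>2) * \<phi> (1 / t)"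
      unfolding \<phi>_def .
  qed
  also have "\<dots> = (\<integral>\<^sup>+t. \<phi> t \<partial>lborel)"
    by (rule nn_integral_inverse_substitution) measurable
  also have "\<dots> = (\<integral>\<^sup>+y. \<integral>\<^sup>+t. \<integral>\<^sup>+b. \<omega> y * g y (t *\<^sub>R y + L b) \<partial>?P \<partial>lborel \<partial>lborel)"
    unfolding \<phi>_def by (rule lborel_pair.Fubini') measurable
  also have "\<dots> = (\<integral>\<^sup>+y. \<integral>\<^sup>+b. \<integral>\<^sup>+t. \<omega> y * g y (t *\<^sub>R y + L b) \<partial>lborel \<partial>?P \<partial>lborel)"
    by (rule nn_integral_cong, rule Pt.Fubini') measurable
  finally show ?thesis ..
qed

lemma line_weight_scale:
  assumes "t \<noteq> 0"
  shows "line_weight (\<bar>t\<bar> * d) = ennreal (1 / \<bar>t\<bar>) * line_weight d"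
  using assms by (auto simp: line_weight_def abs_mult ennreal_mult_top simp flip: ennreal_mult)

text \<open>Adding a combination of the other vectors does not change the height above their span, and
  scaling by \<open>t\<close> scales it by \<open>|t|\<close>.\<close>

lemma inv_volume_upd_affine:
  fixes X :: "'i \<Rightarrow> 'a::euclidean_space"
  assumes J: "finite J" "j \<notin> J" and t: "t \<noteq> 0"
  shows "inv_volume (insert j J) (X(j := t *\<^sub>R z + lincomb J X b)) =
    ennreal (1 / \<bar>t\<bar>) * inv_volume (insert j J) (X(j := z))"
proof -
  let ?P = "closest_point (span (X ` J))"
  have im: "X(j := y) ` J = X ` J" for y using J by auto
  have lin: "linear ?P" by (rule linear_closest_point[OF subspace_span])
  have "?P (lincomb J X b) = lincomb J X b"
    by (intro closest_point_self lincomb_in_span J)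
  then have "(t *\<^sub>R z + lincomb J X b) - ?P (t *\<^sub>R z + lincomb J X b) = t *\<^sub>R (z - ?P z)"
    by (simp add: linear_add[OF lin] linear_scale[OF lin] scaleR_diff_right)
  then have "norm ((t *\<^sub>R z + lincomb J X b) - ?P (t *\<^sub>R z + lincomb J X b)) = \<bar>t\<bar> * norm (z - ?P z)"
    by simp
  moreover have "inv_volume J (X(j := y)) = inv_volume J X" for y
    using J by (intro inv_volume_cong) auto
  ultimately show ?thesis
    unfolding inv_volume_insert[OF J] fun_upd_same im by (simp add: line_weight_scale[OF t] ac_simps)
qed

text \<open>Parametrising the span by coefficients consumes one factor \<open>inv_volume I Y\<close>; the remaining
  power \<open>q = m - 1\<close> is the homogeneity degree for which the substitution of
  \<open>exchange_affine_combination\<close> balances.\<close>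

lemma exchange_vector:
  fixes h :: "('i \<Rightarrow> 'a::euclidean_space) \<Rightarrow> 'a \<Rightarrow> ennreal"
  assumes J: "finite J" "j \<notin> J" and k: "card (insert j J) < DIM('a)"
    and h: "(\<lambda>(Y, z). h Y z) \<in> borel_measurable (Pi\<^sub>M (insert j J) (\<lambda>_. borel) \<Otimes>\<^sub>M borel)"
  defines "I \<equiv> insert j J" and "m \<equiv> DIM('a) - card (insert j J)"
  shows "(\<integral>\<^sup>+Y. inv_volume I Y ^ m * (\<integral>\<^sup>+z. h Y z \<partial>flat_measure (span (Y ` I))) \<partial>Pi\<^sub>M I (\<lambda>_. lborel)) =
    (\<integral>\<^sup>+Y. inv_volume I Y ^ m * (\<integral>\<^sup>+z. h (Y(j := z)) (Y j) \<partial>flat_measure (span (Y ` I))) \<partial>Pi\<^sub>M I (\<lambda>_. lborel))"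
proof -
  define q where "q = m - 1"
  have mq: "m = Suc q" using k by (simp add: q_def m_def)
  have I: "finite I" using J by (simp add: I_def)
  have qN: "q + card J + 2 = DIM('a)" using k J by (simp add: q_def m_def)
  interpret a: sigma_finite_measure "Pi\<^sub>M I (\<lambda>_. lborel :: real measure)" by (rule lborel_PiM.sigma_finite[OF I])
  interpret b: sigma_finite_measure "Pi\<^sub>M J (\<lambda>_. lborel :: real measure)" by (rule lborel_PiM.sigma_finite[OF J(1)])
  note [measurable] = h[folded I_def]
  have key: "(\<integral>\<^sup>+Y. inv_volume I Y ^ m * (\<integral>\<^sup>+z. u Y z \<partial>flat_measure (span (Y ` I))) \<partial>Pi\<^sub>M I (\<lambda>_. lborel)) =
    (\<integral>\<^sup>+X. \<integral>\<^sup>+y. \<integral>\<^sup>+b. \<integral>\<^sup>+t. inv_volume I (X(j := y)) ^ q * u (X(j := y)) (t *\<^sub>R y + lincomb J X b)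
      \<partial>lborel \<partial>Pi\<^sub>M J (\<lambda>_. lborel) \<partial>lborel \<partial>Pi\<^sub>M J (\<lambda>_. lborel))"
    if um[measurable]: "(\<lambda>(Y, z). u Y z) \<in> borel_measurable (Pi\<^sub>M I (\<lambda>_. borel) \<Otimes>\<^sub>M borel)"
    for u :: "('i \<Rightarrow> 'a) \<Rightarrow> 'a \<Rightarrow> ennreal"
  proof -
    note [measurable (raw)] = measurable_curried[OF um]
    have ind: "AE Y in Pi\<^sub>M I (\<lambda>_. lborel :: 'a measure). inv_volume I Y < top"
      using k by (intro AE_lborel_independent I) (simp add: I_def)
    have "(\<integral>\<^sup>+Y. inv_volume I Y ^ m * (\<integral>\<^sup>+z. u Y z \<partial>flat_measure (span (Y ` I))) \<partial>Pi\<^sub>M I (\<lambda>_. lborel)) =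
      (\<integral>\<^sup>+Y. (\<integral>\<^sup>+a. inv_volume I Y ^ q * u Y (lincomb I Y a) \<partial>Pi\<^sub>M I (\<lambda>_. lborel)) \<partial>Pi\<^sub>M I (\<lambda>_. lborel))"
    proof (intro nn_integral_cong_AE, use ind AE_space in eventually_elim)
      fix Y assume Y: "inv_volume I Y < top" and sp[measurable]: "Y \<in> space (Pi\<^sub>M I (\<lambda>_. lborel :: 'a measure))"
      have [measurable]: "Y \<in> space (Pi\<^sub>M I (\<lambda>_. borel :: 'a measure))" using sp by (simp add: space_PiM)
      have [measurable]: "u Y \<in> borel_measurable borel" by measurable
      have "inv_volume I Y ^ m * (\<integral>\<^sup>+z. u Y z \<partial>flat_measure (span (Y ` I))) =
        inv_volume I Y ^ q * (inv_volume I Y * (\<integral>\<^sup>+z. u Y z \<partial>flat_measure (span (Y ` I))))"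
        by (simp add: mq mult.assoc mult.left_commute)
      also have "\<dots> = inv_volume I Y ^ q * (\<integral>\<^sup>+a. u Y (lincomb I Y a) \<partial>Pi\<^sub>M I (\<lambda>_. lborel))"
        by (subst nn_integral_lincomb[OF I Y]) auto
      also have "\<dots> = (\<integral>\<^sup>+a. inv_volume I Y ^ q * u Y (lincomb I Y a) \<partial>Pi\<^sub>M I (\<lambda>_. lborel))"
        by (rule nn_integral_cmult[symmetric]) measurable
      finally show "inv_volume I Y ^ m * (\<integral>\<^sup>+z. u Y z \<partial>flat_measure (span (Y ` I))) =
        (\<integral>\<^sup>+a. inv_volume I Y ^ q * u Y (lincomb I Y a) \<partial>Pi\<^sub>M I (\<lambda>_. lborel))" .
    qed
    also have "\<dots> = (\<integral>\<^sup>+X. \<integral>\<^sup>+y. (\<integral>\<^sup>+a. inv_volume I (X(j := y)) ^ q *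
        u (X(j := y)) (lincomb I (X(j := y)) a) \<partial>Pi\<^sub>M I (\<lambda>_. lborel)) \<partial>lborel \<partial>Pi\<^sub>M J (\<lambda>_. lborel))"
      unfolding I_def
    proof (rule lborel_PiM.product_nn_integral_insert[OF J], fold I_def)
      show "(\<lambda>Y. \<integral>\<^sup>+a. inv_volume I Y ^ q * u Y (lincomb I Y a) \<partial>Pi\<^sub>M I (\<lambda>_. lborel)) \<in> borel_measurable (Pi\<^sub>M I (\<lambda>_. lborel))"
        using I by measurable
    qed
    also have "\<dots> = (\<integral>\<^sup>+X. \<integral>\<^sup>+y. \<integral>\<^sup>+b. \<integral>\<^sup>+t. inv_volume I (X(j := y)) ^ q * u (X(j := y)) (t *\<^sub>R y + lincomb J X b)
      \<partial>lborel \<partial>Pi\<^sub>M J (\<lambda>_. lborel) \<partial>lborel \<partial>Pi\<^sub>M J (\<lambda>_. lborel))"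
    proof (intro nn_integral_cong)
      fix X y assume "X \<in> space (Pi\<^sub>M J (\<lambda>_. lborel :: 'a measure))"
      then have [measurable]: "X(j := y) \<in> space (Pi\<^sub>M I (\<lambda>_. borel :: 'a measure))"
        by (auto simp: space_PiM I_def PiE_iff extensional_def)
      have [measurable]: "u (X(j := y)) \<in> borel_measurable borel" by measurable
      have "(\<integral>\<^sup>+a. inv_volume I (X(j := y)) ^ q * u (X(j := y)) (lincomb I (X(j := y)) a) \<partial>Pi\<^sub>M I (\<lambda>_. lborel)) =
        (\<integral>\<^sup>+b. \<integral>\<^sup>+t. inv_volume I (X(j := y)) ^ q * u (X(j := y)) (lincomb I (X(j := y)) (b(j := t))) \<partial>lborel \<partial>Pi\<^sub>M J (\<lambda>_. lborel))"
        unfolding I_def by (rule lborel_PiM.product_nn_integral_insert[OF J], fold I_def) measurable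
      moreover have "lincomb I (X(j := y)) (b(j := t)) = t *\<^sub>R y + lincomb J X b" for b t
        unfolding I_def by (simp add: lincomb_insert[OF J] lincomb_upd[OF J(2)])
      ultimately show "(\<integral>\<^sup>+a. inv_volume I (X(j := y)) ^ q * u (X(j := y)) (lincomb I (X(j := y)) a) \<partial>Pi\<^sub>M I (\<lambda>_. lborel)) =
        (\<integral>\<^sup>+b. \<integral>\<^sup>+t. inv_volume I (X(j := y)) ^ q * u (X(j := y)) (t *\<^sub>R y + lincomb J X b) \<partial>lborel \<partial>Pi\<^sub>M J (\<lambda>_. lborel))"
        by (simp only:)
    qed
    finally show ?thesis .
  qed
  have upd[measurable]: "(\<lambda>p. (fst p)(j := snd p)) \<in> Pi\<^sub>M I (\<lambda>_. borel) \<Otimes>\<^sub>M borel \<rightarrow>\<^sub>M Pi\<^sub>M I (\<lambda>_. borel :: 'a measure)"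
    by (rule measurable_fun_upd_PiM) (auto simp: I_def)
  have h': "(\<lambda>(Y, z). h (Y(j := z)) (Y j)) \<in> borel_measurable (Pi\<^sub>M I (\<lambda>_. borel) \<Otimes>\<^sub>M borel)"
  proof -
    have "(\<lambda>p. ((fst p)(j := snd p), fst p j)) \<in> Pi\<^sub>M I (\<lambda>_. borel) \<Otimes>\<^sub>M borel \<rightarrow>\<^sub>M Pi\<^sub>M I (\<lambda>_. borel) \<Otimes>\<^sub>M (borel :: 'a measure)"
      by (intro measurable_Pair upd) (simp add: I_def)
    from measurable_compose[OF this h[folded I_def]] show ?thesis by (simp add: case_prod_beta)
  qed
  have "(\<integral>\<^sup>+y. \<integral>\<^sup>+b. \<integral>\<^sup>+t. inv_volume I (X(j := y)) ^ q * h (X(j := y)) (t *\<^sub>R y + lincomb J X b)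
      \<partial>lborel \<partial>Pi\<^sub>M J (\<lambda>_. lborel) \<partial>lborel) =
    (\<integral>\<^sup>+y. \<integral>\<^sup>+b. \<integral>\<^sup>+t. inv_volume I (X(j := y)) ^ q * h (X(j := t *\<^sub>R y + lincomb J X b)) y
      \<partial>lborel \<partial>Pi\<^sub>M J (\<lambda>_. lborel) \<partial>lborel)"
    if X: "X \<in> space (Pi\<^sub>M J (\<lambda>_. lborel :: 'a measure))" for X
  proof (rule exchange_affine_combination[OF J(1), where g="\<lambda>y. h (X(j := y))" and \<omega>="\<lambda>y. inv_volume I (X(j := y)) ^ q" and q=q])
    have upX[measurable]: "(\<lambda>y. X(j := y)) \<in> borel \<rightarrow>\<^sub>M Pi\<^sub>M I (\<lambda>_. borel :: 'a measure)"
      unfolding I_def using X J by (intro measurable_component_update) (auto simp: space_PiM)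
    show "lincomb J X (\<lambda>i\<in>J. r * b i) = r *\<^sub>R lincomb J X b" for r b
      by (rule lincomb_scale)
    show "(\<lambda>y. inv_volume I (X(j := y)) ^ q) \<in> borel_measurable borel"
      using I by measurable
    show "inv_volume I (X(j := t *\<^sub>R z + lincomb J X b)) ^ q = ennreal ((1 / \<bar>t\<bar>) ^ q) * inv_volume I (X(j := z)) ^ q"
      if "t \<noteq> 0" for t z b
      unfolding I_def inv_volume_upd_affine[OF J that] by (simp add: power_mult_distrib ennreal_power)
    note [measurable (raw)] = measurable_curried[OF h[folded I_def]]
    show "(\<lambda>(y, z). h (X(j := y)) z) \<in> borel_measurable (borel \<Otimes>\<^sub>M borel)"
      unfolding case_prod_beta by measurable
    show "lincomb J X \<in> borel_measurable (Pi\<^sub>M J (\<lambda>_. lborel))" by measurable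
    show "q + card J + 2 = DIM('a)" by (rule qN)
  qed
  then show ?thesis
    unfolding key[OF h[folded I_def]] key[OF h'] fun_upd_upd fun_upd_same
    by (rule nn_integral_cong)
qed

section \<open>Exchanging whole tuples\<close>

lemma span_exchange:
  fixes Y :: "'i \<Rightarrow> 'a::euclidean_space"
  assumes I: "finite I" "j \<in> I" and Y: "inv_volume I Y < top"
  shows "AE z in flat_measure (span (Y ` I)). span ((Y(j := z)) ` I) = span (Y ` I)"
proof -
  let ?J = "I - {j}"
  let ?S = "span (Y ` I)" and ?E = "span (Y ` ?J)"
  have IJ: "I = insert j ?J" and J: "finite ?J" "j \<notin> ?J" using I by auto
  have dI: "dim ?S = card I" using Y I by (simp add: inv_volume_finite_iff)
  have "inv_volume (insert j ?J) Y < top" using Y IJ by simp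
  then have "inv_volume ?J Y < top"
    unfolding inv_volume_insert[OF J] by (auto simp: ennreal_mult_less_top line_weight_pos)
  then have dE: "dim ?E = card ?J" using J by (simp add: inv_volume_finite_iff)
  have Yj: "Y j \<notin> ?E"
  proof
    assume "Y j \<in> ?E"
    then have "dim (insert (Y j) (Y ` ?J)) = dim (Y ` ?J)" by (simp add: dim_insert)
    moreover have "insert (Y j) (Y ` ?J) = Y ` I" using I by auto
    ultimately show False using dI dE I card_gt_0_iff[of I] by (auto simp: card_Diff_singleton)
  qed
  have ES: "?E \<subseteq> ?S" by (intro span_mono) auto
  have "AE z in flat_measure ?S. z \<notin> ?E"
    using I by (intro AE_flat_measure_not_in_subspace[OF subspace_span subspace_span _ Yj ES]) (auto intro: span_base)
  moreover have "AE z in flat_measure ?S. z \<in> ?S"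
    by (rule normalized_haarD(3)[OF normalized_haar_flat_measure[OF subspace_span]])
  ultimately show ?thesis
  proof eventually_elim
    fix z assume z: "z \<notin> ?E" "z \<in> ?S"
    have im: "(Y(j := z)) ` I = insert z (Y ` ?J)" using I by auto
    have "span (insert z (Y ` ?J)) = ?S"
    proof (rule subspace_dim_equal)
      show "span (insert z (Y ` ?J)) \<subseteq> ?S"
        using z(2) by (intro span_minimal) (auto intro: span_base)
      show "dim ?S \<le> dim (span (insert z (Y ` ?J)))"
        using z(1) dI dE I by (simp add: dim_insert card_Diff_singleton)
    qed auto
    then show "span ((Y(j := z)) ` I) = ?S" by (simp only: im)
  qed
qed

text \<open>The integral of \<open>H\<close> over pairs of tuples of \<open>card I\<close> vectors that lie in a common subspace of
  dimension \<open>card I\<close>, parametrised by the first tuple. The weight makes both tuples play the same role.\<close>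

definition tuple_pairing :: "'i set \<Rightarrow> (('i \<Rightarrow> 'a::euclidean_space) \<Rightarrow> ('i \<Rightarrow> 'a) \<Rightarrow> ennreal) \<Rightarrow> ennreal" where
  "tuple_pairing I H = (\<integral>\<^sup>+Y. inv_volume I Y ^ (DIM('a) - card I) *
     (\<integral>\<^sup>+Z. H Y Z \<partial>Pi\<^sub>M I (\<lambda>_. flat_measure (span (Y ` I)))) \<partial>Pi\<^sub>M I (\<lambda>_. lborel))"

lemma tuple_pairing_cong:
  fixes H :: "('i \<Rightarrow> 'a::euclidean_space) \<Rightarrow> ('i \<Rightarrow> 'a) \<Rightarrow> ennreal"
  assumes "\<And>Y Z. Y \<in> extensional I \<Longrightarrow> Z \<in> extensional I \<Longrightarrow> H Y Z = H' Y Z"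
  shows "tuple_pairing I H = tuple_pairing I H'"
  unfolding tuple_pairing_def using assms
  by (intro nn_integral_cong arg_cong2[where f="(*)"] refl) (auto simp: space_PiM PiE_def)

text \<open>After the exchange the new first tuple almost surely spans the same subspace, so the other
  vectors of \<open>Z\<close> are carried along unchanged.\<close>

lemma tuple_pairing_swap_one:
  fixes H :: "('i \<Rightarrow> 'a::euclidean_space) \<Rightarrow> ('i \<Rightarrow> 'a) \<Rightarrow> ennreal"
  assumes I: "finite I" "j \<in> I" and k: "card I < DIM('a)"
    and H: "(\<lambda>(Y, Z). H Y Z) \<in> borel_measurable (Pi\<^sub>M I (\<lambda>_. borel) \<Otimes>\<^sub>M Pi\<^sub>M I (\<lambda>_. borel))"
  shows "tuple_pairing I H = tuple_pairing I (\<lambda>Y Z. H (Y(j := Z j)) (Z(j := Y j)))"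
proof -
  define J where "J = I - {j}"
  have IJ: "I = insert j J" and J: "finite J" "j \<notin> J" using I by (auto simp: J_def)
  let ?S = "\<lambda>Y. span (Y ` I) :: 'a set"
  let ?F = "\<lambda>Y. Pi\<^sub>M J (\<lambda>_. flat_measure (?S Y))"
  define h where "h Y z = (\<integral>\<^sup>+Z. H Y (Z(j := z)) \<partial>?F Y)" for Y z
  note [measurable (raw)] = measurable_curried[OF H]
  have upd[measurable (raw)]: "(\<lambda>l. (f l)(j := g l)) \<in> M \<rightarrow>\<^sub>M Pi\<^sub>M I (\<lambda>_. borel :: 'a measure)"
    if "f \<in> M \<rightarrow>\<^sub>M Pi\<^sub>M J (\<lambda>_. borel :: 'a measure)" "g \<in> borel_measurable M" for f g and M :: "((('i \<Rightarrow> 'a) \<times> 'a) \<times> ('i \<Rightarrow> 'a)) measure"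
    using measurable_compose[OF measurable_Pair[OF that] measurable_add_dim[of j J "\<lambda>_. borel"]]
    by (simp add: IJ)
  have fam: "flat_family (Pi\<^sub>M I (\<lambda>_. borel) \<Otimes>\<^sub>M borel) (\<lambda>p. ?S (fst p))"
    using I by (intro flat_family_span) auto
  have hm: "(\<lambda>(Y, z). h Y z) \<in> borel_measurable (Pi\<^sub>M I (\<lambda>_. borel) \<Otimes>\<^sub>M borel)"
    unfolding h_def case_prod_beta
  proof (rule measurable_nn_integral_PiM_flat_measure[OF J(1) fam])
    show "(\<lambda>(p, Z). H (fst p) (Z(j := snd p))) \<in>
      borel_measurable ((Pi\<^sub>M I (\<lambda>_. borel) \<Otimes>\<^sub>M borel) \<Otimes>\<^sub>M Pi\<^sub>M J (\<lambda>_. borel))"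
      unfolding case_prod_beta by measurable
  qed
  have split: "(\<integral>\<^sup>+Z. u Z \<partial>Pi\<^sub>M I (\<lambda>_. flat_measure (?S Y))) =
    (\<integral>\<^sup>+z. \<integral>\<^sup>+Z. u (Z(j := z)) \<partial>?F Y \<partial>flat_measure (?S Y))"
    if "u \<in> borel_measurable (Pi\<^sub>M I (\<lambda>_. borel))" for u Y
  proof -
    interpret product_sigma_finite "\<lambda>_. flat_measure (?S Y)"
      by (intro product_sigma_finite_flat_measure_subspace subspace_span)
    have "u \<in> borel_measurable (Pi\<^sub>M I (\<lambda>_. flat_measure (?S Y)))"
      using that by measurable
    then show ?thesis
      using product_nn_integral_insert_rev[OF J, of u] unfolding IJ[symmetric] by simp
  qed
  have ind: "AE Y in Pi\<^sub>M I (\<lambda>_. lborel :: 'a measure). inv_volume I Y < top"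
    using k I by (intro AE_lborel_independent) auto
  have "tuple_pairing I H = (\<integral>\<^sup>+Y. inv_volume I Y ^ (DIM('a) - card I) *
     (\<integral>\<^sup>+z. h Y z \<partial>flat_measure (?S Y)) \<partial>Pi\<^sub>M I (\<lambda>_. lborel))"
    unfolding tuple_pairing_def h_def
  proof (rule nn_integral_cong, rule arg_cong[where f="\<lambda>x. _ * x"], rule split)
    fix Y assume "Y \<in> space (Pi\<^sub>M I (\<lambda>_. lborel :: 'a measure))"
    then have "Y \<in> space (Pi\<^sub>M I (\<lambda>_. borel :: 'a measure))" by (simp add: space_PiM)
    then show "H Y \<in> borel_measurable (Pi\<^sub>M I (\<lambda>_. borel))" by measurable
  qed
  also have "\<dots> = (\<integral>\<^sup>+Y. inv_volume I Y ^ (DIM('a) - card I) *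
     (\<integral>\<^sup>+z. h (Y(j := z)) (Y j) \<partial>flat_measure (?S Y)) \<partial>Pi\<^sub>M I (\<lambda>_. lborel))"
    using exchange_vector[OF J, of h] k hm unfolding IJ[symmetric] by simp
  also have "\<dots> = tuple_pairing I (\<lambda>Y Z. H (Y(j := Z j)) (Z(j := Y j)))"
    unfolding tuple_pairing_def
  proof (intro nn_integral_cong_AE, use ind AE_space in eventually_elim)
    fix Y assume Y: "inv_volume I Y < top" and "Y \<in> space (Pi\<^sub>M I (\<lambda>_. lborel :: 'a measure))"
    then have spY: "Y \<in> space (Pi\<^sub>M I (\<lambda>_. borel :: 'a measure))" by (simp add: space_PiM)
    have "(\<integral>\<^sup>+z. h (Y(j := z)) (Y j) \<partial>flat_measure (?S Y)) =
      (\<integral>\<^sup>+z. \<integral>\<^sup>+Z. H (Y(j := z)) (Z(j := Y j)) \<partial>?F Y \<partial>flat_measure (?S Y))"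
      by (intro nn_integral_cong_AE, use span_exchange[OF I Y] in eventually_elim) (simp add: h_def)
    also have "\<dots> = (\<integral>\<^sup>+Z. H (Y(j := Z j)) (Z(j := Y j)) \<partial>Pi\<^sub>M I (\<lambda>_. flat_measure (?S Y)))"
    proof (subst split)
      have "(\<lambda>Z. Y(j := Z j)) \<in> Pi\<^sub>M I (\<lambda>_. borel) \<rightarrow>\<^sub>M Pi\<^sub>M I (\<lambda>_. borel :: 'a measure)"
        using spY I by (intro measurable_fun_upd_PiM) auto
      moreover have "(\<lambda>Z. Z(j := Y j)) \<in> Pi\<^sub>M I (\<lambda>_. borel) \<rightarrow>\<^sub>M Pi\<^sub>M I (\<lambda>_. borel :: 'a measure)"
        using I by (intro measurable_fun_upd_PiM) auto
      ultimately show "(\<lambda>Z. H (Y(j := Z j)) (Z(j := Y j))) \<in> borel_measurable (Pi\<^sub>M I (\<lambda>_. borel))"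
        by (rule measurable_curried[OF H])
    qed simp
    finally show "inv_volume I Y ^ (DIM('a) - card I) * (\<integral>\<^sup>+z. h (Y(j := z)) (Y j) \<partial>flat_measure (?S Y)) =
      inv_volume I Y ^ (DIM('a) - card I) * (\<integral>\<^sup>+Z. H (Y(j := Z j)) (Z(j := Y j)) \<partial>Pi\<^sub>M I (\<lambda>_. flat_measure (?S Y)))"
      by simp
  qed
  finally show ?thesis .
qed

text \<open>Swap the components one after the other; \<open>A\<close> is the set of those already swapped.\<close>

lemma tuple_pairing_commute:
  fixes H :: "('i \<Rightarrow> 'a::euclidean_space) \<Rightarrow> ('i \<Rightarrow> 'a) \<Rightarrow> ennreal"
  assumes I: "finite I" and k: "card I < DIM('a)"
    and H: "(\<lambda>(Y, Z). H Y Z) \<in> borel_measurable (Pi\<^sub>M I (\<lambda>_. borel) \<Otimes>\<^sub>M Pi\<^sub>M I (\<lambda>_. borel))"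
  shows "tuple_pairing I H = tuple_pairing I (\<lambda>Y Z. H Z Y)"
proof -
  \<comment> \<open>\<open>restrict\<close> keeps the mixed tuples in the product space.\<close>
  define mix where "mix A Y Z = (\<lambda>i\<in>I. if i \<in> A then Z i else Y i :: 'a)" for A Y Z
  have *: "tuple_pairing I H = tuple_pairing I (\<lambda>Y Z. H (mix A Y Z) (mix A Z Y))" if "A \<subseteq> I" for A
    using finite_subset[OF that I] that
  proof (induction A rule: finite_induct)
    case empty
    show ?case
      by (rule tuple_pairing_cong) (simp add: mix_def extensional_restrict)
  next
    case (insert j A)
    then have j: "j \<in> I" "j \<notin> A" and A: "A \<subseteq> I" by auto
    have [measurable]: "(\<lambda>p. mix A (fst p) (snd p)) \<in> Pi\<^sub>M I (\<lambda>_. borel) \<Otimes>\<^sub>M Pi\<^sub>M I (\<lambda>_. borel) \<rightarrow>\<^sub>M Pi\<^sub>M I (\<lambda>_. borel)"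
      "(\<lambda>p. mix A (snd p) (fst p)) \<in> Pi\<^sub>M I (\<lambda>_. borel) \<Otimes>\<^sub>M Pi\<^sub>M I (\<lambda>_. borel) \<rightarrow>\<^sub>M Pi\<^sub>M I (\<lambda>_. borel)"
      unfolding mix_def by (intro measurable_restrict; auto)+
    have m: "(\<lambda>(Y, Z). H (mix A Y Z) (mix A Z Y)) \<in> borel_measurable (Pi\<^sub>M I (\<lambda>_. borel) \<Otimes>\<^sub>M Pi\<^sub>M I (\<lambda>_. borel))"
      unfolding case_prod_beta by (intro measurable_curried[OF H]) measurable
    have "tuple_pairing I H = tuple_pairing I (\<lambda>Y Z. H (mix A Y Z) (mix A Z Y))"
      using insert.IH[OF A] .
    also have "\<dots> = tuple_pairing I (\<lambda>Y Z. H (mix A (Y(j := Z j)) (Z(j := Y j))) (mix A (Z(j := Y j)) (Y(j := Z j))))"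
      by (rule tuple_pairing_swap_one[OF I j(1) k m])
    finally have "tuple_pairing I H =
      tuple_pairing I (\<lambda>Y Z. H (mix A (Y(j := Z j)) (Z(j := Y j))) (mix A (Z(j := Y j)) (Y(j := Z j))))" .
    moreover have "mix A (Y(j := Z j)) (Z(j := Y j)) = mix (insert j A) Y Z" for Y Z
      using j by (auto simp: mix_def fun_eq_iff)
    ultimately show ?case by (simp only:)
  qed
  show ?thesis
    unfolding *[OF order_refl]
    by (rule tuple_pairing_cong) (simp add: mix_def extensional_restrict cong: restrict_cong)
qed

text \<open>Symmetry for \<open>H Y Z = p Y * h Z\<close>, where \<open>p\<close> is chosen to turn the weight of \<open>tuple_pairing\<close> into
  a Gaussian one. After the exchange, the integral over \<open>Z\<close> involves only the subspace; its value will
  turn out to depend on nothing but dimensions.\<close>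

lemma linear_blaschke_petkantschin:
  fixes h :: "('i \<Rightarrow> 'a::euclidean_space) \<Rightarrow> ennreal"
  assumes I: "finite I" and k: "card I < DIM('a)"
    and [measurable]: "h \<in> borel_measurable (Pi\<^sub>M I (\<lambda>_. borel))"
  shows "(\<integral>\<^sup>+Y. (\<Prod>i\<in>I. gauss (Y i)) * (\<integral>\<^sup>+Z. h Z \<partial>Pi\<^sub>M I (\<lambda>_. flat_measure (span (Y ` I)))) \<partial>Pi\<^sub>M I (\<lambda>_. lborel)) =
    (\<integral>\<^sup>+Y. h Y * inv_volume I Y ^ (DIM('a) - card I) *
       (\<integral>\<^sup>+Z. (\<Prod>i\<in>I. gauss (Z i)) * inverse (inv_volume I Z) ^ (DIM('a) - card I)
          \<partial>Pi\<^sub>M I (\<lambda>_. flat_measure (span (Y ` I)))) \<partial>Pi\<^sub>M I (\<lambda>_. lborel))"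
    (is "?L = ?R")
proof -
  define m where "m = DIM('a) - card I"
  define p where "p Y = (\<Prod>i\<in>I. gauss (Y i)) * inverse (inv_volume I Y) ^ m" for Y :: "'i \<Rightarrow> 'a"
  have pm[measurable]: "p \<in> borel_measurable (Pi\<^sub>M I (\<lambda>_. borel))"
    unfolding p_def using I by measurable
  have pY: "(\<lambda>Z. u Z) \<in> borel_measurable (Pi\<^sub>M I (\<lambda>_. flat_measure S))"
    if "u \<in> borel_measurable (Pi\<^sub>M I (\<lambda>_. borel))" for S :: "'a set" and u :: "('i \<Rightarrow> 'a) \<Rightarrow> ennreal"
    using that by measurable
  have ind: "AE Y in Pi\<^sub>M I (\<lambda>_. lborel :: 'a measure). inv_volume I Y < top"
    using k I by (intro AE_lborel_independent) auto
  have "?L = tuple_pairing I (\<lambda>Y Z. p Y * h Z)"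
    unfolding tuple_pairing_def m_def[symmetric]
  proof (intro nn_integral_cong_AE, use ind in eventually_elim)
    fix Y :: "'i \<Rightarrow> 'a" assume "inv_volume I Y < top"
    then have "inv_volume I Y ^ m * inverse (inv_volume I Y) ^ m = 1"
      using I by (simp add: ennreal_times_inverse flip: power_mult_distrib)
    then have "inv_volume I Y ^ m * p Y = (\<Prod>i\<in>I. gauss (Y i))"
      unfolding p_def by (subst mult.left_commute) simp
    then show "(\<Prod>i\<in>I. gauss (Y i)) * (\<integral>\<^sup>+Z. h Z \<partial>Pi\<^sub>M I (\<lambda>_. flat_measure (span (Y ` I)))) =
      inv_volume I Y ^ m * (\<integral>\<^sup>+Z. p Y * h Z \<partial>Pi\<^sub>M I (\<lambda>_. flat_measure (span (Y ` I))))"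
      by (subst nn_integral_cmult) (auto intro!: pY simp flip: mult.assoc)
  qed
  also have "\<dots> = tuple_pairing I (\<lambda>Y Z. p Z * h Y)"
    by (rule tuple_pairing_commute[OF I k]) measurable
  also have "\<dots> = ?R"
    unfolding tuple_pairing_def m_def[symmetric] p_def[symmetric]
    by (intro nn_integral_cong, subst nn_integral_multc) (auto intro!: pY simp: ac_simps)
  finally show ?thesis .
qed

section \<open>Gaussian moments\<close>

lemma nn_integral_flat_measure_scale:
  fixes S :: "'a::euclidean_space set"
  assumes S: "subspace S" and c: "c \<noteq> 0" and [measurable]: "h \<in> borel_measurable borel"
  shows "(\<integral>\<^sup>+y. h y \<partial>flat_measure S) = ennreal (\<bar>c\<bar> ^ dim S) * (\<integral>\<^sup>+y. h (c *\<^sub>R y) \<partial>flat_measure S)"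
proof -
  obtain B where B: "B \<subseteq> S" "independent B" "card B = dim S" "span B = S"
    by (rule orthonormal_basis_subspace[OF S])
  have fB: "finite B" using B(2) by (rule independent_imp_finite)
  have fin: "inv_volume B (\<lambda>b. b) < top"
    using B(2) fB by (simp add: inv_volume_finite_iff dim_eq_card_independent)
  have SB: "S = span ((\<lambda>b. b) ` B)" using B(4) by simp
  have "inv_volume B (\<lambda>b. b) * (\<integral>\<^sup>+y. h y \<partial>flat_measure S) =
    (\<integral>\<^sup>+a. h (lincomb B (\<lambda>b. b) a) \<partial>Pi\<^sub>M B (\<lambda>_. lborel))"
    unfolding SB by (rule nn_integral_lincomb[OF fB fin, symmetric]) measurable
  also have "\<dots> = ennreal (\<bar>c\<bar> ^ dim S) * (\<integral>\<^sup>+a. h (lincomb B (\<lambda>b. b) (\<lambda>i\<in>B. c * a i)) \<partial>Pi\<^sub>M B (\<lambda>_. lborel))"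
    unfolding B(3)[symmetric]
    by (rule nn_integral_PiM_lborel_scale[OF fB c, where k="\<lambda>a. h (lincomb B (\<lambda>b. b) a)"]) measurable
  also have "(\<integral>\<^sup>+a. h (lincomb B (\<lambda>b. b) (\<lambda>i\<in>B. c * a i)) \<partial>Pi\<^sub>M B (\<lambda>_. lborel)) =
    (\<integral>\<^sup>+a. h (c *\<^sub>R lincomb B (\<lambda>b. b) a) \<partial>Pi\<^sub>M B (\<lambda>_. lborel))"
    by (simp only: lincomb_scale)
  also have "\<dots> = inv_volume B (\<lambda>b. b) * (\<integral>\<^sup>+y. h (c *\<^sub>R y) \<partial>flat_measure S)"
    unfolding SB by (rule nn_integral_lincomb[OF fB fin]) measurable
  finally have "inv_volume B (\<lambda>b. b) * (\<integral>\<^sup>+y. h y \<partial>flat_measure S) =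
    inv_volume B (\<lambda>b. b) * (ennreal (\<bar>c\<bar> ^ dim S) * (\<integral>\<^sup>+y. h (c *\<^sub>R y) \<partial>flat_measure S))"
    by (simp only: mult.left_commute)
  then show ?thesis
    using fB less_imp_neq[OF fin] by (simp add: ennreal_mult_cancel_left)
qed

lemma nn_integral_Gamma_scaled:
  fixes p :: real
  assumes p: "p \<ge> 0"
  shows "(\<integral>\<^sup>+r. ennreal (indicator {0..} r * (pi * exp (- pi * r) * r powr p)) \<partial>lborel) =
    ennreal (pi powr (- p) * Gamma (p + 1))"
proof -
  have [simp]: "\<not> pi \<le> 0" by (simp add: not_le)
  have "ennreal (Gamma (p + 1)) = (\<integral>\<^sup>+t. ennreal (indicator {0..} t * t powr p / exp t) \<partial>lborel)"
    using Gamma_conv_nn_integral_real[of "p + 1"] p by simp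
  also have "\<dots> = ennreal \<bar>pi\<bar> * (\<integral>\<^sup>+t. ennreal (indicator {0..} (0 + pi * t) * (0 + pi * t) powr p / exp (0 + pi * t)) \<partial>lborel)"
    by (rule nn_integral_real_affine) auto
  also have "\<dots> = (\<integral>\<^sup>+t. ennreal (pi powr p) * ennreal (indicator {0..} t * (pi * exp (- pi * t) * t powr p)) \<partial>lborel)"
    by (subst nn_integral_cmult[symmetric])
       (auto intro!: nn_integral_cong simp: indicator_def powr_mult exp_minus field_simps zero_le_mult_iff simp flip: ennreal_mult)
  also have "\<dots> = ennreal (pi powr p) * (\<integral>\<^sup>+t. ennreal (indicator {0..} t * (pi * exp (- pi * t) * t powr p)) \<partial>lborel)"
    by (rule nn_integral_cmult) measurable
  finally have "ennreal (pi powr (- p)) * ennreal (Gamma (p + 1)) =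
    (ennreal (pi powr (- p)) * ennreal (pi powr p)) * (\<integral>\<^sup>+t. ennreal (indicator {0..} t * (pi * exp (- pi * t) * t powr p)) \<partial>lborel)"
    by (simp only: mult.assoc)
  moreover have "ennreal (pi powr (- p)) * ennreal (pi powr p) = 1"
    by (simp flip: ennreal_mult add: powr_minus)
  ultimately show ?thesis
    using p by (simp add: ennreal_mult)
qed

text \<open>The mean of the \<open>s\<close>-th power of the norm of a vector with density \<open>gauss\<close> in dimension \<open>d\<close>.\<close>

definition gaussian_moment :: "nat \<Rightarrow> nat \<Rightarrow> real" where
  "gaussian_moment d s = pi powr (- (real s / 2)) * Gamma (real (d + s) / 2) / Gamma (real d / 2)"

text \<open>Slicing the Gaussian weight along balls reduces the moment to the integral \<open>B s\<close> of the
  \<open>s\<close>-th power of the norm over the unit ball, since balls scale. A second slicing gives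
  \<open>B s = d / (d + s) * B 0\<close>, and the volume \<open>B 0\<close> of the unit ball is read off from the normalisation,
  the case \<open>s = 0\<close>.\<close>

lemma nn_integral_gauss_norm_power:
  fixes S :: "'a::euclidean_space set"
  assumes S: "subspace S" and d: "dim S > 0"
  shows "(\<integral>\<^sup>+y. gauss y * ennreal (norm y ^ s) \<partial>flat_measure S) = ennreal (gaussian_moment (dim S) s)"
proof -
  let ?d = "dim S"
  have [simp]: "\<not> S \<subseteq> {0}" using d dim_eq_0[of S] by linarith
  interpret sigma_finite_measure "flat_measure S" by (rule sigma_finite_flat_measure[OF S])
  interpret pair: pair_sigma_finite "flat_measure S" "lborel :: real measure" ..
  define B where "B s = (\<integral>\<^sup>+y. ennreal (norm y ^ s) * indicator {..1} (norm y) \<partial>flat_measure S)" for s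
  have ball: "(\<integral>\<^sup>+y. ennreal (norm y ^ s) * indicator {..c} (norm y) \<partial>flat_measure S) =
    ennreal (c ^ (?d + s)) * B s" if c: "c > 0" for c s
  proof -
    have "(\<integral>\<^sup>+y. ennreal (norm y ^ s) * indicator {..c} (norm y) \<partial>flat_measure S) =
      ennreal (\<bar>c\<bar> ^ ?d) * (\<integral>\<^sup>+y. ennreal (norm (c *\<^sub>R y) ^ s) * indicator {..c} (norm (c *\<^sub>R y)) \<partial>flat_measure S)"
      using c by (intro nn_integral_flat_measure_scale[OF S]) auto
    also have "(\<integral>\<^sup>+y. ennreal (norm (c *\<^sub>R y) ^ s) * indicator {..c} (norm (c *\<^sub>R y)) \<partial>flat_measure S) =
      (\<integral>\<^sup>+y. ennreal (c ^ s) * (ennreal (norm y ^ s) * indicator {..1} (norm y)) \<partial>flat_measure S)"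
      using c by (intro nn_integral_cong) (auto simp: power_mult_distrib indicator_def ennreal_mult)
    also have "\<dots> = ennreal (c ^ s) * B s"
      unfolding B_def by (rule nn_integral_cmult) measurable
    finally show ?thesis using c by (simp add: power_add ennreal_mult mult.assoc)
  qed
  have moment: "(\<integral>\<^sup>+y. gauss y * ennreal (norm y ^ s) \<partial>flat_measure S) =
    B s * ennreal (pi powr (- (real (?d + s) / 2)) * Gamma (real (?d + s) / 2 + 1))" for s
  proof -
    have g: "gauss y = (\<integral>\<^sup>+r. ennreal (pi * exp (- pi * r)) * indicator {(norm y)\<^sup>2..} r \<partial>lborel)" for y :: 'a
    proof -
      have lim: "((\<lambda>r. - exp (- pi * r)) \<longlongrightarrow> 0) at_top"
        by (rule tendsto_eq_intros filterlim_compose[OF exp_at_bot]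
              filterlim_tendsto_neg_mult_at_bot[OF tendsto_const _ filterlim_ident] | simp)+
      have "(\<integral>\<^sup>+r. ennreal (pi * exp (- pi * r)) * indicator {(norm y)\<^sup>2..} r \<partial>lborel) = 0 - (- exp (- pi * (norm y)\<^sup>2))"
        by (rule nn_integral_FTC_atLeast[OF _ _ _ lim]) (auto intro!: derivative_eq_intros)
      then show ?thesis by (simp add: gauss_def)
    qed
    have "(\<integral>\<^sup>+y. gauss y * ennreal (norm y ^ s) \<partial>flat_measure S) =
      (\<integral>\<^sup>+y. \<integral>\<^sup>+r. ennreal (pi * exp (- pi * r)) * indicator {(norm y)\<^sup>2..} r * ennreal (norm y ^ s) \<partial>lborel \<partial>flat_measure S)"
      unfolding g by (rule nn_integral_cong, rule nn_integral_multc[symmetric]) measurable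
    also have "\<dots> = (\<integral>\<^sup>+r. \<integral>\<^sup>+y. ennreal (pi * exp (- pi * r)) * indicator {(norm y)\<^sup>2..} r * ennreal (norm y ^ s) \<partial>flat_measure S \<partial>lborel)"
      by (rule pair.Fubini'[symmetric]) (unfold indicator_def atLeast_iff, measurable)
    also have "\<dots> = (\<integral>\<^sup>+r. ennreal (indicator {0..} r * (pi * exp (- pi * r) * r powr (real (?d + s) / 2))) * B s \<partial>lborel)"
    proof (intro nn_integral_cong_AE, use AE_lborel_singleton[of "0::real"] in eventually_elim)
      fix r :: real assume r: "r \<noteq> 0"
      show "(\<integral>\<^sup>+y. ennreal (pi * exp (- pi * r)) * indicator {(norm y)\<^sup>2..} r * ennreal (norm y ^ s) \<partial>flat_measure S) =
        ennreal (indicator {0..} r * (pi * exp (- pi * r) * r powr (real (?d + s) / 2))) * B s"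
      proof (cases "r > 0")
        case True
        have "(\<integral>\<^sup>+y. ennreal (pi * exp (- pi * r)) * indicator {(norm y)\<^sup>2..} r * ennreal (norm y ^ s) \<partial>flat_measure S) =
          (\<integral>\<^sup>+y. ennreal (pi * exp (- pi * r)) * (ennreal (norm y ^ s) * indicator {..sqrt r} (norm y)) \<partial>flat_measure S)"
        proof (rule nn_integral_cong)
          fix y :: 'a
          have "(norm y)\<^sup>2 \<le> r \<longleftrightarrow> norm y \<le> sqrt r"
            using real_sqrt_le_iff[of "(norm y)\<^sup>2" r] by simp
          then show "ennreal (pi * exp (- pi * r)) * indicator {(norm y)\<^sup>2..} r * ennreal (norm y ^ s) =
            ennreal (pi * exp (- pi * r)) * (ennreal (norm y ^ s) * indicator {..sqrt r} (norm y))"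
            by (simp add: indicator_def)
        qed
        also have "\<dots> = ennreal (pi * exp (- pi * r)) * (ennreal (sqrt r ^ (?d + s)) * B s)"
          using True by (subst nn_integral_cmult) (auto simp: ball)
        also have "sqrt r ^ (?d + s) = r powr (real (?d + s) / 2)"
          using True by (simp add: powr_half_sqrt[symmetric] powr_powr flip: powr_realpow)
        finally show ?thesis using True by (simp add: ennreal_mult mult.assoc)
      next
        case False
        then have "r < 0" using r by simp
        then have "\<not> (norm y)\<^sup>2 \<le> r" for y :: 'a
          using zero_le_power2[of "norm y"] by linarith
        then have "indicator {(norm y)\<^sup>2..} r = (0::ennreal)" for y :: 'a
          by (simp add: indicator_def)
        then show ?thesis using \<open>r < 0\<close> by simp
      qed
    qed
    also have "\<dots> = ennreal (pi powr (- (real (?d + s) / 2)) * Gamma (real (?d + s) / 2 + 1)) * B s"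
      by (subst nn_integral_multc, measurable) (subst nn_integral_Gamma_scaled, auto)
    finally show ?thesis by (simp add: mult.commute)
  qed
  have m0: "B 0 * ennreal (pi powr (- (real ?d / 2)) * Gamma (real ?d / 2 + 1)) = 1"
    using moment[of 0] normalized_haarD(5)[OF normalized_haar_flat_measure[OF S]] by simp
  have pos: "pi powr (- (real (?d + s) / 2)) * Gamma (real (?d + s) / 2 + 1) > 0" for s
    by (simp add: add_pos_nonneg Gamma_real_pos add_nonneg_pos)
  have "B 0 \<noteq> top"
    using m0 pos[of 0] by (auto simp: ennreal_top_mult split: if_splits)
  have "B s \<le> B 0"
    unfolding B_def by (intro nn_integral_mono) (auto simp: indicator_def power_le_one)
  then have "B s \<noteq> top" using \<open>B 0 \<noteq> top\<close> by (auto simp: top_unique)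
  obtain b0 where b0: "B 0 = ennreal b0" "b0 \<ge> 0" using \<open>B 0 \<noteq> top\<close> by (cases "B 0") auto
  obtain bs where bs: "B s = ennreal bs" "bs \<ge> 0" using \<open>B s \<noteq> top\<close> by (cases "B s") auto
  have "bs = real ?d / real (?d + s) * b0"
  proof (cases "s = 0")
    case True
    then show ?thesis using b0 bs d by simp
  next
    case False
    let ?k = "\<lambda>y t. ennreal (real s * t ^ (s - 1)) * indicator {0..1} t * indicator {..t} (norm (y::'a))"
    have k: "(\<integral>\<^sup>+t. ?k y t \<partial>lborel) = ennreal (1 - norm y ^ s) * indicator {..1} (norm y)" for y
    proof (cases "norm y \<le> 1")
      case True
      have "(\<integral>\<^sup>+t. ?k y t \<partial>lborel) = (\<integral>\<^sup>+t. ennreal (real s * t ^ (s - 1)) * indicator {norm y..1} t \<partial>lborel)"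
        by (intro nn_integral_cong) (auto simp: indicator_def intro: order_trans[OF norm_ge_zero])
      also have "\<dots> = 1 ^ s - norm y ^ s"
      proof (rule nn_integral_FTC_Icc)
        show "0 \<le> real s * t ^ (s - 1)" if t: "t \<in> {norm y..1}" for t
        proof -
          have "0 \<le> t" using t norm_ge_zero[of y] by (simp del: norm_ge_zero)
          then show ?thesis by simp
        qed
      qed (use True in \<open>auto intro!: derivative_eq_intros\<close>)
      finally show ?thesis using True by simp
    next
      case False
      then have "(\<integral>\<^sup>+t. ?k y t \<partial>lborel) = (\<integral>\<^sup>+t. 0 \<partial>(lborel :: real measure))"
        by (intro nn_integral_cong) (auto simp: indicator_def)
      then show ?thesis using False by simp
    qed
    have "B 0 = (\<integral>\<^sup>+y. ennreal (norm y ^ s) * indicator {..1} (norm y) + ennreal (1 - norm y ^ s) * indicator {..1} (norm y) \<partial>flat_measure S)"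
      unfolding B_def by (intro nn_integral_cong) (auto simp: indicator_def power_le_one simp flip: ennreal_plus)
    also have "\<dots> = B s + (\<integral>\<^sup>+y. \<integral>\<^sup>+t. ?k y t \<partial>lborel \<partial>flat_measure S)"
      unfolding B_def k by (rule nn_integral_add) measurable
    also have "(\<integral>\<^sup>+y. \<integral>\<^sup>+t. ?k y t \<partial>lborel \<partial>flat_measure S) = (\<integral>\<^sup>+t. \<integral>\<^sup>+y. ?k y t \<partial>flat_measure S \<partial>lborel)"
      by (rule pair.Fubini'[symmetric]) (unfold indicator_def atMost_iff, measurable)
    also have "\<dots> = (\<integral>\<^sup>+t. (ennreal (real s * t ^ (s - 1 + ?d)) * indicator {0..1} t) * B 0 \<partial>lborel)"
    proof (intro nn_integral_cong_AE, use AE_lborel_singleton[of "0::real"] in eventually_elim)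
      fix t :: real assume t: "t \<noteq> 0"
      have "(\<integral>\<^sup>+y. ?k y t \<partial>flat_measure S) = (ennreal (real s * t ^ (s - 1)) * indicator {0..1} t) * (\<integral>\<^sup>+y. indicator {..t} (norm y) \<partial>flat_measure S)"
        by (rule nn_integral_cmult) measurable
      then show "(\<integral>\<^sup>+y. ?k y t \<partial>flat_measure S) = (ennreal (real s * t ^ (s - 1 + ?d)) * indicator {0..1} t) * B 0"
        using t ball[of t 0] by (cases "0 < t \<and> t \<le> 1") (auto simp: indicator_def power_add ennreal_mult ac_simps)
    qed
    also have "\<dots> = (\<integral>\<^sup>+t. ennreal (real s * t ^ (s - 1 + ?d)) * indicator {0..1} t \<partial>lborel) * B 0"
      by (rule nn_integral_multc) measurable
    also have "(\<integral>\<^sup>+t. ennreal (real s * t ^ (s - 1 + ?d)) * indicator {0..1} t \<partial>lborel) =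
      real s / real (?d + s) * 1 ^ (?d + s) - real s / real (?d + s) * 0 ^ (?d + s)"
    proof (rule nn_integral_FTC_Icc)
      show "((\<lambda>t. real s / real (?d + s) * t ^ (?d + s)) has_real_derivative real s * t ^ (s - 1 + ?d)) (at t)" for t :: real
        using False d by (auto intro!: derivative_eq_intros simp: divide_simps add.commute)
    qed auto
    finally have "ennreal b0 = ennreal bs + ennreal (real s / real (?d + s)) * ennreal b0"
      using False d b0 bs by (simp add: power_0_left)
    also have "\<dots> = ennreal (bs + real s / real (?d + s) * b0)"
    proof -
      have "0 \<le> real s / real (?d + s)" by simp
      then show ?thesis using b0(2) bs(2)
        by (simp only: ennreal_plus[OF bs(2) mult_nonneg_nonneg[OF _ b0(2)]] ennreal_mult[OF _ b0(2)])
    qed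
    finally have "ennreal b0 = ennreal (bs + real s / real (?d + s) * b0)" .
    then have "b0 = bs + real s / real (?d + s) * b0"
      using b0 bs by (subst (asm) ennreal_inj) auto
    then show ?thesis using d by (simp add: field_simps)
  qed
  note bs_b0 = this
  have G: "Gamma (x + 1) = x * Gamma x" if "x > 0" for x :: real
    using that by (intro Gamma_plus1) (auto elim: nonpos_Ints_cases)
  define P Q g g' D M where defs: "P = pi powr (- (real ?d / 2))" "Q = pi powr (- (real s / 2))"
    "g = Gamma (real ?d / 2)" "g' = Gamma (real (?d + s) / 2)" "D = real ?d" "M = real (?d + s)"
  have "Gamma (real ?d / 2) > 0" using d by (intro Gamma_real_pos) simp
  then have nz: "g \<noteq> 0" "M \<noteq> 0" unfolding defs using d by linarith+
  have "b0 * (pi powr (- (real ?d / 2)) * Gamma (real ?d / 2 + 1)) = 1"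
    using m0 b0 pos[of 0] by (simp flip: ennreal_mult add: ennreal_eq_1)
  then have b0g: "b0 * (P * (D / 2 * g)) = 1"
    unfolding defs using d by (subst (asm) G) auto
  have "pi powr (- (real (?d + s) / 2)) = P * Q"
    by (simp add: defs add_divide_distrib flip: powr_add)
  moreover have "Gamma (real (?d + s) / 2 + 1) = M / 2 * g'"
    unfolding defs using d by (subst G) auto
  moreover have "bs * (P * Q * (M / 2 * g')) = (b0 * (P * (D / 2 * g))) * (Q * g' / g)"
    unfolding bs_b0 defs(5,6)[symmetric] using nz by (simp add: field_simps)
  ultimately have "bs * (pi powr (- (real (?d + s) / 2)) * Gamma (real (?d + s) / 2 + 1)) = gaussian_moment ?d s"
    unfolding b0g gaussian_moment_def defs(2-4)[symmetric] by (simp only: mult_1)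
  then show ?thesis
    unfolding moment bs(1) using bs(2) pos[of s] by (simp flip: ennreal_mult)
qed

lemma inverse_line_weight: "d \<ge> 0 \<Longrightarrow> inverse (line_weight d) = ennreal d"
  by (auto simp: line_weight_def inverse_ennreal)

text \<open>The distance to \<open>E\<close> is the norm of the component orthogonal to \<open>E\<close>, and that component of a
  Gaussian vector is Gaussian.\<close>

lemma nn_integral_gauss_distance_power:
  fixes S E :: "'a::euclidean_space set"
  assumes S: "subspace S" and E: "subspace E" and ES: "E \<subseteq> S" and d: "dim E < dim S"
  shows "(\<integral>\<^sup>+y. gauss y * ennreal (norm (y - closest_point E y) ^ s) \<partial>flat_measure S) =
    ennreal (gaussian_moment (dim S - dim E) s)"
proof -
  define Q where "Q = {y \<in> S. \<forall>x\<in>E. orthogonal x y}"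
  have Q: "subspace Q"
    using S by (auto simp: Q_def subspace_def orthogonal_clauses)
  have QS: "Q \<subseteq> S" by (auto simp: Q_def)
  have dQ: "dim Q = dim S - dim E"
    using dim_subspace_orthogonal_to_vectors[OF E S ES] by (simp add: Q_def)
  have Qa: "affine Q" "Q \<noteq> {}" using subspace_imp_affine[OF Q] subspace_0[OF Q] by auto
  note [measurable] = borel_measurable_closest_point[OF Qa]
  have PQ: "closest_point Q y = y - closest_point E y" if y: "y \<in> S" for y
  proof (rule closest_point_subspaceI[OF Q])
    show "y - closest_point E y \<in> Q"
      using y ES closest_point_subspace_mem[OF E, of y] closest_point_subspace_orth[OF E, of _ y]
      by (auto simp: Q_def orthogonal_def inner_commute intro!: subspace_diff[OF S])
    show "(y - (y - closest_point E y)) \<bullet> s = 0" if "s \<in> Q" for s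
      using that closest_point_subspace_mem[OF E, of y] by (simp add: Q_def orthogonal_def)
  qed
  have aS: "AE y in flat_measure S. y \<in> S"
    by (rule normalized_haarD(3)[OF normalized_haar_flat_measure[OF S]])
  have "ennreal (gaussian_moment (dim S - dim E) s) = (\<integral>\<^sup>+y. gauss y * ennreal (norm y ^ s) \<partial>flat_measure Q)"
    using d by (subst nn_integral_gauss_norm_power[OF Q]) (auto simp: dQ)
  also have "\<dots> = (\<integral>\<^sup>+y. gauss (y - closest_point Q y) * (gauss (closest_point Q y) * ennreal (norm (closest_point Q y) ^ s)) \<partial>flat_measure S)"
    unfolding flat_measure_project[OF Q S QS] by (simp add: nn_integral_distr nn_integral_density)
  also have "\<dots> = (\<integral>\<^sup>+y. gauss y * ennreal (norm (y - closest_point E y) ^ s) \<partial>flat_measure S)"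
  proof (intro nn_integral_cong_AE, use aS in eventually_elim)
    fix y assume "y \<in> S"
    have "gauss y = gauss (closest_point Q y) * gauss (y - closest_point Q y)"
      by (rule gauss_orthogonal[OF norm_closest_point_pythagoras[OF Q]])
    then show "gauss (y - closest_point Q y) * (gauss (closest_point Q y) * ennreal (norm (closest_point Q y) ^ s)) =
      gauss y * ennreal (norm (y - closest_point E y) ^ s)"
      using PQ[OF \<open>y \<in> S\<close>] by (simp add: ac_simps)
  qed
  finally show ?thesis ..
qed

text \<open>Adding the vectors one at a time, the volume is multiplied by the distance of the new vector to
  the span of the old ones, and that distance depends only on a Gaussian vector of the orthogonal
  complement.\<close>

lemma nn_integral_gauss_volume_power:
  fixes S :: "'a::euclidean_space set"
  assumes S: "subspace S" and I: "finite I" "card I \<le> dim S"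
  shows "(\<integral>\<^sup>+Z. (\<Prod>i\<in>I. gauss (Z i)) * inverse (inv_volume I Z) ^ s \<partial>Pi\<^sub>M I (\<lambda>_. flat_measure S)) =
    (\<Prod>i<card I. ennreal (gaussian_moment (dim S - i) s))"
  using I
proof (induction I rule: finite_induct)
  case empty
  show ?case by (simp add: space_PiM)
next
  case (insert j J)
  interpret product_sigma_finite "\<lambda>_. flat_measure S"
    by (rule product_sigma_finite_flat_measure_subspace[OF S])
  have fI: "finite (insert j J)" using insert by simp
  have ind: "AE X in Pi\<^sub>M J (\<lambda>_. flat_measure S). (\<forall>i\<in>J. X i \<in> S) \<and> inv_volume J X < top"
    using insert by (intro AE_PiM_flat_measure_independent[OF S]) auto
  let ?d = "dim S - card J"
  have meas: "(\<lambda>Z. (\<Prod>i\<in>I. gauss (Z i)) * inverse (inv_volume I Z) ^ s) \<in> borel_measurable (Pi\<^sub>M I (\<lambda>_. flat_measure S))"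
    if "finite I" for I
    using that by measurable
  have "(\<integral>\<^sup>+Z. (\<Prod>i\<in>insert j J. gauss (Z i)) * inverse (inv_volume (insert j J) Z) ^ s \<partial>Pi\<^sub>M (insert j J) (\<lambda>_. flat_measure S)) =
    (\<integral>\<^sup>+X. \<integral>\<^sup>+y. (\<Prod>i\<in>insert j J. gauss ((X(j := y)) i)) * inverse (inv_volume (insert j J) (X(j := y))) ^ s
       \<partial>flat_measure S \<partial>Pi\<^sub>M J (\<lambda>_. flat_measure S))"
    by (rule product_nn_integral_insert[OF insert.hyps meas[OF fI]])
  also have "\<dots> = (\<integral>\<^sup>+X. ((\<Prod>i\<in>J. gauss (X i)) * inverse (inv_volume J X) ^ s) * ennreal (gaussian_moment ?d s) \<partial>Pi\<^sub>M J (\<lambda>_. flat_measure S))"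
  proof (intro nn_integral_cong_AE, use ind in eventually_elim)
    fix X assume X: "(\<forall>i\<in>J. X i \<in> S) \<and> inv_volume J X < top"
    let ?E = "span (X ` J)"
    have ES: "?E \<subseteq> S" using X S by (intro span_minimal) auto
    have dE: "dim ?E = card J" using X insert.hyps inv_volume_finite_iff[of J X] by simp
    have Ea: "affine ?E" "?E \<noteq> {}"
      using subspace_imp_affine[OF subspace_span[of "X ` J"]] subspace_0[OF subspace_span[of "X ` J"]] by auto
    note [measurable] = borel_measurable_closest_point[OF Ea]
    have "(\<Prod>i\<in>insert j J. gauss ((X(j := y)) i)) * inverse (inv_volume (insert j J) (X(j := y))) ^ s =
      ((\<Prod>i\<in>J. gauss (X i)) * inverse (inv_volume J X) ^ s) *
        (gauss y * ennreal (norm (y - closest_point ?E y) ^ s))" for y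
    proof -
      have im: "X(j := y) ` J = X ` J" using insert.hyps by auto
      have "inv_volume J (X(j := y)) = inv_volume J X"
        using insert.hyps by (intro inv_volume_cong) auto
      then have "inverse (inv_volume (insert j J) (X(j := y))) =
        inverse (inv_volume J X) * ennreal (norm (y - closest_point ?E y))"
        using insert.hyps X unfolding inv_volume_insert[OF insert.hyps] im fun_upd_same
        by (subst ennreal_inverse_mult') (auto simp: line_weight_pos inverse_line_weight zero_less_iff_neq_zero)
      moreover have "(\<Prod>i\<in>J. gauss ((X(j := y)) i)) = (\<Prod>i\<in>J. gauss (X i))"
        using insert.hyps by (intro prod.cong) auto
      ultimately show ?thesis
        using insert.hyps by (simp add: power_mult_distrib ennreal_power ac_simps)
    qed
    moreover have "(\<integral>\<^sup>+y. ((\<Prod>i\<in>J. gauss (X i)) * inverse (inv_volume J X) ^ s) *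
        (gauss y * ennreal (norm (y - closest_point ?E y) ^ s)) \<partial>flat_measure S) =
      ((\<Prod>i\<in>J. gauss (X i)) * inverse (inv_volume J X) ^ s) * ennreal (gaussian_moment ?d s)"
      using insert.prems insert.hyps nn_integral_gauss_distance_power[OF S subspace_span ES, of s]
      by (subst nn_integral_cmult) (auto simp: dE[simplified])
    ultimately show "(\<integral>\<^sup>+y. (\<Prod>i\<in>insert j J. gauss ((X(j := y)) i)) * inverse (inv_volume (insert j J) (X(j := y))) ^ s \<partial>flat_measure S) =
      ((\<Prod>i\<in>J. gauss (X i)) * inverse (inv_volume J X) ^ s) * ennreal (gaussian_moment ?d s)"
      by (simp only:)
  qed
  also have "\<dots> = (\<Prod>i<card J. ennreal (gaussian_moment (dim S - i) s)) * ennreal (gaussian_moment ?d s)"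
    using insert meas[of J] by (subst nn_integral_multc) auto
  also have "\<dots> = (\<Prod>i<card (insert j J). ennreal (gaussian_moment (dim S - i) s))"
    using insert.hyps by simp
  finally show ?case .
qed

text \<open>The Gamma factors of the moments are the quotients of those of the two \<open>stiefel_sigma\<close>, index by
  index; only powers of \<open>\<pi>\<close> remain to be compared, and the powers of \<open>2\<close> cancel.\<close>

lemma prod_gaussian_moment_eq_stiefel:
  assumes k: "1 \<le> k" "k \<le> n"
  shows "(\<Prod>i<k. gaussian_moment (k - i) (n - k)) = stiefel_sigma k k / stiefel_sigma n k"
    and "stiefel_sigma k k / stiefel_sigma n k > 0"
proof -
  have G: "(\<Prod>j<k. Gamma (real m / 2 - real j / 2)) > 0" if "k \<le> m" for m
    using that by (intro prod_pos ballI Gamma_real_pos) auto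
  have st: "stiefel_sigma m k = 2 ^ k * pi powr (real m * real k / 2) /
    (pi powr (real k * (real k - 1) / 4) * (\<Prod>j<k. Gamma (real m / 2 - real j / 2)))" for m
    by (simp add: stiefel_sigma_def siegel_Gamma_def)
  have "(\<Prod>i<k. gaussian_moment (k - i) (n - k)) =
    (\<Prod>i<k. pi powr (- (real (n - k) / 2)) * Gamma (real n / 2 - real i / 2) / Gamma (real k / 2 - real i / 2))"
    using k by (intro prod.cong refl) (auto simp: gaussian_moment_def of_nat_diff diff_divide_distrib)
  also have "\<dots> = (pi powr (- (real (n - k) / 2))) ^ k * (\<Prod>j<k. Gamma (real n / 2 - real j / 2)) / (\<Prod>j<k. Gamma (real k / 2 - real j / 2))"
    by (simp add: prod_dividef prod.distrib)
  also have "(pi powr (- (real (n - k) / 2))) ^ k = pi powr (real k * real k / 2) / pi powr (real n * real k / 2)"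
    using k by (simp add: powr_powr of_nat_diff algebra_simps diff_divide_distrib flip: powr_realpow powr_diff)
  finally show "(\<Prod>i<k. gaussian_moment (k - i) (n - k)) = stiefel_sigma k k / stiefel_sigma n k"
    using G[of n] G[of k] k unfolding st by (simp add: field_simps)
  show "stiefel_sigma k k / stiefel_sigma n k > 0"
    using G[of n] G[of k] k unfolding st by (intro divide_pos_pos mult_pos_pos) auto
qed

lemma linear_blaschke_petkantschin_stiefel:
  fixes h :: "('i \<Rightarrow> 'a::euclidean_space) \<Rightarrow> ennreal"
  assumes I: "finite I" and k: "1 \<le> card I" "card I < DIM('a)"
    and [measurable]: "h \<in> borel_measurable (Pi\<^sub>M I (\<lambda>_. borel))"
  shows "(\<integral>\<^sup>+Y. (\<Prod>i\<in>I. gauss (Y i)) * (\<integral>\<^sup>+Z. h Z \<partial>Pi\<^sub>M I (\<lambda>_. flat_measure (span (Y ` I)))) \<partial>Pi\<^sub>M I (\<lambda>_. lborel)) =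
    ennreal (stiefel_sigma (card I) (card I) / stiefel_sigma DIM('a) (card I)) *
      (\<integral>\<^sup>+Y. h Y * inv_volume I Y ^ (DIM('a) - card I) \<partial>Pi\<^sub>M I (\<lambda>_. lborel))"
proof -
  have ind: "AE Y in Pi\<^sub>M I (\<lambda>_. lborel :: 'a measure). inv_volume I Y < top"
    using k I by (intro AE_lborel_independent) auto
  have nonneg: "gaussian_moment d s \<ge> 0" for d s
    unfolding gaussian_moment_def by (cases "d = 0") (auto intro!: divide_nonneg_nonneg mult_nonneg_nonneg less_imp_le[OF Gamma_real_pos])
  have "(\<integral>\<^sup>+Z. (\<Prod>i\<in>I. gauss (Z i)) * inverse (inv_volume I Z) ^ (DIM('a) - card I) \<partial>Pi\<^sub>M I (\<lambda>_. flat_measure (span (Y ` I)))) =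
    ennreal (stiefel_sigma (card I) (card I) / stiefel_sigma DIM('a) (card I))"
    if "inv_volume I Y < top" for Y :: "'i \<Rightarrow> 'a"
  proof -
    have d: "dim (span (Y ` I)) = card I" using that inv_volume_finite_iff[OF I, of Y] by simp
    show ?thesis
      using nn_integral_gauss_volume_power[OF subspace_span I, of "Y ` I" "DIM('a) - card I"] k
        prod_gaussian_moment_eq_stiefel(1)[of "card I" "DIM('a)"] nonneg
      unfolding d by (simp add: prod_ennreal)
  qed
  note K = this
  have "(\<integral>\<^sup>+Y. h Y * inv_volume I Y ^ (DIM('a) - card I) *
       (\<integral>\<^sup>+Z. (\<Prod>i\<in>I. gauss (Z i)) * inverse (inv_volume I Z) ^ (DIM('a) - card I)
          \<partial>Pi\<^sub>M I (\<lambda>_. flat_measure (span (Y ` I)))) \<partial>Pi\<^sub>M I (\<lambda>_. lborel)) =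
    (\<integral>\<^sup>+Y. h Y * inv_volume I Y ^ (DIM('a) - card I) *
      ennreal (stiefel_sigma (card I) (card I) / stiefel_sigma DIM('a) (card I)) \<partial>Pi\<^sub>M I (\<lambda>_. lborel))"
    by (intro nn_integral_cong_AE, use ind in eventually_elim) (simp only: K)
  also have "\<dots> = (\<integral>\<^sup>+Y. h Y * inv_volume I Y ^ (DIM('a) - card I) \<partial>Pi\<^sub>M I (\<lambda>_. lborel)) *
      ennreal (stiefel_sigma (card I) (card I) / stiefel_sigma DIM('a) (card I))"
    using I by (intro nn_integral_multc) measurable
  finally show ?thesis
    unfolding linear_blaschke_petkantschin[OF I k(2) assms(4)] by (simp only: mult.commute)
qed

section \<open>The invariant measure on the Grassmannian\<close>

lemma space_flat_borel[simp]: "space (flat_borel \<Omega>) = \<Omega>"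
  unfolding flat_borel_def by (intro space_measure_of) auto

lemma sets_flat_borel: "sets (flat_borel \<Omega>) = sigma_sets \<Omega> {{\<tau> \<in> \<Omega>. closest_point \<tau> x \<in> A} | x A. A \<in> sets borel}"
  unfolding flat_borel_def by (intro sets_measure_of) auto

lemma measurable_closest_point_flat_borel:
  "(\<lambda>\<tau>. closest_point \<tau> x) \<in> flat_borel \<Omega> \<rightarrow>\<^sub>M (borel :: 'a::euclidean_space measure)"
proof (rule measurableI)
  fix A :: "'a set" assume A: "A \<in> sets borel"
  have "(\<lambda>\<tau>. closest_point \<tau> x) -` A \<inter> space (flat_borel \<Omega>) = {\<tau> \<in> \<Omega>. closest_point \<tau> x \<in> A}" by auto
  then show "(\<lambda>\<tau>. closest_point \<tau> x) -` A \<inter> space (flat_borel \<Omega>) \<in> sets (flat_borel \<Omega>)"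
    using A unfolding sets_flat_borel by (auto intro: sigma_sets.Basic)
qed simp

lemma measurable_flat_borelI:
  fixes f :: "'m \<Rightarrow> 'a::euclidean_space set"
  assumes f: "\<And>m. m \<in> space M \<Longrightarrow> f m \<in> \<Omega>"
    and cp: "\<And>x. (\<lambda>m. closest_point (f m) x) \<in> borel_measurable M"
  shows "f \<in> M \<rightarrow>\<^sub>M flat_borel \<Omega>"
  unfolding flat_borel_def
proof (rule measurable_measure_of)
  fix y assume "y \<in> {{\<tau> \<in> \<Omega>. closest_point \<tau> x \<in> A} | x A. A \<in> sets borel}"
  then obtain x A where y: "y = {\<tau> \<in> \<Omega>. closest_point \<tau> x \<in> A}" and A: "A \<in> sets borel" by blast
  have "f -` y \<inter> space M = (\<lambda>m. closest_point (f m) x) -` A \<inter> space M" using f by (auto simp: y)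
  then show "f -` y \<inter> space M \<in> sets M" using measurable_sets[OF cp A] by simp
qed (use f in auto)

lemma grassmannianD:
  assumes "\<xi> \<in> grassmannian k"
  shows "subspace \<xi>" "dim \<xi> = k" "affine \<xi>" "\<xi> \<noteq> {}"
  using assms subspace_imp_affine subspace_0 by (auto simp: grassmannian_def)

lemma affine_grassmannianD:
  assumes "\<tau> \<in> affine_grassmannian k"
  shows "affine \<tau>" "aff_dim \<tau> = int k" "\<tau> \<noteq> {}"
  using assms by (auto simp: affine_grassmannian_def)

lemma flat_family_grassmannian: "flat_family (flat_borel (grassmannian k)) (\<lambda>\<xi>. \<xi>)"
  by (simp add: flat_family_def measurable_closest_point_flat_borel grassmannianD)

lemma flat_family_affine_grassmannian: "flat_family (flat_borel (affine_grassmannian k)) (\<lambda>\<tau>. \<tau>)"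
  by (simp add: flat_family_def measurable_closest_point_flat_borel affine_grassmannianD)

lemma span_in_grassmannian:
  "finite I \<Longrightarrow> inv_volume I Y < top \<Longrightarrow> span (Y ` I) \<in> grassmannian (card I)"
  using inv_volume_finite_iff[of I Y] by (simp add: grassmannian_def)

lemma inv_volume_insert_less_top:
  assumes "finite J" "j \<notin> J"
  shows "inv_volume (insert j J) Y < top \<longleftrightarrow> inv_volume J Y < top \<and> Y j \<notin> span (Y ` J)"
  using assms closest_point_eq_iff_span[of "Y ` J" "Y j"]
  by (auto simp: inv_volume_insert ennreal_mult_less_top line_weight_def)

lemma grassmannian_orthogonal_image:
  fixes U :: "'a::euclidean_space \<Rightarrow> 'a"
  assumes U: "orthogonal_transformation U" and \<xi>: "\<xi> \<in> grassmannian k"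
  shows "U ` \<xi> \<in> grassmannian k"
proof -
  have "linear U" "inj U" using U by (auto intro: orthogonal_transformation_linear orthogonal_transformation_inj)
  then show ?thesis
    using \<xi> by (auto simp: grassmannian_def dim_image_eq linear_subspace_image inj_on_subset)
qed

lemma measurable_orthogonal_image:
  fixes U :: "'a::euclidean_space \<Rightarrow> 'a"
  assumes U: "orthogonal_transformation U"
  shows "(`) U \<in> flat_borel (grassmannian k) \<rightarrow>\<^sub>M flat_borel (grassmannian k)"
proof (rule measurable_flat_borelI)
  show "U ` \<xi> \<in> grassmannian k" if "\<xi> \<in> space (flat_borel (grassmannian k))" for \<xi>
    using grassmannian_orthogonal_image[OF U] that by simp
  fix x
  obtain y where y: "x = U y" using orthogonal_transformation_surj[OF U] by blast
  have "U \<in> borel_measurable borel"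
    using orthogonal_transformation_linear[OF U] by (simp add: borel_measurable_continuous_onI linear_continuous_on linear_linear)
  then have "(\<lambda>\<xi>. U (closest_point \<xi> y)) \<in> borel_measurable (flat_borel (grassmannian k))"
    by (rule measurable_compose[OF measurable_closest_point_flat_borel])
  then show "(\<lambda>\<xi>. closest_point (U ` \<xi>) x) \<in> borel_measurable (flat_borel (grassmannian k))"
    by (rule measurable_cong[THEN iffD1, rotated])
       (simp add: y closest_point_orthogonal_image[OF U] grassmannianD)
qed

subsection \<open>Gaussian tuples\<close>

definition gauss_measure :: "'a::euclidean_space measure" where
  "gauss_measure = density lborel gauss"

lemma sets_gauss_measure[measurable_cong, simp]: "sets gauss_measure = sets borel"
  by (simp add: gauss_measure_def)

lemma space_gauss_measure[simp]: "space gauss_measure = UNIV"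
  by (simp add: gauss_measure_def)

lemma prob_space_gauss_measure: "prob_space (gauss_measure :: 'a::euclidean_space measure)"
  using normalized_haarD(5)[OF normalized_haar_UNIV, where 'a='a]
  by (intro prob_spaceI) (simp add: gauss_measure_def emeasure_density)

lemma product_sigma_finite_gauss_measure: "product_sigma_finite (\<lambda>_. gauss_measure)"
  by (intro product_sigma_finite.intro prob_space_imp_sigma_finite prob_space_gauss_measure)

lemma prob_space_gauss_tuple: "prob_space (Pi\<^sub>M I (\<lambda>_. gauss_measure))"
  by (intro prob_space_PiM prob_space_gauss_measure)

lemma nn_integral_gauss_tuple:
  fixes G :: "('i \<Rightarrow> 'a::euclidean_space) \<Rightarrow> ennreal"
  assumes I: "finite I" and [measurable]: "G \<in> borel_measurable (Pi\<^sub>M I (\<lambda>_. borel))"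
  shows "(\<integral>\<^sup>+Y. G Y \<partial>Pi\<^sub>M I (\<lambda>_. gauss_measure)) = (\<integral>\<^sup>+Y. (\<Prod>i\<in>I. gauss (Y i)) * G Y \<partial>Pi\<^sub>M I (\<lambda>_. lborel))"
proof -
  have "Pi\<^sub>M I (\<lambda>_. gauss_measure) = distr (density (Pi\<^sub>M I (\<lambda>_. lborel)) (\<lambda>x. \<Prod>i\<in>I. gauss (x i)))
     (Pi\<^sub>M I (\<lambda>_. gauss_measure)) (\<lambda>x. \<lambda>i\<in>I. x i :: 'a)"
    by (rule PiM_eq_distr_density[OF I product_sigma_finite_lborel product_sigma_finite_gauss_measure])
       (auto simp: gauss_measure_def nn_integral_density)
  then have "(\<integral>\<^sup>+Y. G Y \<partial>Pi\<^sub>M I (\<lambda>_. gauss_measure)) =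
    (\<integral>\<^sup>+Y. G Y \<partial>distr (density (Pi\<^sub>M I (\<lambda>_. lborel)) (\<lambda>x. \<Prod>i\<in>I. gauss (x i)))
     (Pi\<^sub>M I (\<lambda>_. gauss_measure)) (\<lambda>x. \<lambda>i\<in>I. x i :: 'a))" by simp
  also have "\<dots> = (\<integral>\<^sup>+Y. (\<Prod>i\<in>I. gauss (Y i)) * G (restrict Y I) \<partial>Pi\<^sub>M I (\<lambda>_. lborel))"
    by (simp add: nn_integral_distr nn_integral_density)
  also have "\<dots> = (\<integral>\<^sup>+Y. (\<Prod>i\<in>I. gauss (Y i)) * G Y \<partial>Pi\<^sub>M I (\<lambda>_. lborel))"
    by (intro nn_integral_cong) (simp add: space_PiM PiE_def extensional_restrict)
  finally show ?thesis .
qed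

lemma AE_gauss_tuple_independent:
  fixes I :: "'i set"
  assumes I: "finite I" and k: "card I \<le> DIM('a::euclidean_space)"
  shows "AE Y in Pi\<^sub>M I (\<lambda>_. gauss_measure :: 'a measure). inv_volume I Y < top"
proof -
  let ?G = "\<lambda>Y. indicator {Y. \<not> inv_volume I Y < top} Y :: ennreal"
  have m: "?G \<in> borel_measurable (Pi\<^sub>M I (\<lambda>_. borel :: 'a measure))"
    unfolding indicator_def using I by measurable
  then have m': "?G \<in> borel_measurable (Pi\<^sub>M I (\<lambda>_. gauss_measure :: 'a measure))" by measurable
  have "(\<integral>\<^sup>+Y. ?G Y \<partial>Pi\<^sub>M I (\<lambda>_. gauss_measure :: 'a measure)) = (\<integral>\<^sup>+Y. (\<Prod>i\<in>I. gauss (Y i)) * ?G Y \<partial>Pi\<^sub>M I (\<lambda>_. lborel :: 'a measure))"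
    by (rule nn_integral_gauss_tuple[OF I m])
  also have "\<dots> = (\<integral>\<^sup>+Y. 0 \<partial>Pi\<^sub>M I (\<lambda>_. lborel :: 'a measure))"
    by (intro nn_integral_cong_AE, use AE_lborel_independent[OF I k] in eventually_elim) (simp add: indicator_def)
  finally have "AE Y in Pi\<^sub>M I (\<lambda>_. gauss_measure :: 'a measure). ?G Y = 0"
    using nn_integral_0_iff_AE[OF m'] by simp
  then show ?thesis
  proof eventually_elim
    fix Y :: "'i \<Rightarrow> 'a" assume "?G Y = 0"
    then show "inv_volume I Y < top" by (cases "inv_volume I Y < top") simp_all
  qed
qed

lemma borel_measurable_orthogonal_transformation:
  fixes U :: "'a::euclidean_space \<Rightarrow> 'a"
  shows "orthogonal_transformation U \<Longrightarrow> U \<in> borel_measurable borel"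
  using orthogonal_transformation_linear[of U] by (simp add: borel_measurable_continuous_onI linear_continuous_on linear_linear)

text \<open>The image of Lebesgue measure under an isometry is again translation invariant with the same
  Gaussian integral.\<close>

lemma nn_integral_lborel_orthogonal:
  fixes U :: "'a::euclidean_space \<Rightarrow> 'a"
  assumes U: "orthogonal_transformation U" and [measurable]: "h \<in> borel_measurable borel"
  shows "(\<integral>\<^sup>+x. h (U x) \<partial>lborel) = (\<integral>\<^sup>+x. h x \<partial>lborel)"
proof -
  note [measurable] = borel_measurable_orthogonal_transformation[OF U]
  have lin: "linear U" by (rule orthogonal_transformation_linear[OF U])
  have "normalized_haar UNIV (distr lborel borel U)"
  proof (rule normalized_haarI)
    show "(\<integral>\<^sup>+x. gauss x \<partial>distr lborel borel U) = 1"
      using normalized_haarD(5)[OF normalized_haar_UNIV, where 'a='a]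
      by (simp add: nn_integral_distr gauss_def orthogonal_transformation_norm[OF U])
    fix v
    obtain w where w: "v = U w" using orthogonal_transformation_surj[OF U] by blast
    have "distr (distr lborel borel U) borel ((+) v) = distr lborel borel (\<lambda>x. U (w + x))"
      by (simp add: distr_distr comp_def w linear_add[OF lin])
    also have "\<dots> = distr (distr lborel borel ((+) w)) borel U"
      by (simp add: distr_distr comp_def)
    finally show "distr (distr lborel borel U) borel ((+) v) = distr lborel borel U"
      by (simp add: lborel_distr_plus)
  qed auto
  then have eq: "distr lborel borel U = lborel"
    by (rule normalized_haar_unique[OF subspace_UNIV _ normalized_haar_UNIV])
  have "(\<integral>\<^sup>+x. h (U x) \<partial>lborel) = (\<integral>\<^sup>+x. h x \<partial>distr lborel borel U)" by (simp add: nn_integral_distr)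
  then show ?thesis by (simp add: eq)
qed

lemma nn_integral_gauss_tuple_orthogonal:
  fixes U :: "'a::euclidean_space \<Rightarrow> 'a" and G :: "('i \<Rightarrow> 'a) \<Rightarrow> ennreal"
  assumes I: "finite I" and U: "orthogonal_transformation U"
    and [measurable]: "G \<in> borel_measurable (Pi\<^sub>M I (\<lambda>_. borel))"
  shows "(\<integral>\<^sup>+Y. G (\<lambda>i\<in>I. U (Y i)) \<partial>Pi\<^sub>M I (\<lambda>_. gauss_measure)) = (\<integral>\<^sup>+Y. G Y \<partial>Pi\<^sub>M I (\<lambda>_. gauss_measure))"
proof -
  note [measurable] = borel_measurable_orthogonal_transformation[OF U]
  have "Pi\<^sub>M I (\<lambda>_. gauss_measure) = distr (density (Pi\<^sub>M I (\<lambda>_. gauss_measure)) (\<lambda>x. \<Prod>i\<in>I. 1))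
     (Pi\<^sub>M I (\<lambda>_. gauss_measure)) (\<lambda>x. \<lambda>i\<in>I. U (x i))"
  proof (rule PiM_eq_distr_density[OF I product_sigma_finite_gauss_measure product_sigma_finite_gauss_measure])
    fix h :: "'a \<Rightarrow> ennreal" assume "h \<in> borel_measurable gauss_measure"
    then have [measurable]: "h \<in> borel_measurable borel" by measurable
    have "gauss (U x) = gauss x" for x by (simp add: gauss_def orthogonal_transformation_norm[OF U])
    then show "(\<integral>\<^sup>+y. h y \<partial>gauss_measure) = (\<integral>\<^sup>+x. 1 * h (U x) \<partial>gauss_measure)"
      using nn_integral_lborel_orthogonal[OF U, of "\<lambda>x. gauss x * h x"]
      by (simp add: gauss_measure_def nn_integral_density)
  qed auto
  then have "(\<integral>\<^sup>+Y. G Y \<partial>Pi\<^sub>M I (\<lambda>_. gauss_measure)) = (\<integral>\<^sup>+Y. G Y \<partial>distr (Pi\<^sub>M I (\<lambda>_. gauss_measure)) (Pi\<^sub>M I (\<lambda>_. gauss_measure)) (\<lambda>x. \<lambda>i\<in>I. U (x i)))"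
    by (simp add: density_1)
  also have "\<dots> = (\<integral>\<^sup>+Y. G (\<lambda>i\<in>I. U (Y i)) \<partial>Pi\<^sub>M I (\<lambda>_. gauss_measure))"
    by (rule nn_integral_distr) measurable
  finally show ?thesis ..
qed

lemma orthogonal_image_span:
  fixes U :: "'a::euclidean_space \<Rightarrow> 'a"
  assumes "orthogonal_transformation U"
  shows "span ((\<lambda>i. U (Y i)) ` I) = U ` span (Y ` I)"
  using linear_span_image[OF orthogonal_transformation_linear[OF assms], of "Y ` I"] by (simp add: image_image)

lemma inv_volume_orthogonal:
  fixes U :: "'a::euclidean_space \<Rightarrow> 'a"
  assumes U: "orthogonal_transformation U"
  shows "inv_volume I (\<lambda>i\<in>I. U (Y i)) = inv_volume I Y"
proof -
  have "lincomb I (\<lambda>i\<in>I. U (Y i)) a = U (lincomb I Y a)" for a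
    using orthogonal_transformation_linear[OF U] by (simp add: lincomb_def linear_sum linear_scale)
  then show ?thesis
    by (simp add: inv_volume_def gauss_def orthogonal_transformation_norm[OF U])
qed

subsection \<open>A random rotation\<close>

text \<open>For dependent vectors some of the values are \<open>0\<close>, because \<open>sgn 0 = 0\<close>.\<close>

definition gram_schmidt :: "(nat \<Rightarrow> 'a::euclidean_space) \<Rightarrow> nat \<Rightarrow> 'a" where
  "gram_schmidt X i = sgn (X i - closest_point (span (X ` {..<i})) (X i))"

lemma measurable_gram_schmidt:
  assumes "i < n" "f \<in> M \<rightarrow>\<^sub>M Pi\<^sub>M {..<n} (\<lambda>_. borel :: 'a::euclidean_space measure)"
  shows "(\<lambda>l. gram_schmidt (f l) i) \<in> borel_measurable M"
proof -
  have f: "(\<lambda>l. f l j) \<in> borel_measurable M" if "j < n" for j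
    using measurable_compose[OF assms(2) measurable_component_singleton] that by simp
  have [measurable]: "(\<lambda>l. f l i) \<in> borel_measurable M" using f assms by simp
  have [measurable]: "(\<lambda>l. closest_point (span (f l ` {..<i})) (f l i)) \<in> borel_measurable M"
    using assms by (intro measurable_closest_point_span f) auto
  show ?thesis unfolding gram_schmidt_def sgn_div_norm by measurable
qed

lemma inv_volume_prefix:
  fixes X :: "nat \<Rightarrow> 'a::euclidean_space"
  assumes "inv_volume {..<n} X < top" "m \<le> n"
  shows "inv_volume {..<m} X < top"
  using assms(2)
proof (induction m rule: inc_induct)
  case base
  show ?case by (rule assms(1))
next
  case (step m)
  then show ?case using inv_volume_insert_less_top[of "{..<m}" m X] by (simp add: lessThan_Suc)
qed

lemma gram_schmidt_orthonormal:
  fixes X :: "nat \<Rightarrow> 'a::euclidean_space"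
  assumes X: "inv_volume {..<n} X < top" and i: "i < n" and j: "j < n"
  shows "gram_schmidt X i \<bullet> gram_schmidt X j = (if i = j then 1 else 0)"
proof -
  have less: "gram_schmidt X i \<bullet> gram_schmidt X j = 0" if "i < j" for i j
  proof -
    have "X ` {..<i} \<subseteq> X ` {..<j}" using that by auto
    then have sub: "span (X ` {..<i}) \<subseteq> span (X ` {..<j})" by (rule span_mono)
    have "X i \<in> span (X ` {..<j})" using that by (intro span_base) auto
    then have "gram_schmidt X i \<in> span (X ` {..<j})"
      unfolding gram_schmidt_def sgn_div_norm
      using sub closest_point_subspace_mem[OF subspace_span, of "X ` {..<i}" "X i"]
      by (intro span_scale span_diff) auto
    from closest_point_subspace_orth[OF subspace_span this, of "X j"]
    show ?thesis by (simp add: gram_schmidt_def[of X j] sgn_div_norm inner_commute)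
  qed
  have "inv_volume {..<Suc i} X < top" using X i by (intro inv_volume_prefix[OF X]) simp
  then have "X i \<notin> span (X ` {..<i})"
    using inv_volume_insert_less_top[of "{..<i}" i X] by (simp add: lessThan_Suc)
  then have "X i - closest_point (span (X ` {..<i})) (X i) \<noteq> 0"
    using closest_point_eq_iff_span[of "X ` {..<i}" "X i"] by auto
  then have "norm (gram_schmidt X i) = 1" by (simp add: gram_schmidt_def norm_sgn)
  then have "gram_schmidt X i \<bullet> gram_schmidt X i = 1" by (simp add: norm_eq_1)
  then show ?thesis
    using less[of i j] less[of j i] by (auto simp: inner_commute not_less_iff_gr_or_eq linorder_neq_iff)
qed

text \<open>Projections commute with isometries; this is what transfers the invariance of Gaussian vectors to
  the frame made from them.\<close>

lemma gram_schmidt_orthogonal: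
  fixes V :: "'a::euclidean_space \<Rightarrow> 'a"
  assumes V: "orthogonal_transformation V" and i: "i < n"
  shows "gram_schmidt (\<lambda>i\<in>{..<n}. V (X i)) i = V (gram_schmidt X i)"
proof -
  have lin: "linear V" by (rule orthogonal_transformation_linear[OF V])
  have "(\<lambda>i\<in>{..<n}. V (X i)) ` {..<i} = (\<lambda>i. V (X i)) ` {..<i}" using i by (intro image_cong) auto
  then have "span ((\<lambda>i\<in>{..<n}. V (X i)) ` {..<i}) = V ` span (X ` {..<i})"
    by (simp only: orthogonal_image_span[OF V])
  moreover have "affine (span (X ` {..<i}))" "span (X ` {..<i}) \<noteq> {}"
    using subspace_imp_affine[OF subspace_span] span_zero[of "X ` {..<i}"] by blast+
  ultimately show ?thesis
    using i by (simp add: gram_schmidt_def closest_point_orthogonal_image[OF V] sgn_div_norm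
      orthogonal_transformation_norm[OF V] linear_scale[OF lin] flip: linear_diff[OF lin])
qed

text \<open>The orthonormal frame made from a Gaussian \<open>n\<close>-tuple \<open>X\<close> is the image of the standard basis
  under a random rotation. Replacing \<open>X\<close> by \<open>V X\<close> multiplies the rotation by \<open>V\<close> on the left, so its inverse,
  \<open>unrotation X\<close>, is multiplied by the inverse of \<open>V\<close> on the right.\<close>

context
  fixes e :: "nat \<Rightarrow> 'a::euclidean_space"
  assumes e: "bij_betw e {..<DIM('a)} Basis"
begin

definition rotation :: "(nat \<Rightarrow> 'a) \<Rightarrow> 'a \<Rightarrow> 'a" where
  "rotation X x = (\<Sum>i<DIM('a). (x \<bullet> e i) *\<^sub>R gram_schmidt X i)"

definition unrotation :: "(nat \<Rightarrow> 'a) \<Rightarrow> 'a \<Rightarrow> 'a" where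
  "unrotation X x = (\<Sum>i<DIM('a). (x \<bullet> gram_schmidt X i) *\<^sub>R e i)"

lemma unrotation_rotation:
  assumes X: "inv_volume {..<DIM('a)} X < top"
  shows "unrotation X (rotation X x) = x"
proof -
  have "rotation X x \<bullet> gram_schmidt X j = x \<bullet> e j" if "j < DIM('a)" for j
    using that by (simp add: rotation_def inner_sum_left gram_schmidt_orthonormal[OF X] if_distrib[of "(*) _"] sum.delta cong: if_cong)
  then have "unrotation X (rotation X x) = (\<Sum>i<DIM('a). (x \<bullet> e i) *\<^sub>R e i)"
    by (simp add: unrotation_def)
  also have "\<dots> = (\<Sum>b\<in>Basis. (x \<bullet> b) *\<^sub>R b)"
    using e by (rule sum.reindex_bij_betw)
  finally show ?thesis by (simp add: euclidean_representation)
qed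

lemma orthogonal_transformation_unrotation:
  assumes X: "inv_volume {..<DIM('a)} X < top"
  shows "orthogonal_transformation (unrotation X)"
proof -
  have "orthogonal_transformation (rotation X)"
    unfolding orthogonal_transformation
  proof (intro conjI allI)
    show "linear (rotation X)"
      by (rule linearI) (simp_all add: rotation_def inner_add_left scaleR_add_left sum.distrib scaleR_sum_right)
    fix v
    have "(norm (rotation X v))\<^sup>2 = rotation X v \<bullet> rotation X v" by (simp add: power2_norm_eq_inner)
    also have "\<dots> = (\<Sum>i<DIM('a). (v \<bullet> e i) * (v \<bullet> e i))"
      by (simp add: rotation_def inner_sum_left inner_sum_right gram_schmidt_orthonormal[OF X] if_distrib[of "(*) _"] sum.delta cong: if_cong)
    also have "\<dots> = (\<Sum>b\<in>Basis. (v \<bullet> b) * (v \<bullet> b))"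
      using e by (rule sum.reindex_bij_betw)
    also have "\<dots> = (norm v)\<^sup>2" by (simp add: power2_norm_eq_inner flip: euclidean_inner)
    finally show "norm (rotation X v) = norm v" by simp
  qed
  moreover have "unrotation X = inv (rotation X)"
  proof
    fix y
    obtain x where "y = rotation X x" using orthogonal_transformation_surj[OF calculation] by blast
    then show "unrotation X y = inv (rotation X) y"
      by (simp add: unrotation_rotation[OF X] inv_f_f[OF orthogonal_transformation_inj[OF calculation]])
  qed
  ultimately show ?thesis by (simp add: orthogonal_transformation_inv)
qed

lemma unrotation_orthogonal:
  assumes V: "orthogonal_transformation V"
  shows "unrotation (\<lambda>i\<in>{..<DIM('a)}. V (X i)) (V x) = unrotation X x"
  using V by (simp add: unrotation_def gram_schmidt_orthogonal orthogonal_transformation_def)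

text \<open>Dependent tuples form a null set; there the plane is left alone, which keeps the values in the
  Grassmannian.\<close>

definition turn :: "(nat \<Rightarrow> 'a) \<Rightarrow> 'a set \<Rightarrow> 'a set" where
  "turn X \<xi> = (if inv_volume {..<DIM('a)} X < top then unrotation X ` \<xi> else \<xi>)"

lemma measurable_turn:
  "(\<lambda>(X, \<xi>). turn X \<xi>) \<in> Pi\<^sub>M {..<DIM('a)} (\<lambda>_. borel) \<Otimes>\<^sub>M flat_borel (grassmannian k) \<rightarrow>\<^sub>M flat_borel (grassmannian k)"
    (is "_ \<in> ?M \<rightarrow>\<^sub>M _")
proof (rule measurable_flat_borelI)
  show "(case p of (X, \<xi>) \<Rightarrow> turn X \<xi>) \<in> grassmannian k" if "p \<in> space ?M" for p
    using that grassmannian_orthogonal_image[OF orthogonal_transformation_unrotation]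
    by (auto simp: turn_def space_pair_measure)
  fix x
  have [measurable]: "(\<lambda>p. gram_schmidt (fst p) i) \<in> borel_measurable ?M" if "i < DIM('a)" for i
    by (rule measurable_gram_schmidt[OF that measurable_fst])
  have [measurable]: "(\<lambda>p. rotation (fst p) x) \<in> borel_measurable ?M"
    unfolding rotation_def by measurable
  have [measurable]: "(\<lambda>p. closest_point (snd p) (rotation (fst p) x)) \<in> borel_measurable ?M"
    "(\<lambda>p. closest_point (snd p) x) \<in> borel_measurable ?M"
    by (rule measurable_closest_point_family[OF flat_family_grassmannian measurable_snd], measurable)+
  have "(\<lambda>p. if inv_volume {..<DIM('a)} (fst p) < top
      then unrotation (fst p) (closest_point (snd p) (rotation (fst p) x)) else closest_point (snd p) x) \<in> borel_measurable ?M"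
    unfolding unrotation_def by measurable
  then show "(\<lambda>p. closest_point (case p of (X, \<xi>) \<Rightarrow> turn X \<xi>) x) \<in> borel_measurable ?M"
  proof (rule measurable_cong[THEN iffD1, rotated])
    fix p assume p: "p \<in> space ?M"
    obtain X \<xi> where [simp]: "p = (X, \<xi>)" by fastforce
    have \<xi>: "\<xi> \<in> grassmannian k" using p by (simp add: space_pair_measure)
    show "(if inv_volume {..<DIM('a)} (fst p) < top
      then unrotation (fst p) (closest_point (snd p) (rotation (fst p) x)) else closest_point (snd p) x) =
      closest_point (case p of (X, \<xi>) \<Rightarrow> turn X \<xi>) x"
      using closest_point_orthogonal_image[OF orthogonal_transformation_unrotation grassmannianD(3,4)[OF \<xi>], of X "rotation X x"]
      by (simp add: turn_def unrotation_rotation)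
  qed
qed

end

text \<open>Glue an isometry between the planes and an isometry between their orthogonal complements.\<close>

lemma grassmannian_transitive:
  fixes \<xi> \<eta> :: "'a::euclidean_space set"
  assumes \<xi>: "\<xi> \<in> grassmannian k" and \<eta>: "\<eta> \<in> grassmannian k"
  shows "\<exists>V. orthogonal_transformation V \<and> V ` \<xi> = \<eta>"
proof -
  let ?o = "\<lambda>S. {y. \<forall>x\<in>S. orthogonal x y} :: 'a set"
  have so: "subspace (?o S)" for S by (auto simp: subspace_def orthogonal_clauses)
  have do: "dim (?o S) + dim S = DIM('a)" if "subspace S" for S
    using dim_subspace_orthogonal_to_vectors[OF that subspace_UNIV] by simp
  have d: "dim \<xi> = dim \<eta>" using grassmannianD(2)[OF \<xi>] grassmannianD(2)[OF \<eta>] by simp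
  obtain f f' where f: "linear f" "linear f'" "f ` \<xi> = \<eta>" "f' ` \<eta> = \<xi>"
    "\<And>x. x \<in> \<xi> \<Longrightarrow> norm (f x) = norm x" "\<And>x. x \<in> \<eta> \<Longrightarrow> norm (f' x) = norm x"
    "\<And>x. x \<in> \<xi> \<Longrightarrow> f' (f x) = x" "\<And>x. x \<in> \<eta> \<Longrightarrow> f (f' x) = x"
    by (rule isometries_subspaces[OF grassmannianD(1)[OF \<xi>] grassmannianD(1)[OF \<eta>] d], rule that; assumption)
  have d': "dim (?o \<xi>) = dim (?o \<eta>)"
    using do[OF grassmannianD(1)[OF \<xi>]] do[OF grassmannianD(1)[OF \<eta>]] grassmannianD(2)[OF \<xi>] grassmannianD(2)[OF \<eta>] by simp
  obtain g g' where g: "linear g" "linear g'" "g ` (?o \<xi>) = ?o \<eta>" "g' ` (?o \<eta>) = ?o \<xi>"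
    "\<And>x. x \<in> ?o \<xi> \<Longrightarrow> norm (g x) = norm x" "\<And>x. x \<in> ?o \<eta> \<Longrightarrow> norm (g' x) = norm x"
    "\<And>x. x \<in> ?o \<xi> \<Longrightarrow> g' (g x) = x" "\<And>x. x \<in> ?o \<eta> \<Longrightarrow> g (g' x) = x"
    by (rule isometries_subspaces[OF so so d'], rule that; assumption)
  let ?P = "closest_point \<xi>"
  have lP: "linear ?P" by (rule linear_closest_point[OF grassmannianD(1)[OF \<xi>]])
  define V where "V x = f (?P x) + g (x - ?P x)" for x
  have lV: "linear V"
    by (rule linearI) (simp_all add: V_def linear_add[OF lP] linear_scale[OF lP] linear_add[OF f(1)] linear_scale[OF f(1)]
        linear_diff[OF g(1)] linear_add[OF g(1)] linear_scale[OF g(1)] algebra_simps)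
  have Px: "?P x \<in> \<xi>" for x by (rule closest_point_subspace_mem[OF grassmannianD(1)[OF \<xi>]])
  have Qx: "x - ?P x \<in> ?o \<xi>" for x
    using closest_point_subspace_orth[OF grassmannianD(1)[OF \<xi>], of _ x] by (auto simp: orthogonal_def inner_commute)
  have nV: "norm (V x) = norm x" for x
  proof -
    have "f (?P x) \<in> \<eta>" "g (x - ?P x) \<in> ?o \<eta>" using f(3) g(3) Px Qx by blast+
    then have "orthogonal (f (?P x)) (g (x - ?P x))" by simp
    then have "(norm (V x))\<^sup>2 = (norm (f (?P x)))\<^sup>2 + (norm (g (x - ?P x)))\<^sup>2"
      unfolding V_def by (rule norm_add_Pythagorean)
    also have "\<dots> = (norm x)\<^sup>2"
      using norm_closest_point_pythagoras[OF grassmannianD(1)[OF \<xi>], of x] f(5)[OF Px] g(5)[OF Qx] by simp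
    finally show ?thesis by simp
  qed
  have "V x = f x" if "x \<in> \<xi>" for x
    using that by (simp add: V_def closest_point_self linear_0[OF g(1)])
  then have "V ` \<xi> = \<eta>" using f(3) by simp
  then show ?thesis using lV nV by (auto simp: orthogonal_transformation)
qed

text \<open>The defining property of \<open>grassmann_measure\<close>.\<close>

definition rotation_invariant :: "nat \<Rightarrow> 'a::euclidean_space set measure \<Rightarrow> bool" where
  "rotation_invariant k \<mu> \<longleftrightarrow> sets \<mu> = sets (flat_borel (grassmannian k)) \<and> prob_space \<mu> \<and>
     (\<forall>U. orthogonal_transformation U \<longrightarrow> distr \<mu> \<mu> ((`) U) = \<mu>)"

lemma rotation_invariantD:
  assumes "rotation_invariant k \<mu>"
  shows "sets \<mu> = sets (flat_borel (grassmannian k))" "prob_space \<mu>"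
    "orthogonal_transformation U \<Longrightarrow> distr \<mu> \<mu> ((`) U) = \<mu>"
proof -
  note h = assms[unfolded rotation_invariant_def]
  show "sets \<mu> = sets (flat_borel (grassmannian k))" using h by (elim conjE)
  show "prob_space \<mu>" using h by (elim conjE)
  have "\<forall>U. orthogonal_transformation U \<longrightarrow> distr \<mu> \<mu> ((`) U) = \<mu>" using h by (elim conjE)
  then have "orthogonal_transformation U \<longrightarrow> distr \<mu> \<mu> ((`) U) = \<mu>" by (rule spec)
  then show "orthogonal_transformation U \<Longrightarrow> distr \<mu> \<mu> ((`) U) = \<mu>" by (rule mp)
qed

text \<open>Apply the inverse of a random rotation to a plane. The law of the result does not depend on the
  plane, since the law of the rotation is invariant on the left and the rotations act transitively; and
  averaging over an invariant law of the plane changes nothing. So every invariant law is this one.\<close>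

lemma rotation_invariant_unique:
  fixes \<mu> \<nu> :: "'a::euclidean_space set measure"
  assumes \<mu>: "rotation_invariant k \<mu>" and \<nu>: "rotation_invariant k \<nu>"
  shows "\<mu> = \<nu>"
proof -
  have "\<exists>e :: nat \<Rightarrow> 'a. bij_betw e {..<DIM('a)} Basis"
    using ex_bij_betw_nat_finite[of "Basis :: 'a set"] by (simp add: atLeast0LessThan)
  then obtain e :: "nat \<Rightarrow> 'a" where e: "bij_betw e {..<DIM('a)} Basis" by blast
  let ?N = "{..<DIM('a)}"
  let ?G = "Pi\<^sub>M ?N (\<lambda>_. gauss_measure :: 'a measure)"
  interpret G: prob_space ?G by (rule prob_space_gauss_tuple)
  define \<rho> where "\<rho> A \<xi> = (\<integral>\<^sup>+X. indicator A (turn e X \<xi>) \<partial>?G)" for A :: "'a set set" and \<xi>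
  have G: "sets ?G = sets (Pi\<^sub>M ?N (\<lambda>_. borel :: 'a measure))" by (intro sets_PiM_cong) auto
  have ind: "AE X in ?G. inv_volume ?N X < top" by (rule AE_gauss_tuple_independent) auto
  have \<rho>V: "\<rho> A (V ` \<xi>) = \<rho> A \<xi>"
    if V: "orthogonal_transformation V" and \<xi>: "\<xi> \<in> grassmannian k" and A[measurable]: "A \<in> sets (flat_borel (grassmannian k))" for V \<xi> A
  proof -
    have [measurable]: "(\<lambda>X. turn e X (V ` \<xi>)) \<in> Pi\<^sub>M ?N (\<lambda>_. borel) \<rightarrow>\<^sub>M flat_borel (grassmannian k)"
      using \<xi> grassmannian_orthogonal_image[OF V] by (intro measurable_curried[OF measurable_turn[OF e]]) auto
    have "\<rho> A (V ` \<xi>) = (\<integral>\<^sup>+X. indicator A (turn e (\<lambda>i\<in>?N. V (X i)) (V ` \<xi>)) \<partial>?G)"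
      unfolding \<rho>_def by (rule nn_integral_gauss_tuple_orthogonal[OF _ V, symmetric]) auto
    also have "\<dots> = (\<integral>\<^sup>+X. indicator A (turn e X \<xi>) \<partial>?G)"
    proof (intro nn_integral_cong_AE, use ind in eventually_elim)
      fix X :: "nat \<Rightarrow> 'a" assume X: "inv_volume ?N X < top"
      then have "turn e (\<lambda>i\<in>?N. V (X i)) (V ` \<xi>) = turn e X \<xi>"
        by (simp add: turn_def[OF e] inv_volume_orthogonal[OF V] image_image unrotation_orthogonal[OF e V])
      then show "indicator A (turn e (\<lambda>i\<in>?N. V (X i)) (V ` \<xi>)) = (indicator A (turn e X \<xi>) :: ennreal)" by simp
    qed
    finally show ?thesis by (simp add: \<rho>_def)
  qed
  have main: "emeasure \<mu> A = \<rho> A \<xi>0"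
    if \<mu>: "rotation_invariant k \<mu>" and A: "A \<in> sets (flat_borel (grassmannian k))" and \<xi>0: "\<xi>0 \<in> grassmannian k" for \<mu> A \<xi>0
  proof -
    have s\<mu>[measurable_cong]: "sets \<mu> = sets (flat_borel (grassmannian k))" and p\<mu>: "prob_space \<mu>"
      and inv: "\<And>U. orthogonal_transformation U \<Longrightarrow> distr \<mu> \<mu> ((`) U) = \<mu>"
      by (rule rotation_invariantD(1)[OF \<mu>], rule rotation_invariantD(2)[OF \<mu>], rule rotation_invariantD(3)[OF \<mu>])
    note [measurable] = A
    interpret \<mu>: prob_space \<mu> by (rule p\<mu>)
    interpret P: pair_sigma_finite \<mu> ?G ..
    have [simp]: "space \<mu> = grassmannian k" using sets_eq_imp_space_eq[OF s\<mu>] by simp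
    have [measurable]: "(\<lambda>p. turn e (snd p) (fst p)) \<in> \<mu> \<Otimes>\<^sub>M ?G \<rightarrow>\<^sub>M flat_borel (grassmannian k)"
      by (rule measurable_curried[OF measurable_turn[OF e]]) measurable
    have "\<rho> A \<xi>0 = (\<integral>\<^sup>+\<xi>. \<rho> A \<xi>0 \<partial>\<mu>)" by (simp add: \<mu>.emeasure_space_1[simplified])
    also have "\<dots> = (\<integral>\<^sup>+\<xi>. \<rho> A \<xi> \<partial>\<mu>)"
    proof (rule nn_integral_cong)
      fix \<xi> assume "\<xi> \<in> space \<mu>"
      then have "\<exists>V. orthogonal_transformation V \<and> V ` \<xi>0 = \<xi>" by (intro grassmannian_transitive[OF \<xi>0]) simp
      then obtain V where "orthogonal_transformation V" "V ` \<xi>0 = \<xi>" by (elim exE conjE)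
      then show "\<rho> A \<xi>0 = \<rho> A \<xi>" using \<rho>V[OF _ \<xi>0 A, of V] by simp
    qed
    also have "\<dots> = (\<integral>\<^sup>+X. \<integral>\<^sup>+\<xi>. indicator A (turn e X \<xi>) \<partial>\<mu> \<partial>?G)"
      unfolding \<rho>_def by (rule P.Fubini'[symmetric]) (simp add: case_prod_beta, measurable)
    also have "\<dots> = (\<integral>\<^sup>+X. emeasure \<mu> A \<partial>?G)"
    proof (intro nn_integral_cong_AE, use ind in eventually_elim)
      fix X :: "nat \<Rightarrow> 'a" assume X: "inv_volume ?N X < top"
      let ?U = "unrotation e X"
      have U: "orthogonal_transformation ?U" by (rule orthogonal_transformation_unrotation[OF e X])
      have [measurable]: "(`) ?U \<in> \<mu> \<rightarrow>\<^sub>M \<mu>" using measurable_orthogonal_image[OF U, of k] by measurable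
      have "(\<integral>\<^sup>+\<xi>. indicator A (turn e X \<xi>) \<partial>\<mu>) = (\<integral>\<^sup>+\<xi>. indicator A (?U ` \<xi>) \<partial>\<mu>)"
        using X by (simp add: turn_def[OF e])
      also have "\<dots> = (\<integral>\<^sup>+\<xi>. indicator A \<xi> \<partial>distr \<mu> \<mu> ((`) ?U))"
        by (rule nn_integral_distr[symmetric]) measurable
      also have "\<dots> = emeasure \<mu> A" unfolding inv[OF U] by simp
      finally show "(\<integral>\<^sup>+\<xi>. indicator A (turn e X \<xi>) \<partial>\<mu>) = emeasure \<mu> A" .
    qed
    also have "\<dots> = emeasure \<mu> A" by (simp add: G.emeasure_space_1)
    finally show ?thesis ..
  qed
  note s\<mu> = rotation_invariantD(1)[OF \<mu>] and s\<nu> = rotation_invariantD(1)[OF \<nu>]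
  have "space \<mu> \<noteq> {}" by (rule prob_space.not_empty[OF rotation_invariantD(2)[OF \<mu>]])
  then obtain \<xi>0 where \<xi>0: "\<xi>0 \<in> (grassmannian k :: 'a set set)" using sets_eq_imp_space_eq[OF s\<mu>] by auto
  show ?thesis
    by (rule measure_eqI) (simp_all add: s\<mu> s\<nu> main[OF \<mu> _ \<xi>0] main[OF \<nu> _ \<xi>0])
qed

text \<open>The default value makes this a measurable map into the Grassmannian that is defined on all
  tuples.\<close>

definition spanned_plane :: "'i set \<Rightarrow> ('i \<Rightarrow> 'a::euclidean_space) \<Rightarrow> 'a set" where
  "spanned_plane I Y = (if inv_volume I Y < top then span (Y ` I) else (SOME \<xi>. \<xi> \<in> grassmannian (card I)))"

lemma spanned_plane_in_grassmannian:
  fixes Y :: "'i \<Rightarrow> 'a::euclidean_space"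
  assumes I: "finite I" and "card I \<le> DIM('a)"
  shows "spanned_plane I Y \<in> grassmannian (card I)"
proof -
  have "card I \<le> dim (UNIV :: 'a set)" using assms by simp
  then obtain S :: "'a set" where S: "subspace S" "S \<subseteq> span UNIV" "dim S = card I"
    by (rule choose_subspace_of_subspace)
  then have "(SOME \<xi>. \<xi> \<in> grassmannian (card I)) \<in> (grassmannian (card I) :: 'a set set)"
    using S by (intro someI[of "\<lambda>\<xi>. \<xi> \<in> grassmannian (card I)" S]) (simp add: grassmannian_def)
  then show ?thesis
    using span_in_grassmannian[OF I, of Y] by (simp add: spanned_plane_def)
qed

lemma measurable_spanned_plane:
  fixes I :: "'i set"
  assumes I: "finite I" and "card I \<le> DIM('a::euclidean_space)"
  shows "spanned_plane I \<in> Pi\<^sub>M I (\<lambda>_. borel :: 'a measure) \<rightarrow>\<^sub>M flat_borel (grassmannian (card I))"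
proof (rule measurable_flat_borelI)
  show "spanned_plane I Y \<in> grassmannian (card I)" for Y :: "'i \<Rightarrow> 'a"
    by (rule spanned_plane_in_grassmannian[OF assms])
  fix x :: 'a
  have [measurable]: "(\<lambda>Y. closest_point (span (Y ` I)) x) \<in> borel_measurable (Pi\<^sub>M I (\<lambda>_. borel :: 'a measure))"
    by (intro measurable_closest_point_span I) auto
  note measurable_inv_volume[OF I, measurable (raw)]
  have "(\<lambda>Y. if inv_volume I Y < top then closest_point (span (Y ` I)) x
     else closest_point (SOME \<xi>. \<xi> \<in> grassmannian (card I)) x) \<in> borel_measurable (Pi\<^sub>M I (\<lambda>_. borel :: 'a measure))"
    by measurable
  then show "(\<lambda>Y. closest_point (spanned_plane I Y) x) \<in> borel_measurable (Pi\<^sub>M I (\<lambda>_. borel))"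
    by (rule measurable_cong[THEN iffD1, rotated]) (simp add: spanned_plane_def)
qed

definition gauss_grassmann :: "'i set \<Rightarrow> 'a::euclidean_space set measure" where
  "gauss_grassmann I = distr (Pi\<^sub>M I (\<lambda>_. gauss_measure)) (flat_borel (grassmannian (card I))) (spanned_plane I)"

text \<open>Gaussian tuples are invariant under rotations, and forming the span commutes with them. Hence an
  invariant law exists, which together with uniqueness identifies \<open>grassmann_measure\<close>.\<close>

lemma rotation_invariant_gauss_grassmann:
  fixes I :: "'i set"
  assumes I: "finite I" and k: "card I \<le> DIM('a::euclidean_space)"
  shows "rotation_invariant (card I) (gauss_grassmann I :: 'a set measure)"
  unfolding rotation_invariant_def
proof (intro conjI allI impI)
  let ?G = "Pi\<^sub>M I (\<lambda>_. gauss_measure :: 'a measure)"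
  interpret G: prob_space ?G by (rule prob_space_gauss_tuple)
  have sp[measurable]: "spanned_plane I \<in> ?G \<rightarrow>\<^sub>M flat_borel (grassmannian (card I))"
    using measurable_spanned_plane[OF I k] by measurable
  show s: "sets (gauss_grassmann I) = sets (flat_borel (grassmannian (card I) :: 'a set set))"
    by (simp add: gauss_grassmann_def)
  show "prob_space (gauss_grassmann I :: 'a set measure)"
    unfolding gauss_grassmann_def by (rule G.prob_space_distr[OF sp])
  fix U :: "'a \<Rightarrow> 'a" assume U: "orthogonal_transformation U"
  note [measurable] = measurable_orthogonal_image[OF U, of "card I"] measurable_spanned_plane[OF I k]
  have ind: "AE Y in ?G. inv_volume I Y < top" by (rule AE_gauss_tuple_independent[OF I k])
  have "distr (gauss_grassmann I) (gauss_grassmann I) ((`) U) = distr (gauss_grassmann I) (flat_borel (grassmannian (card I))) ((`) U)"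
    by (intro distr_cong) (simp_all add: s)
  also have "\<dots> = distr ?G (flat_borel (grassmannian (card I))) (\<lambda>Y. U ` spanned_plane I Y)"
    unfolding gauss_grassmann_def by (subst distr_distr) (auto simp: comp_def)
  also have "\<dots> = gauss_grassmann I"
  proof (rule measure_eqI)
    fix A assume "A \<in> sets (distr ?G (flat_borel (grassmannian (card I))) (\<lambda>Y. U ` spanned_plane I Y))"
    then have A[measurable]: "A \<in> sets (flat_borel (grassmannian (card I)))" by simp
    have "emeasure (distr ?G (flat_borel (grassmannian (card I))) (\<lambda>Y. U ` spanned_plane I Y)) A =
      (\<integral>\<^sup>+Z. indicator A Z \<partial>distr ?G (flat_borel (grassmannian (card I))) (\<lambda>Y. U ` spanned_plane I Y))" by simp
    also have "\<dots> = (\<integral>\<^sup>+Y. indicator A (U ` spanned_plane I Y) \<partial>?G)"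
      by (rule nn_integral_distr) measurable
    also have "\<dots> = (\<integral>\<^sup>+Y. indicator A (spanned_plane I (\<lambda>i\<in>I. U (Y i))) \<partial>?G)"
    proof (intro nn_integral_cong_AE, use ind in eventually_elim)
      fix Y :: "'i \<Rightarrow> 'a" assume Y: "inv_volume I Y < top"
      have "(\<lambda>i\<in>I. U (Y i)) ` I = (\<lambda>i. U (Y i)) ` I" by (intro image_cong) auto
      then have "U ` spanned_plane I Y = spanned_plane I (\<lambda>i\<in>I. U (Y i))"
        using Y by (simp only: spanned_plane_def inv_volume_orthogonal[OF U] if_True orthogonal_image_span[OF U])
      then show "indicator A (U ` spanned_plane I Y) = (indicator A (spanned_plane I (\<lambda>i\<in>I. U (Y i))) :: ennreal)" by simp
    qed
    also have "\<dots> = (\<integral>\<^sup>+Y. indicator A (spanned_plane I Y) \<partial>?G)"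
      by (rule nn_integral_gauss_tuple_orthogonal[OF I U, of "\<lambda>Y. indicator A (spanned_plane I Y)"]) auto
    also have "\<dots> = (\<integral>\<^sup>+Z. indicator A Z \<partial>gauss_grassmann I)"
      unfolding gauss_grassmann_def by (rule nn_integral_distr[symmetric]) measurable
    also have "\<dots> = emeasure (gauss_grassmann I) A"
      using A by (simp add: s)
    finally show "emeasure (distr ?G (flat_borel (grassmannian (card I))) (\<lambda>Y. U ` spanned_plane I Y)) A = emeasure (gauss_grassmann I) A" .
  qed (simp add: s)
  finally show "distr (gauss_grassmann I) (gauss_grassmann I) ((`) U) = gauss_grassmann I" .
qed

lemma grassmann_measure_eq:
  assumes I: "finite I" and k: "card I \<le> DIM('a::euclidean_space)"
  shows "grassmann_measure (card I) = (gauss_grassmann I :: 'a set measure)"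
  unfolding grassmann_measure_def rotation_invariant_def[symmetric]
proof (rule the_equality)
  show inv: "rotation_invariant (card I) (gauss_grassmann I :: 'a set measure)"
    by (rule rotation_invariant_gauss_grassmann[OF I k])
  show "\<mu> = gauss_grassmann I" if "rotation_invariant (card I) \<mu>" for \<mu> :: "'a set measure"
    by (rule rotation_invariant_unique[OF that inv])
qed

lemma nn_integral_grassmann_measure:
  fixes u :: "'a::euclidean_space set \<Rightarrow> ennreal"
  assumes I: "finite I" and k: "card I \<le> DIM('a)" and u[measurable]: "u \<in> borel_measurable (flat_borel (grassmannian (card I)))"
  shows "(\<integral>\<^sup>+\<xi>. u \<xi> \<partial>grassmann_measure (card I)) =
    (\<integral>\<^sup>+Y. (\<Prod>i\<in>I. gauss (Y i)) * u (span (Y ` I)) \<partial>Pi\<^sub>M I (\<lambda>_. lborel))"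
proof -
  note [measurable] = measurable_spanned_plane[OF I k]
  have ind: "AE Y in Pi\<^sub>M I (\<lambda>_. lborel :: 'a measure). inv_volume I Y < top"
    by (rule AE_lborel_independent[OF I k])
  have "(\<integral>\<^sup>+\<xi>. u \<xi> \<partial>grassmann_measure (card I)) = (\<integral>\<^sup>+Y. u (spanned_plane I Y) \<partial>Pi\<^sub>M I (\<lambda>_. gauss_measure))"
    unfolding grassmann_measure_eq[OF I k] gauss_grassmann_def by (rule nn_integral_distr) measurable
  also have "\<dots> = (\<integral>\<^sup>+Y. (\<Prod>i\<in>I. gauss (Y i)) * u (spanned_plane I Y) \<partial>Pi\<^sub>M I (\<lambda>_. lborel))"
    by (rule nn_integral_gauss_tuple[OF I]) measurable
  also have "\<dots> = (\<integral>\<^sup>+Y. (\<Prod>i\<in>I. gauss (Y i)) * u (span (Y ` I)) \<partial>Pi\<^sub>M I (\<lambda>_. lborel))"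
    by (intro nn_integral_cong_AE, use ind in eventually_elim) (simp add: spanned_plane_def)
  finally show ?thesis .
qed

section \<open>The measure on the affine Grassmannian\<close>

text \<open>An orthonormal basis has \<open>inv_volume\<close> equal to one, so the isometric parametrisation transports
  Lebesgue measure to the invariant measure, whatever base point and basis the choice operator returns.\<close>

lemma flat_lebesgue_eq:
  fixes T :: "'a::euclidean_space set"
  assumes T: "affine T" "T \<noteq> {}"
  shows "flat_lebesgue T = completion (flat_measure T)"
proof -
  define a where "a = (SOME a. a \<in> T)"
  have a: "a \<in> T" unfolding a_def using T by (simp add: some_in_eq)
  define S where "S = (\<lambda>y. y - a) ` T"
  have S: "subspace S"
    unfolding S_def using affine_diffs_subspace_subtract[OF T(1) a] .
  define B where "B = orthonormal_basis_of S"
  have "\<exists>B. pairwise orthogonal B \<and> (\<forall>b\<in>B. norm b = 1) \<and> span B = S"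
    by (rule orthonormal_basis_subspace[OF S]) blast
  then have B: "pairwise orthogonal B" "\<forall>b\<in>B. norm b = 1" "span B = S"
    unfolding B_def orthonormal_basis_of_def by (rule someI2_ex; simp)+
  have "0 \<notin> B" using B(2) by force
  then have fB: "finite B" using pairwise_orthogonal_imp_finite[OF B(1)] by simp
  have "inv_volume B (\<lambda>b. b) = (\<integral>\<^sup>+u. (\<Prod>b\<in>B. gauss (u b :: real)) \<partial>Pi\<^sub>M B (\<lambda>_. lborel))"
    by (simp add: inv_volume_def lincomb_def gauss_sum[OF fB B(1,2)])
  also have "\<dots> = 1"
    using nn_integral_gauss_real_scaled[of 1] by (subst lborel_PiM.product_nn_integral_prod[OF fB]) auto
  finally have W: "inv_volume B (\<lambda>b. b) = 1" .
  have [measurable]: "lincomb B (\<lambda>b. b) \<in> borel_measurable (Pi\<^sub>M B (\<lambda>_. lborel))" by measurable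
  have flat: "flat_measure S = distr (Pi\<^sub>M B (\<lambda>_. lborel)) borel (lincomb B (\<lambda>b. b))"
    using flat_measure_span[OF fB, of "\<lambda>b. b"] by (simp add: W B(3) density_1)
  have TS: "T = (+) a ` S" by (force simp: S_def image_image)
  have Sa: "affine S" "S \<noteq> {}" using subspace_imp_affine[OF S] subspace_0[OF S] by auto
  have "distr (Pi\<^sub>M B (\<lambda>_. lborel)) borel (\<lambda>u. a + (\<Sum>b\<in>B. u b *\<^sub>R b)) = distr (flat_measure S) borel ((+) a)"
    unfolding flat by (subst distr_distr) (auto simp: comp_def lincomb_def)
  also have "\<dots> = flat_measure T"
    unfolding TS flat_measure_translation[OF Sa] ..
  finally show ?thesis
    unfolding flat_lebesgue_def a_def[symmetric] Let_def S_def[symmetric] B_def[symmetric] by simp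
qed

lemma translate_in_affine_grassmannian:
  "\<xi> \<in> grassmannian k \<Longrightarrow> (+) x ` \<xi> \<in> affine_grassmannian k"
  using affine_translation[of \<xi> x] by (simp add: affine_grassmannian_def aff_dim_translation_eq aff_dim_subspace grassmannianD)

lemma measurable_translate:
  assumes "f \<in> M \<rightarrow>\<^sub>M flat_borel (grassmannian k)" and [measurable]: "g \<in> borel_measurable M"
  shows "(\<lambda>m. (+) (g m) ` f m) \<in> M \<rightarrow>\<^sub>M flat_borel (affine_grassmannian k :: 'a::euclidean_space set set)"
proof (rule measurable_flat_borelI)
  have f: "f m \<in> grassmannian k" if "m \<in> space M" for m using measurable_space[OF assms(1) that] by simp
  show "(+) (g m) ` f m \<in> affine_grassmannian k" if "m \<in> space M" for m
    using f[OF that] by (rule translate_in_affine_grassmannian)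
  fix x
  have "(\<lambda>m. closest_point (f m) (x - g m)) \<in> borel_measurable M"
    by (rule measurable_closest_point_family[OF flat_family_grassmannian assms(1)]) measurable
  then have "(\<lambda>m. g m + closest_point (f m) (x - g m)) \<in> borel_measurable M" by measurable
  then show "(\<lambda>m. closest_point ((+) (g m) ` f m) x) \<in> borel_measurable M"
    by (rule measurable_cong[THEN iffD1, rotated]) (simp add: closest_point_translation grassmannianD[OF f])
qed

text \<open>The translation vector ranges over the whole space, with a Gaussian weight along \<open>\<xi>\<close>, instead of
  over the orthogonal complement of \<open>\<xi>\<close>; thus one product space serves all directions.\<close>

definition affine_flat_measure :: "nat \<Rightarrow> 'a::euclidean_space set measure" where
  "affine_flat_measure k = distr (density (grassmann_measure k \<Otimes>\<^sub>M lborel) (\<lambda>(\<xi>, x). gauss (closest_point \<xi> x)))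
     (flat_borel (affine_grassmannian k)) (\<lambda>(\<xi>, x). (+) x ` \<xi>)"

lemma sets_affine_flat_measure[measurable_cong, simp]:
  "sets (affine_flat_measure k) = sets (flat_borel (affine_grassmannian k))"
  by (simp add: affine_flat_measure_def)

lemma space_affine_flat_measure[simp]: "space (affine_flat_measure k) = affine_grassmannian k"
  by (simp add: affine_flat_measure_def)

lemma rotation_invariant_grassmann_measure:
  assumes "k \<le> DIM('a::euclidean_space)"
  shows "rotation_invariant k (grassmann_measure k :: 'a set measure)"
  using grassmann_measure_eq[of "{..<k}", where 'a='a] rotation_invariant_gauss_grassmann[of "{..<k}", where 'a='a] assms
  by simp

lemma sets_grassmann_measure:
  assumes "k \<le> DIM('a::euclidean_space)"
  shows "sets (grassmann_measure k :: 'a set measure) = sets (flat_borel (grassmannian k))"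
  by (rule rotation_invariantD(1)[OF rotation_invariant_grassmann_measure[OF assms]])

lemma nn_integral_affine_flat_measure:
  fixes \<phi> :: "'a::euclidean_space set \<Rightarrow> ennreal"
  assumes k: "k \<le> DIM('a)" and [measurable]: "\<phi> \<in> borel_measurable (flat_borel (affine_grassmannian k))"
  shows "(\<integral>\<^sup>+\<tau>. \<phi> \<tau> \<partial>affine_flat_measure k) =
    (\<integral>\<^sup>+\<xi>. \<integral>\<^sup>+x. gauss (closest_point \<xi> x) * \<phi> ((+) x ` \<xi>) \<partial>lborel \<partial>grassmann_measure k)"
proof -
  note [measurable_cong] = sets_grassmann_measure[OF k]
  have [measurable]: "(\<lambda>p. (+) (snd p) ` fst p) \<in> grassmann_measure k \<Otimes>\<^sub>M lborel \<rightarrow>\<^sub>M flat_borel (affine_grassmannian k :: 'a set set)"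
    by (rule measurable_translate) measurable
  have [measurable]: "(\<lambda>p. closest_point (fst p) (snd p)) \<in> borel_measurable (grassmann_measure k \<Otimes>\<^sub>M (lborel :: 'a measure))"
    by (rule measurable_closest_point_family[OF flat_family_grassmannian]) measurable
  show ?thesis
    unfolding affine_flat_measure_def case_prod_beta
    by (simp add: nn_integral_distr nn_integral_density flip: lborel.nn_integral_fst)
qed

text \<open>The translate \<open>x + \<xi>\<close> depends only on the component of \<open>x\<close> orthogonal to \<open>\<xi>\<close>, and the law of that
  component under the Gaussian weight is Lebesgue measure on the orthogonal complement.\<close>

lemma affine_grassmann_measure_eq:
  assumes k: "k \<le> DIM('a::euclidean_space)"
  shows "affine_grassmann_measure k = completion (affine_flat_measure k :: 'a set measure)"
proof -
  let ?\<Omega> = "affine_grassmannian k :: 'a set set"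
  let ?\<mu> = "\<lambda>A. \<integral>\<^sup>+\<xi>. emeasure (flat_lebesgue (\<xi>\<^sup>\<bottom>)) {z \<in> \<xi>\<^sup>\<bottom>. (+) z ` \<xi> \<in> A} \<partial>grassmann_measure k"
  have sp: "space (grassmann_measure k :: 'a set measure) = grassmannian k"
    using sets_eq_imp_space_eq[OF sets_grassmann_measure[OF k]] by simp
  have eq: "?\<mu> A = emeasure (affine_flat_measure k) A" if A: "A \<in> sets (flat_borel ?\<Omega>)" for A
  proof -
    note [measurable] = A
    have "?\<mu> A = (\<integral>\<^sup>+\<xi>. \<integral>\<^sup>+x. gauss (closest_point \<xi> x) * indicator A ((+) x ` \<xi>) \<partial>lborel \<partial>grassmann_measure k)"
    proof (rule nn_integral_cong)
      fix \<xi> :: "'a set" assume "\<xi> \<in> space (grassmann_measure k)"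
      then have \<xi>: "\<xi> \<in> grassmannian k" by (simp add: sp)
      have s: "subspace \<xi>" by (rule grassmannianD(1)[OF \<xi>])
      have o: "subspace (\<xi>\<^sup>\<bottom>)" by (rule subspace_orthogonal_comp)
      have oa: "affine (\<xi>\<^sup>\<bottom>)" "\<xi>\<^sup>\<bottom> \<noteq> {}" using subspace_imp_affine[OF o] subspace_0[OF o] by auto
      have P: "closest_point (\<xi>\<^sup>\<bottom>) x = x - closest_point \<xi> x" for x
      proof (rule closest_point_subspaceI[OF o])
        show "x - closest_point \<xi> x \<in> \<xi>\<^sup>\<bottom>"
          using closest_point_subspace_orth[OF s, of _ x] by (auto simp: orthogonal_comp_def orthogonal_def inner_commute)
        show "(x - (x - closest_point \<xi> x)) \<bullet> u = 0" if "u \<in> \<xi>\<^sup>\<bottom>" for u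
          using that closest_point_subspace_mem[OF s, of x] by (simp add: orthogonal_comp_def orthogonal_def)
      qed
      have tr: "(+) (x - closest_point \<xi> x) ` \<xi> = (+) x ` \<xi>" for x
      proof -
        have c: "closest_point \<xi> x \<in> \<xi>" by (rule closest_point_subspace_mem[OF s])
        have "(+) (x - closest_point \<xi> x) ` \<xi> \<subseteq> (+) x ` \<xi>"
        proof safe
          fix y assume "y \<in> \<xi>"
          then show "x - closest_point \<xi> x + y \<in> (+) x ` \<xi>"
            using subspace_diff[OF s _ c, of y] by (intro image_eqI[of _ _ "y - closest_point \<xi> x"]) auto
        qed
        moreover have "(+) x ` \<xi> \<subseteq> (+) (x - closest_point \<xi> x) ` \<xi>"
        proof safe
          fix y assume "y \<in> \<xi>"
          then show "x + y \<in> (+) (x - closest_point \<xi> x) ` \<xi>"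
            using subspace_add[OF s _ c, of y] by (intro image_eqI[of _ _ "y + closest_point \<xi> x"]) auto
        qed
        ultimately show ?thesis by blast
      qed
      have [measurable]: "(\<lambda>z. (+) z ` \<xi>) \<in> borel \<rightarrow>\<^sub>M flat_borel ?\<Omega>"
        using \<xi> by (intro measurable_translate) auto
      note [measurable] = subspace_borel[OF o] borel_measurable_closest_point[OF grassmannianD(3,4)[OF \<xi>]]
      have Z: "{z \<in> \<xi>\<^sup>\<bottom>. (+) z ` \<xi> \<in> A} \<in> sets borel" by measurable
      then have "emeasure (flat_lebesgue (\<xi>\<^sup>\<bottom>)) {z \<in> \<xi>\<^sup>\<bottom>. (+) z ` \<xi> \<in> A} = (\<integral>\<^sup>+z. indicator {z \<in> \<xi>\<^sup>\<bottom>. (+) z ` \<xi> \<in> A} z \<partial>flat_measure (\<xi>\<^sup>\<bottom>))"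
        by (simp add: flat_lebesgue_eq[OF oa])
      also have "\<dots> = (\<integral>\<^sup>+x. gauss (x - closest_point (\<xi>\<^sup>\<bottom>) x) * indicator {z \<in> \<xi>\<^sup>\<bottom>. (+) z ` \<xi> \<in> A} (closest_point (\<xi>\<^sup>\<bottom>) x) \<partial>lborel)"
        using Z by (intro nn_integral_flat_measure[OF oa]) auto
      also have "\<dots> = (\<integral>\<^sup>+x. gauss (closest_point \<xi> x) * indicator A ((+) x ` \<xi>) \<partial>lborel)"
        using closest_point_subspace_mem[OF o] by (intro nn_integral_cong) (auto simp: P tr indicator_def)
      finally show "emeasure (flat_lebesgue (\<xi>\<^sup>\<bottom>)) {z \<in> \<xi>\<^sup>\<bottom>. (+) z ` \<xi> \<in> A} =
        (\<integral>\<^sup>+x. gauss (closest_point \<xi> x) * indicator A ((+) x ` \<xi>) \<partial>lborel)" .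
    qed
    also have "\<dots> = (\<integral>\<^sup>+\<tau>. indicator A \<tau> \<partial>affine_flat_measure k)"
      by (rule nn_integral_affine_flat_measure[OF k, symmetric]) measurable
    finally show ?thesis by simp
  qed
  have "measure_of ?\<Omega> (sets (flat_borel ?\<Omega>)) ?\<mu> = measure_of ?\<Omega> (sets (flat_borel ?\<Omega>)) (emeasure (affine_flat_measure k))"
  proof (rule measure_of_eq)
    show "sets (flat_borel ?\<Omega>) \<subseteq> Pow ?\<Omega>" using sets.space_closed[of "flat_borel ?\<Omega>"] by simp
    show "?\<mu> A = emeasure (affine_flat_measure k) A" if "A \<in> sigma_sets ?\<Omega> (sets (flat_borel ?\<Omega>))" for A
      using that sets.sigma_sets_eq[of "flat_borel ?\<Omega>"] by (intro eq) simp
  qed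
  also have "\<dots> = affine_flat_measure k"
    using measure_of_of_measure[of "affine_flat_measure k :: 'a set measure"] by simp
  finally show ?thesis by (simp add: affine_grassmann_measure_def)
qed

text \<open>The planes at distance less than \<open>r\<close> from the origin have finite measure, because the Gaussian
  weight across the plane is bounded below on them.\<close>

lemma sigma_finite_affine_flat_measure:
  assumes k: "k \<le> DIM('a::euclidean_space)"
  shows "sigma_finite_measure (affine_flat_measure k :: 'a set measure)"
proof (rule sigma_finite_measure.intro, rule exI[of _ "range (\<lambda>n::nat. {\<tau> \<in> affine_grassmannian k. closest_point \<tau> 0 \<in> ball 0 (real n)})"], intro conjI ballI)
  have m: "{\<tau> \<in> affine_grassmannian k. closest_point \<tau> 0 \<in> ball 0 (real n)} \<in> sets (flat_borel (affine_grassmannian k :: 'a set set))" for n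
  proof -
    have "{\<tau> \<in> affine_grassmannian k. closest_point \<tau> 0 \<in> ball 0 (real n)} =
      (\<lambda>\<tau>. closest_point \<tau> 0) -` ball 0 (real n) \<inter> space (flat_borel (affine_grassmannian k :: 'a set set))" by auto
    then show ?thesis using measurable_sets[OF measurable_closest_point_flat_borel, of "ball 0 (real n)"] by simp
  qed
  then show "range (\<lambda>n::nat. {\<tau> \<in> affine_grassmannian k. closest_point \<tau> 0 \<in> ball 0 (real n)}) \<subseteq> sets (affine_flat_measure k :: 'a set measure)"
    by auto
  show "\<Union> (range (\<lambda>n::nat. {\<tau> \<in> affine_grassmannian k. closest_point \<tau> 0 \<in> ball 0 (real n)})) = space (affine_flat_measure k :: 'a set measure)"
    using reals_Archimedean2 by auto
  fix A assume "A \<in> range (\<lambda>n::nat. {\<tau> \<in> affine_grassmannian k. closest_point \<tau> (0::'a) \<in> ball 0 (real n)})"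
  then obtain n where A: "A = {\<tau> \<in> affine_grassmannian k. closest_point \<tau> (0::'a) \<in> ball 0 (real n)}" by auto
  have sp: "space (grassmann_measure k :: 'a set measure) = grassmannian k"
    using sets_eq_imp_space_eq[OF sets_grassmann_measure[OF k]] by simp
  interpret G: prob_space "grassmann_measure k :: 'a set measure"
    by (rule rotation_invariantD(2)[OF rotation_invariant_grassmann_measure[OF k]])
  let ?c = "ennreal (exp (- pi * (real n)\<^sup>2))"
  have Am[measurable]: "A \<in> sets (flat_borel (affine_grassmannian k))" using m[of n] by (simp add: A)
  have "?c * emeasure (affine_flat_measure k) A = (\<integral>\<^sup>+\<tau>. ?c * indicator A \<tau> \<partial>affine_flat_measure k)"
    using Am by (subst nn_integral_cmult_indicator) auto
  also have "\<dots> = (\<integral>\<^sup>+\<xi>. \<integral>\<^sup>+x. gauss (closest_point \<xi> x) * (?c * indicator A ((+) x ` \<xi>)) \<partial>lborel \<partial>grassmann_measure k)"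
    by (rule nn_integral_affine_flat_measure[OF k]) measurable
  also have "\<dots> \<le> (\<integral>\<^sup>+\<xi>. \<integral>\<^sup>+x. gauss x \<partial>(lborel :: 'a measure) \<partial>(grassmann_measure k :: 'a set measure))"
  proof (intro nn_integral_mono)
    fix \<xi> :: "'a set" and x :: 'a assume "\<xi> \<in> space (grassmann_measure k)"
    then have \<xi>: "\<xi> \<in> grassmannian k" by (simp add: sp)
    have lin: "linear (closest_point \<xi>)" by (rule linear_closest_point[OF grassmannianD(1)[OF \<xi>]])
    have "closest_point ((+) x ` \<xi>) 0 = x - closest_point \<xi> x"
      by (simp add: closest_point_translation grassmannianD[OF \<xi>] linear_neg[OF lin])
    then have "?c * indicator A ((+) x ` \<xi>) \<le> gauss (x - closest_point \<xi> x)"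
      by (auto simp: A indicator_def gauss_def intro!: power_mono)
    then have "gauss (closest_point \<xi> x) * (?c * indicator A ((+) x ` \<xi>)) \<le> gauss (closest_point \<xi> x) * gauss (x - closest_point \<xi> x)"
      by (intro mult_left_mono) auto
    then show "gauss (closest_point \<xi> x) * (?c * indicator A ((+) x ` \<xi>)) \<le> gauss x"
      by (simp add: gauss_orthogonal[OF norm_closest_point_pythagoras[OF grassmannianD(1)[OF \<xi>]], of x])
  qed
  also have "\<dots> = 1"
    using normalized_haarD(5)[OF normalized_haar_UNIV, where 'a='a] by (simp add: G.emeasure_space_1)
  finally show "emeasure (affine_flat_measure k) A \<noteq> \<infinity>"
    by (auto simp: ennreal_mult_eq_top_iff top_unique)
qed simp

section \<open>The affine formula\<close>

lemma PiM_flat_measure_translation: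
  fixes S :: "'a::euclidean_space set" and H :: "('i \<Rightarrow> 'a) \<Rightarrow> ennreal"
  assumes I: "finite I" and S: "affine S" "S \<noteq> {}" and [measurable]: "H \<in> borel_measurable (Pi\<^sub>M I (\<lambda>_. borel))"
  shows "(\<integral>\<^sup>+u. H u \<partial>Pi\<^sub>M I (\<lambda>_. flat_measure ((+) a ` S))) =
    (\<integral>\<^sup>+u. H (\<lambda>i\<in>I. a + u i) \<partial>Pi\<^sub>M I (\<lambda>_. flat_measure S))"
proof -
  have aS: "affine ((+) a ` S)" "(+) a ` S \<noteq> {}" using S affine_translation[of S a] by auto
  have eq: "Pi\<^sub>M I (\<lambda>_. flat_measure ((+) a ` S)) = distr (density (Pi\<^sub>M I (\<lambda>_. flat_measure S)) (\<lambda>x. \<Prod>i\<in>I. 1))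
     (Pi\<^sub>M I (\<lambda>_. flat_measure ((+) a ` S))) (\<lambda>x. \<lambda>i\<in>I. a + x i)"
  proof (rule PiM_eq_distr_density[OF I product_sigma_finite_flat_measure[OF S] product_sigma_finite_flat_measure[OF aS]])
    fix h :: "'a \<Rightarrow> ennreal" assume "h \<in> borel_measurable (flat_measure ((+) a ` S))"
    then have "h \<in> borel_measurable borel" by measurable
    then show "(\<integral>\<^sup>+y. h y \<partial>flat_measure ((+) a ` S)) = (\<integral>\<^sup>+x. 1 * h (a + x) \<partial>flat_measure S)"
      by (simp add: nn_integral_flat_measure_translation[OF S])
  qed auto
  show ?thesis
    by (subst eq) (simp add: nn_integral_distr density_1)
qed

text \<open>The inverse of \<open>edges\<close>: the tuple with first point \<open>x\<close> and differences \<open>u\<close>.\<close>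

definition fan :: "nat \<Rightarrow> 'a::euclidean_space \<Rightarrow> (nat \<Rightarrow> 'a) \<Rightarrow> nat \<Rightarrow> 'a" where
  "fan k x u = (\<lambda>i\<in>{..k}. if i = 0 then x else x + u i)"

lemma measurable_fan[measurable (raw)]:
  assumes [measurable]: "f \<in> borel_measurable M" and g: "g \<in> M \<rightarrow>\<^sub>M Pi\<^sub>M {1..k} (\<lambda>_. borel)"
  shows "(\<lambda>l. fan k (f l) (g l)) \<in> M \<rightarrow>\<^sub>M Pi\<^sub>M {..k} (\<lambda>_. borel :: 'a::euclidean_space measure)"
  unfolding fan_def
proof (rule measurable_restrict)
  fix i assume i: "i \<in> {..k}"
  show "(\<lambda>l. if i = 0 then f l else f l + g l i) \<in> borel_measurable M"
  proof (cases "i = 0")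
    case False
    then have [measurable]: "(\<lambda>l. g l i) \<in> borel_measurable M"
      using i by (intro measurable_compose[OF g measurable_component_singleton]) auto
    show ?thesis using False by simp
  qed simp
qed

text \<open>Translating the later points by the first one is harmless, as the measure of \<open>\<xi>\<close> is invariant
  under the vectors of \<open>\<xi>\<close>.\<close>

lemma PiM_flat_measure_split:
  fixes \<xi> :: "'a::euclidean_space set" and H :: "(nat \<Rightarrow> 'a) \<Rightarrow> ennreal"
  assumes \<xi>: "subspace \<xi>" and [measurable]: "H \<in> borel_measurable (Pi\<^sub>M {..k} (\<lambda>_. borel))"
  shows "(\<integral>\<^sup>+u. H u \<partial>Pi\<^sub>M {..k} (\<lambda>_. flat_measure ((+) x ` \<xi>))) =
    (\<integral>\<^sup>+u0. \<integral>\<^sup>+u. H (fan k (x + u0) u) \<partial>Pi\<^sub>M {1..k} (\<lambda>_. flat_measure \<xi>) \<partial>flat_measure \<xi>)"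
proof -
  have S: "affine \<xi>" "\<xi> \<noteq> {}" using subspace_imp_affine[OF \<xi>] subspace_0[OF \<xi>] by auto
  interpret P: product_sigma_finite "\<lambda>_. flat_measure \<xi>" by (rule product_sigma_finite_flat_measure[OF S])
  have ins: "{..k} = insert 0 {1..k}" by auto
  have "(\<integral>\<^sup>+u. H u \<partial>Pi\<^sub>M {..k} (\<lambda>_. flat_measure ((+) x ` \<xi>))) =
    (\<integral>\<^sup>+u. H (\<lambda>i\<in>{..k}. x + u i) \<partial>Pi\<^sub>M (insert 0 {1..k}) (\<lambda>_. flat_measure \<xi>))"
    unfolding ins[symmetric] by (rule PiM_flat_measure_translation[OF _ S]) auto
  also have "\<dots> = (\<integral>\<^sup>+u0. \<integral>\<^sup>+u. H (\<lambda>i\<in>{..k}. x + (u(0 := u0)) i) \<partial>Pi\<^sub>M {1..k} (\<lambda>_. flat_measure \<xi>) \<partial>flat_measure \<xi>)"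
  proof (rule P.product_nn_integral_insert_rev)
    show "(\<lambda>u. H (\<lambda>i\<in>{..k}. x + u i)) \<in> borel_measurable (Pi\<^sub>M (insert 0 {1..k}) (\<lambda>_. flat_measure \<xi>))"
      unfolding ins[symmetric] by measurable
  qed auto
  also have "\<dots> = (\<integral>\<^sup>+u0. \<integral>\<^sup>+u. H (fan k (x + u0) u) \<partial>Pi\<^sub>M {1..k} (\<lambda>_. flat_measure \<xi>) \<partial>flat_measure \<xi>)"
  proof (intro nn_integral_cong_AE, use normalized_haarD(3)[OF normalized_haar_flat_measure[OF \<xi>]] in eventually_elim)
    fix u0 assume u0: "u0 \<in> \<xi>"
    have tr: "(+) u0 ` \<xi> = \<xi>"
    proof safe
      show "u0 + y \<in> \<xi>" if "y \<in> \<xi>" for y using subspace_add[OF \<xi> u0 that] .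
      show "y \<in> (+) u0 ` \<xi>" if "y \<in> \<xi>" for y
        using subspace_diff[OF \<xi> that u0] by (intro image_eqI[of _ _ "y - u0"]) auto
    qed
    have m: "(\<lambda>u. H (\<lambda>i\<in>{..k}. x + (u(0 := u0)) i)) \<in> borel_measurable (Pi\<^sub>M {1..k} (\<lambda>_. borel))"
    proof (rule measurable_compose[OF measurable_restrict assms(2)])
      fix i assume i: "i \<in> {..k}"
      show "(\<lambda>u. x + (u(0 := u0)) i) \<in> borel_measurable (Pi\<^sub>M {1..k} (\<lambda>_. borel))"
        using i by (cases "i = 0") auto
    qed
    have "(\<integral>\<^sup>+u. H (\<lambda>i\<in>{..k}. x + (u(0 := u0)) i) \<partial>Pi\<^sub>M {1..k} (\<lambda>_. flat_measure \<xi>)) =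
      (\<integral>\<^sup>+u. H (\<lambda>i\<in>{..k}. x + ((\<lambda>i\<in>{1..k}. u0 + u i)(0 := u0)) i) \<partial>Pi\<^sub>M {1..k} (\<lambda>_. flat_measure \<xi>))"
      using PiM_flat_measure_translation[OF _ S m, of u0] by (simp add: tr)
    moreover have "(\<lambda>i\<in>{..k}. x + ((\<lambda>i\<in>{1..k}. u0 + u i)(0 := u0)) i) = fan k (x + u0) u" for u
      by (auto simp: fan_def fun_eq_iff restrict_def add.assoc)
    ultimately show "(\<integral>\<^sup>+u. H (\<lambda>i\<in>{..k}. x + (u(0 := u0)) i) \<partial>Pi\<^sub>M {1..k} (\<lambda>_. flat_measure \<xi>)) =
      (\<integral>\<^sup>+u. H (fan k (x + u0) u) \<partial>Pi\<^sub>M {1..k} (\<lambda>_. flat_measure \<xi>))"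
      by (simp only:)
  qed
  finally show ?thesis .
qed

definition edges :: "(nat \<Rightarrow> 'a::euclidean_space) \<Rightarrow> nat \<Rightarrow> 'a" where
  "edges x i = x i - x 0"

definition stiefel_ratio :: "nat \<Rightarrow> nat \<Rightarrow> real" where
  "stiefel_ratio n k = stiefel_sigma k k / stiefel_sigma n k"

text \<open>Moving \<open>u\<close> from the argument of \<open>F\<close> into the weight leaves a weight with integral one over \<open>\<xi>\<close>.\<close>

lemma nn_integral_sweep:
  fixes \<xi> :: "'a::euclidean_space set"
  assumes \<xi>: "subspace \<xi>" and [measurable]: "F \<in> borel_measurable borel"
  shows "(\<integral>\<^sup>+x. gauss (closest_point \<xi> x) * (\<integral>\<^sup>+u. F (x + u) \<partial>flat_measure \<xi>) \<partial>lborel) = (\<integral>\<^sup>+x. F x \<partial>lborel)"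
proof -
  have S: "affine \<xi>" "\<xi> \<noteq> {}" using subspace_imp_affine[OF \<xi>] subspace_0[OF \<xi>] by auto
  note [measurable] = borel_measurable_closest_point[OF S]
  interpret sigma_finite_measure "flat_measure \<xi>" by (rule sigma_finite_flat_measure[OF \<xi>])
  interpret P: pair_sigma_finite "flat_measure \<xi>" "lborel :: 'a measure" ..
  note haar = normalized_haar_flat_measure[OF \<xi>]
  have "(\<integral>\<^sup>+x. gauss (closest_point \<xi> x) * (\<integral>\<^sup>+u. F (x + u) \<partial>flat_measure \<xi>) \<partial>lborel) =
    (\<integral>\<^sup>+x. \<integral>\<^sup>+u. gauss (closest_point \<xi> x) * F (x + u) \<partial>flat_measure \<xi> \<partial>lborel)"
    by (rule nn_integral_cong, rule nn_integral_cmult[symmetric]) measurable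
  also have "\<dots> = (\<integral>\<^sup>+u. \<integral>\<^sup>+x. gauss (closest_point \<xi> x) * F (x + u) \<partial>lborel \<partial>flat_measure \<xi>)"
    by (rule P.Fubini') measurable
  also have "\<dots> = (\<integral>\<^sup>+u. \<integral>\<^sup>+x. gauss (closest_point \<xi> x - u) * F x \<partial>lborel \<partial>flat_measure \<xi>)"
  proof (intro nn_integral_cong_AE, use normalized_haarD(3)[OF haar] in eventually_elim)
    fix u assume u: "u \<in> \<xi>"
    have "(\<integral>\<^sup>+x. gauss (closest_point \<xi> x) * F (x + u) \<partial>lborel) =
      (\<integral>\<^sup>+x. gauss (closest_point \<xi> (u + x) - u) * F (u + x) \<partial>lborel)"
      by (simp add: closest_point_add_subspace[OF \<xi> u] add.commute[of _ u])
    also have "\<dots> = (\<integral>\<^sup>+x. gauss (closest_point \<xi> x - u) * F x \<partial>lborel)"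
      by (rule nn_integral_lborel_translate[where h="\<lambda>x. gauss (closest_point \<xi> x - u) * F x"]) measurable
    finally show "(\<integral>\<^sup>+x. gauss (closest_point \<xi> x) * F (x + u) \<partial>lborel) =
      (\<integral>\<^sup>+x. gauss (closest_point \<xi> x - u) * F x \<partial>lborel)" .
  qed
  also have "\<dots> = (\<integral>\<^sup>+x. \<integral>\<^sup>+u. gauss (closest_point \<xi> x - u) * F x \<partial>flat_measure \<xi> \<partial>lborel)"
    by (rule P.Fubini'[symmetric]) measurable
  also have "\<dots> = (\<integral>\<^sup>+x. F x \<partial>lborel)"
  proof (rule nn_integral_cong)
    fix x
    have "(\<integral>\<^sup>+u. gauss (closest_point \<xi> x - u) \<partial>flat_measure \<xi>) =
      (\<integral>\<^sup>+u. gauss (closest_point \<xi> x - (closest_point \<xi> x + u)) \<partial>flat_measure \<xi>)"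
      by (rule nn_integral_haar_translate[symmetric, OF normalized_haarD(4)[OF haar closest_point_subspace_mem[OF \<xi>]]]) auto
    also have "\<dots> = 1" using normalized_haarD(5)[OF haar] by simp
    finally show "(\<integral>\<^sup>+u. gauss (closest_point \<xi> x - u) * F x \<partial>flat_measure \<xi>) = F x"
      by (subst nn_integral_multc) auto
  qed
  finally show ?thesis .
qed

text \<open>The plane \<open>\<xi> + x\<close> and the first point on it are integrated together: they sweep out the whole
  space, because the Gaussian weight has total mass one along \<open>\<xi>\<close>. The remaining points, seen from the
  first one, are covered by the linear formula.\<close>

lemma affine_blaschke_petkantschin:
  fixes H :: "(nat \<Rightarrow> 'a::euclidean_space) \<Rightarrow> ennreal"
  assumes k: "1 \<le> k" "k < DIM('a)" and Hm[measurable]: "H \<in> borel_measurable (Pi\<^sub>M {..k} (\<lambda>_. borel))"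
  shows "(\<integral>\<^sup>+\<tau>. \<integral>\<^sup>+x. H x \<partial>Pi\<^sub>M {..k} (\<lambda>_. flat_measure \<tau>) \<partial>affine_flat_measure k) =
    (\<integral>\<^sup>+x. ennreal (stiefel_ratio DIM('a) k) * inv_volume {1..k} (edges x) ^ (DIM('a) - k) * H x \<partial>Pi\<^sub>M {..k} (\<lambda>_. lborel))"
proof -
  let ?I = "{1..k}"
  let ?K = "ennreal (stiefel_ratio DIM('a) k)"
  let ?m = "DIM('a) - k"
  have kN: "k \<le> DIM('a)" using k by simp
  have cI: "card ?I = k" by simp
  define Q where "Q \<xi> x = (\<integral>\<^sup>+u. H (fan k x u) \<partial>Pi\<^sub>M ?I (\<lambda>_. flat_measure \<xi>))" for \<xi> x
  note [measurable_cong] = sets_grassmann_measure[OF kN]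
  interpret G: prob_space "grassmann_measure k :: 'a set measure"
    by (rule rotation_invariantD(2)[OF rotation_invariant_grassmann_measure[OF kN]])
  interpret Gl: pair_sigma_finite "lborel :: 'a measure" "grassmann_measure k :: 'a set measure" ..
  have sp: "space (grassmann_measure k :: 'a set measure) = grassmannian k"
    using sets_eq_imp_space_eq[OF sets_grassmann_measure[OF kN]] by simp
  have fam: "flat_family (lborel \<Otimes>\<^sub>M flat_borel (grassmannian k)) (\<lambda>p :: 'a \<times> 'a set. snd p)"
    by (rule flat_family_compose[OF flat_family_grassmannian measurable_snd])
  have Qm: "(\<lambda>(x, \<xi>). Q \<xi> x) \<in> borel_measurable (lborel \<Otimes>\<^sub>M flat_borel (grassmannian k))"
    unfolding Q_def case_prod_beta
  proof (rule measurable_nn_integral_PiM_flat_measure[OF _ fam])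
    show "(\<lambda>(p, u). H (fan k (fst p) u)) \<in>
      borel_measurable ((lborel \<Otimes>\<^sub>M flat_borel (grassmannian k)) \<Otimes>\<^sub>M Pi\<^sub>M ?I (\<lambda>_. borel))"
      unfolding case_prod_beta by measurable
  qed simp
  note [measurable (raw)] = measurable_curried[OF Qm]
  have "(\<integral>\<^sup>+\<tau>. \<integral>\<^sup>+x. H x \<partial>Pi\<^sub>M {..k} (\<lambda>_. flat_measure \<tau>) \<partial>affine_flat_measure k) =
    (\<integral>\<^sup>+\<xi>. \<integral>\<^sup>+x. gauss (closest_point \<xi> x) * (\<integral>\<^sup>+x. H x \<partial>Pi\<^sub>M {..k} (\<lambda>_. flat_measure ((+) x ` \<xi>))) \<partial>lborel \<partial>grassmann_measure k)"
    by (rule nn_integral_affine_flat_measure[OF kN])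
       (rule measurable_nn_integral_PiM_flat_measure[OF _ flat_family_affine_grassmannian], auto)
  also have "\<dots> = (\<integral>\<^sup>+\<xi>. \<integral>\<^sup>+x. Q \<xi> x \<partial>lborel \<partial>grassmann_measure k)"
  proof (rule nn_integral_cong)
    fix \<xi> :: "'a set" assume "\<xi> \<in> space (grassmann_measure k)"
    then have \<xi>: "\<xi> \<in> grassmannian k" by (simp add: sp)
    then have [measurable]: "Q \<xi> \<in> borel_measurable borel" by (intro measurable_curried[OF Qm]) auto
    have "(\<integral>\<^sup>+x. H x \<partial>Pi\<^sub>M {..k} (\<lambda>_. flat_measure ((+) x ` \<xi>))) = (\<integral>\<^sup>+u. Q \<xi> (x + u) \<partial>flat_measure \<xi>)" for x
      unfolding Q_def by (rule PiM_flat_measure_split[OF grassmannianD(1)[OF \<xi>] Hm])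
    then show "(\<integral>\<^sup>+x. gauss (closest_point \<xi> x) * (\<integral>\<^sup>+x. H x \<partial>Pi\<^sub>M {..k} (\<lambda>_. flat_measure ((+) x ` \<xi>))) \<partial>lborel) =
      (\<integral>\<^sup>+x. Q \<xi> x \<partial>lborel)"
      using nn_integral_sweep[OF grassmannianD(1)[OF \<xi>], of "Q \<xi>"] by simp
  qed
  also have "\<dots> = (\<integral>\<^sup>+x. \<integral>\<^sup>+\<xi>. Q \<xi> x \<partial>grassmann_measure k \<partial>lborel)"
    by (rule Gl.Fubini') (simp add: case_prod_beta)
  also have "\<dots> = (\<integral>\<^sup>+x. \<integral>\<^sup>+Y. ?K * inv_volume ?I (edges (Y(0 := x))) ^ ?m * H (Y(0 := x)) \<partial>Pi\<^sub>M ?I (\<lambda>_. lborel) \<partial>lborel)"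
  proof (rule nn_integral_cong)
    fix x :: 'a
    have hH[measurable]: "(\<lambda>Y. H (fan k x Y)) \<in> borel_measurable (Pi\<^sub>M ?I (\<lambda>_. borel))" by measurable
    have "(\<integral>\<^sup>+\<xi>. Q \<xi> x \<partial>grassmann_measure k) = (\<integral>\<^sup>+Y. (\<Prod>i\<in>?I. gauss (Y i)) * Q (span (Y ` ?I)) x \<partial>Pi\<^sub>M ?I (\<lambda>_. lborel))"
      using nn_integral_grassmann_measure[of ?I "\<lambda>\<xi>. Q \<xi> x"] kN by simp
    also have "\<dots> = ?K * (\<integral>\<^sup>+Y. H (fan k x Y) * inv_volume ?I Y ^ ?m \<partial>Pi\<^sub>M ?I (\<lambda>_. lborel))"
      using linear_blaschke_petkantschin_stiefel[OF _ _ _ hH] k by (simp add: Q_def stiefel_ratio_def)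
    also have "\<dots> = (\<integral>\<^sup>+Y. ?K * (H (fan k x Y) * inv_volume ?I Y ^ ?m) \<partial>Pi\<^sub>M ?I (\<lambda>_. lborel))"
      by (rule nn_integral_cmult[symmetric]) measurable
    also have "\<dots> = (\<integral>\<^sup>+Y. ?K * (H (fan k x (\<lambda>i\<in>?I. - x + Y i)) * inv_volume ?I (\<lambda>i\<in>?I. - x + Y i) ^ ?m) \<partial>Pi\<^sub>M ?I (\<lambda>_. lborel))"
      by (rule nn_integral_PiM_lborel_translate[symmetric, where h="\<lambda>Y. ?K * (H (fan k x Y) * inv_volume ?I Y ^ ?m)"]) (simp, measurable)
    also have "\<dots> = (\<integral>\<^sup>+Y. ?K * inv_volume ?I (edges (Y(0 := x))) ^ ?m * H (Y(0 := x)) \<partial>Pi\<^sub>M ?I (\<lambda>_. lborel))"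
    proof (rule nn_integral_cong)
      fix Y assume "Y \<in> space (Pi\<^sub>M ?I (\<lambda>_. lborel :: 'a measure))"
      then have "Y \<in> extensional ?I" by (simp add: space_PiM PiE_def)
      then have "fan k x (\<lambda>i\<in>?I. - x + Y i) = Y(0 := x)"
        by (auto simp: fan_def fun_eq_iff extensional_def)
      moreover have "inv_volume ?I (\<lambda>i\<in>?I. - x + Y i) = inv_volume ?I (edges (Y(0 := x)))"
        by (intro inv_volume_cong) (auto simp: edges_def)
      ultimately show "?K * (H (fan k x (\<lambda>i\<in>?I. - x + Y i)) * inv_volume ?I (\<lambda>i\<in>?I. - x + Y i) ^ ?m) =
        ?K * inv_volume ?I (edges (Y(0 := x))) ^ ?m * H (Y(0 := x))"
        by (simp only: ac_simps)
    qed
    finally show "(\<integral>\<^sup>+\<xi>. Q \<xi> x \<partial>grassmann_measure k) =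
      (\<integral>\<^sup>+Y. ?K * inv_volume ?I (edges (Y(0 := x))) ^ ?m * H (Y(0 := x)) \<partial>Pi\<^sub>M ?I (\<lambda>_. lborel))" .
  qed
  also have "\<dots> = (\<integral>\<^sup>+x. ?K * inv_volume ?I (edges x) ^ ?m * H x \<partial>Pi\<^sub>M (insert 0 ?I) (\<lambda>_. lborel))"
  proof (rule lborel_PiM.product_nn_integral_insert_rev[symmetric])
    have ins: "insert 0 ?I = {..k}" by auto
    have [measurable]: "(\<lambda>x. edges x i) \<in> borel_measurable (Pi\<^sub>M {..k} (\<lambda>_. lborel :: 'a measure))" if "i \<in> ?I" for i
      unfolding edges_def using that by (intro borel_measurable_diff measurable_component_singleton) auto
    show "(\<lambda>x. ?K * inv_volume ?I (edges x) ^ ?m * H x) \<in> borel_measurable (Pi\<^sub>M (insert 0 ?I) (\<lambda>_. lborel))"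
      unfolding ins by measurable
  qed auto
  also have "insert 0 ?I = {..k}" by auto
  finally show ?thesis .
qed

section \<open>Borel representatives\<close>

text \<open>Each simple function of an approximating sequence agrees almost everywhere with a measurable one,
  and so do the limits.\<close>

lemma completion_ex_borel_measurable_banach:
  fixes f :: "'a \<Rightarrow> 'b::{banach, second_countable_topology}"
  assumes f: "f \<in> borel_measurable (completion M)"
  shows "\<exists>g\<in>borel_measurable M. AE x in M. f x = g x"
proof -
  obtain s where s: "\<And>i. simple_function (completion M) (s i)"
    and lim: "\<And>x. x \<in> space M \<Longrightarrow> (\<lambda>i. s i x) \<longlonglongrightarrow> f x"
    using borel_measurable_implies_sequence_metric[OF f, of 0] by auto
  have "\<forall>i. \<exists>t. simple_function M t \<and> (AE x in M. s i x = t x)"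
    using completion_ex_simple_function[OF s] by simp
  then obtain t where t: "\<And>i. simple_function M (t i)" and ae: "\<And>i. AE x in M. s i x = t i x"
    by metis
  have [measurable]: "t i \<in> borel_measurable M" for i
    using t by (rule borel_measurable_simple_function)
  show ?thesis
  proof (rule bexI[of _ "\<lambda>x. lim (\<lambda>i. t i x)"])
    have "AE x in M. \<forall>i. s i x = t i x" using ae by (simp add: AE_all_countable)
    then show "AE x in M. f x = lim (\<lambda>i. t i x)"
      using AE_space
    proof eventually_elim
      fix x assume "\<forall>i. s i x = t i x" and x: "x \<in> space M"
      then have "(\<lambda>i. t i x) \<longlonglongrightarrow> f x" using lim[OF x] by simp
      then show "f x = lim (\<lambda>i. t i x)" by (rule limI[symmetric])
    qed
  qed measurable
qed

lemma borel_measurable_completion_AE: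
  assumes g: "g \<in> borel_measurable M" and ae: "AE x in M. f x = g x"
  shows "f \<in> borel_measurable (completion M)"
proof (rule measurableI)
  fix A :: "'b set" assume A: "A \<in> sets borel"
  obtain N where N': "{x \<in> space M. \<not> f x = g x} \<subseteq> N" "emeasure M N = 0" "N \<in> sets M"
    using ae by (rule AE_E)
  then have N: "{x \<in> space M. \<not> f x = g x} \<subseteq> N" "N \<in> null_sets M"
    by (simp_all add: null_setsI)
  have eq: "f -` A \<inter> space (completion M) = (g -` A \<inter> space M - N) \<union> (f -` A \<inter> space M \<inter> N)"
    using N(1) by auto
  have "g -` A \<inter> space M - N \<in> sets (completion M)"
    using measurable_sets[OF g A] N(2) by (intro sets_completionI_sets sets.Diff) auto
  moreover have "f -` A \<inter> space M \<inter> N \<in> sets (completion M)"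
    using N(2) by (intro sets_completionI_sub[of _ M]) auto
  ultimately show "f -` A \<inter> space (completion M) \<in> sets (completion M)"
    unfolding eq by (intro sets.Un)
qed simp

section \<open>The plane and the simplex spanned by a tuple of points\<close>

lemma inv_volume_edges_cong:
  "inv_volume {1..k} (restrict (edges x) {1..k}) = inv_volume {1..k} (edges x)"
  by (intro inv_volume_cong) auto

text \<open>A measurable choice of the plane through a tuple; the restriction to \<open>{1..k}\<close> makes the tuple of
  differences an element of the product space on which \<open>spanned_plane\<close> is measurable.\<close>

definition spanned_flat :: "nat \<Rightarrow> (nat \<Rightarrow> 'a::euclidean_space) \<Rightarrow> 'a set" where
  "spanned_flat k x = (+) (x 0) ` spanned_plane {1..k} (restrict (edges x) {1..k})"

lemma measurable_edges[measurable]: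
  "(\<lambda>x. restrict (edges x) {1..k}) \<in> Pi\<^sub>M {..k} (\<lambda>_. borel) \<rightarrow>\<^sub>M Pi\<^sub>M {1..k} (\<lambda>_. borel :: 'a::euclidean_space measure)"
  unfolding edges_def by (intro measurable_restrict borel_measurable_diff measurable_component_singleton) auto

lemma measurable_inv_volume_edges[measurable]:
  "(\<lambda>x. inv_volume {1..k} (edges x :: nat \<Rightarrow> 'a::euclidean_space)) \<in> borel_measurable (Pi\<^sub>M {..k} (\<lambda>_. borel))"
proof (rule measurable_inv_volume)
  show "(\<lambda>x. edges x i) \<in> borel_measurable (Pi\<^sub>M {..k} (\<lambda>_. borel :: 'a measure))" if "i \<in> {1..k}" for i
    unfolding edges_def using that by (intro borel_measurable_diff measurable_component_singleton) auto
qed simp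

lemma measurable_spanned_flat[measurable]:
  assumes "k \<le> DIM('a::euclidean_space)"
  shows "spanned_flat k \<in> Pi\<^sub>M {..k} (\<lambda>_. borel :: 'a measure) \<rightarrow>\<^sub>M flat_borel (affine_grassmannian k)"
proof -
  have "spanned_plane {1..k} \<in> Pi\<^sub>M {1..k} (\<lambda>_. borel :: 'a measure) \<rightarrow>\<^sub>M flat_borel (grassmannian k)"
    using measurable_spanned_plane[of "{1..k}", where 'a='a] assms by simp
  from measurable_compose[OF measurable_edges this]
  have "(\<lambda>x. spanned_plane {1..k} (restrict (edges x) {1..k})) \<in> Pi\<^sub>M {..k} (\<lambda>_. borel :: 'a measure) \<rightarrow>\<^sub>M flat_borel (grassmannian k)" .
  then show ?thesis
    unfolding spanned_flat_def[abs_def] by (rule measurable_translate) simp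
qed

lemma spanned_flat_eq:
  assumes "inv_volume {1..k} (edges x) < top"
  shows "spanned_flat k x = (+) (x 0) ` span (edges x ` {1..k})"
proof -
  have "restrict (edges x) {1..k} ` {1..k} = edges x ` {1..k}" by (intro image_cong) auto
  then show ?thesis
    using assms by (simp add: spanned_flat_def spanned_plane_def inv_volume_edges_cong[simplified])
qed

lemma spanned_flat_in_affine_grassmannian:
  assumes "inv_volume {1..k} (edges x) < top"
  shows "spanned_flat k x \<in> affine_grassmannian k"
  using span_in_grassmannian[OF _ assms] unfolding spanned_flat_eq[OF assms]
  by (intro translate_in_affine_grassmannian) simp

lemma spanned_flat_contains:
  assumes "inv_volume {1..k} (edges x) < top" and i: "i \<le> k"
  shows "x i \<in> spanned_flat k x"
proof (cases "i = 0")
  case True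
  then show ?thesis
    unfolding spanned_flat_eq[OF assms(1)] by (intro image_eqI[of _ _ 0]) (auto simp: span_zero)
next
  case False
  then show ?thesis
    unfolding spanned_flat_eq[OF assms(1)] using i
    by (intro image_eqI[of _ _ "edges x i"]) (auto simp: edges_def intro!: span_base)
qed

lemma spanned_flat_unique:
  fixes x :: "nat \<Rightarrow> 'a::euclidean_space"
  assumes W: "inv_volume {1..k} (edges x) < top" and \<tau>: "\<tau> \<in> affine_grassmannian k"
    and x: "\<And>i. i \<le> k \<Longrightarrow> x i \<in> \<tau>"
  shows "spanned_flat k x = \<tau>"
proof -
  define S where "S = (\<lambda>y. y - x 0) ` \<tau>"
  have S: "subspace S"
    unfolding S_def by (rule affine_diffs_subspace_subtract[OF affine_grassmannianD(1)[OF \<tau>] x]) simp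
  have "aff_dim S = int k" unfolding S_def aff_dim_translation_eq_subtract by (rule affine_grassmannianD(2)[OF \<tau>])
  then have dS: "dim S = k" by (simp add: aff_dim_subspace[OF S])
  have sub: "span (edges x ` {1..k}) \<subseteq> S"
    using x by (intro span_minimal S) (auto simp: S_def edges_def)
  have "span (edges x ` {1..k}) = S"
    using grassmannianD(2)[OF span_in_grassmannian[OF _ W]] dS
    by (intro subspace_dim_equal[OF subspace_span S sub]) simp
  moreover have "(+) (x 0) ` S = \<tau>" by (force simp: S_def image_image)
  ultimately show ?thesis by (simp add: spanned_flat_eq[OF W])
qed

lemma plane_through_eq:
  assumes W: "inv_volume {1..k} (edges x) < top"
  shows "plane_through k x = spanned_flat k x"
  unfolding plane_through_def
proof (rule some_equality)
  show "spanned_flat k x \<in> affine_grassmannian k \<and> x ` {..k} \<subseteq> spanned_flat k x"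
    using spanned_flat_in_affine_grassmannian[OF W] spanned_flat_contains[OF W] by auto
  show "\<tau> = spanned_flat k x" if "\<tau> \<in> affine_grassmannian k \<and> x ` {..k} \<subseteq> \<tau>" for \<tau>
    using that by (intro spanned_flat_unique[OF W, symmetric]) auto
qed

lemma AE_PiM_flat_measure_spanned_flat:
  fixes \<tau> :: "'a::euclidean_space set"
  assumes \<tau>: "\<tau> \<in> affine_grassmannian k"
  shows "AE x in Pi\<^sub>M {..k} (\<lambda>_. flat_measure \<tau>). inv_volume {1..k} (edges x) < top \<and> spanned_flat k x = \<tau>"
proof -
  obtain a where a: "a \<in> \<tau>" using affine_grassmannianD(3)[OF \<tau>] by blast
  define \<xi> where "\<xi> = (\<lambda>y. y - a) ` \<tau>"
  have \<xi>: "subspace \<xi>" unfolding \<xi>_def by (rule affine_diffs_subspace_subtract[OF affine_grassmannianD(1)[OF \<tau>] a])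
  have "aff_dim \<xi> = int k" unfolding \<xi>_def aff_dim_translation_eq_subtract by (rule affine_grassmannianD(2)[OF \<tau>])
  then have d: "dim \<xi> = k" by (simp add: aff_dim_subspace[OF \<xi>])
  have \<tau>\<xi>: "\<tau> = (+) a ` \<xi>" by (force simp: \<xi>_def image_image)
  note [measurable] = affine_borel[OF affine_grassmannianD(1)[OF \<tau>]]
  define P where "P x \<longleftrightarrow> (\<forall>i\<in>{..k}. x i \<in> \<tau>) \<and> inv_volume {1..k} (edges x) < top" for x
  have Pm: "Measurable.pred (Pi\<^sub>M {..k} (\<lambda>_. borel)) P" unfolding P_def by measurable
  let ?h = "\<lambda>x. indicator {x. \<not> P x} x :: ennreal"
  have hm: "?h \<in> borel_measurable (Pi\<^sub>M {..k} (\<lambda>_. borel))" using Pm unfolding indicator_def by measurable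
  then have hm': "?h \<in> borel_measurable (Pi\<^sub>M {..k} (\<lambda>_. flat_measure \<tau>))" by measurable
  have "AE u in Pi\<^sub>M {1..k} (\<lambda>_. flat_measure \<xi>). (\<forall>i\<in>{1..k}. u i \<in> \<xi>) \<and> inv_volume {1..k} u < top"
    by (rule AE_PiM_flat_measure_independent[OF \<xi>]) (simp_all add: d)
  then have inner: "(\<integral>\<^sup>+u. ?h (fan k (a + u0) u) \<partial>Pi\<^sub>M {1..k} (\<lambda>_. flat_measure \<xi>)) = 0" if u0: "u0 \<in> \<xi>" for u0
  proof -
    have "(\<integral>\<^sup>+u. ?h (fan k (a + u0) u) \<partial>Pi\<^sub>M {1..k} (\<lambda>_. flat_measure \<xi>)) = (\<integral>\<^sup>+u. 0 \<partial>Pi\<^sub>M {1..k} (\<lambda>_. flat_measure \<xi>))"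
    proof (intro nn_integral_cong_AE, use \<open>AE u in _. _\<close> in eventually_elim)
      fix u assume u: "(\<forall>i\<in>{1..k}. u i \<in> \<xi>) \<and> inv_volume {1..k} u < top"
      have "inv_volume {1..k} (edges (fan k (a + u0) u)) = inv_volume {1..k} u"
        by (intro inv_volume_cong) (auto simp: edges_def fan_def)
      moreover have "fan k (a + u0) u i \<in> \<tau>" if "i \<in> {..k}" for i
        using that u u0 subspace_add[OF \<xi> u0] by (auto simp: fan_def \<tau>\<xi> add.assoc)
      ultimately have "P (fan k (a + u0) u)" using u by (simp add: P_def)
      then show "?h (fan k (a + u0) u) = 0" by simp
    qed
    then show ?thesis by simp
  qed
  have "(\<integral>\<^sup>+x. ?h x \<partial>Pi\<^sub>M {..k} (\<lambda>_. flat_measure \<tau>)) =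
    (\<integral>\<^sup>+u0. \<integral>\<^sup>+u. ?h (fan k (a + u0) u) \<partial>Pi\<^sub>M {1..k} (\<lambda>_. flat_measure \<xi>) \<partial>flat_measure \<xi>)"
    unfolding \<tau>\<xi> by (rule PiM_flat_measure_split[OF \<xi> hm])
  also have "\<dots> = (\<integral>\<^sup>+u0. 0 \<partial>flat_measure \<xi>)"
    by (intro nn_integral_cong_AE, use normalized_haarD(3)[OF normalized_haar_flat_measure[OF \<xi>]] in eventually_elim) (rule inner)
  finally have "AE x in Pi\<^sub>M {..k} (\<lambda>_. flat_measure \<tau>). ?h x = 0"
    using nn_integral_0_iff_AE[OF hm'] by simp
  then show ?thesis
  proof eventually_elim
    fix x assume "?h x = 0"
    then have "P x" by (cases "P x") simp_all
    then show "inv_volume {1..k} (edges x) < top \<and> spanned_flat k x = \<tau>"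
      using spanned_flat_unique[of k x \<tau>] \<tau> by (simp add: P_def)
  qed
qed

lemma AE_lborel_edges_independent:
  assumes k: "1 \<le> k" "k < DIM('a::euclidean_space)"
  shows "AE x in Pi\<^sub>M {..k} (\<lambda>_. lborel :: 'a measure). inv_volume {1..k} (edges x) < top"
proof -
  have ins: "{..k} = insert 0 {1..k}" by auto
  have kk: "card {1..k} \<le> DIM('a)" using k by simp
  let ?h = "\<lambda>x :: nat \<Rightarrow> 'a. indicator {x. \<not> inv_volume {1..k} (edges x) < top} x :: ennreal"
  have hm: "?h \<in> borel_measurable (Pi\<^sub>M {..k} (\<lambda>_. borel :: 'a measure))" unfolding indicator_def by measurable
  then have hm': "?h \<in> borel_measurable (Pi\<^sub>M {..k} (\<lambda>_. lborel :: 'a measure))" by measurable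
  have "(\<integral>\<^sup>+x. ?h x \<partial>Pi\<^sub>M (insert 0 {1..k}) (\<lambda>_. lborel :: 'a measure)) =
    (\<integral>\<^sup>+x. \<integral>\<^sup>+Y. ?h (Y(0 := x)) \<partial>Pi\<^sub>M {1..k} (\<lambda>_. lborel) \<partial>(lborel :: 'a measure))"
    by (rule lborel_PiM.product_nn_integral_insert_rev) (use hm' ins in auto)
  also have "\<dots> = (\<integral>\<^sup>+x. 0 \<partial>(lborel :: 'a measure))"
  proof (rule nn_integral_cong)
    fix x :: 'a
    let ?g = "\<lambda>Y :: nat \<Rightarrow> 'a. indicator {Y. \<not> inv_volume {1..k} Y < top} Y :: ennreal"
    have gm: "?g \<in> borel_measurable (Pi\<^sub>M {1..k} (\<lambda>_. lborel :: 'a measure))" unfolding indicator_def by measurable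
    have "(\<integral>\<^sup>+Y. ?h (Y(0 := x)) \<partial>Pi\<^sub>M {1..k} (\<lambda>_. lborel :: 'a measure)) = (\<integral>\<^sup>+Y. ?g (\<lambda>i\<in>{1..k}. - x + Y i) \<partial>Pi\<^sub>M {1..k} (\<lambda>_. lborel :: 'a measure))"
    proof (rule nn_integral_cong)
      fix Y :: "nat \<Rightarrow> 'a"
      have "inv_volume {1..k} (\<lambda>i\<in>{1..k}. - x + Y i) = inv_volume {1..k} (edges (Y(0 := x)))"
        by (intro inv_volume_cong) (auto simp: edges_def)
      then show "?h (Y(0 := x)) = ?g (\<lambda>i\<in>{1..k}. - x + Y i)" by (simp add: indicator_def)
    qed
    also have "\<dots> = (\<integral>\<^sup>+Y. ?g Y \<partial>Pi\<^sub>M {1..k} (\<lambda>_. lborel :: 'a measure))"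
      by (rule nn_integral_PiM_lborel_translate[OF _ gm]) simp
    also have "\<dots> = (\<integral>\<^sup>+Y. 0 \<partial>Pi\<^sub>M {1..k} (\<lambda>_. lborel :: 'a measure))"
      by (intro nn_integral_cong_AE, use AE_lborel_independent[OF finite_atLeastAtMost kk] in eventually_elim) (simp add: indicator_def)
    finally show "(\<integral>\<^sup>+Y. ?h (Y(0 := x)) \<partial>Pi\<^sub>M {1..k} (\<lambda>_. lborel :: 'a measure)) = 0" by simp
  qed
  finally have "AE x in Pi\<^sub>M {..k} (\<lambda>_. lborel :: 'a measure). ?h x = 0"
    using nn_integral_0_iff_AE[OF hm'] by (simp add: ins)
  then show ?thesis
  proof eventually_elim
    fix x :: "nat \<Rightarrow> 'a" assume "?h x = 0"
    then show "inv_volume {1..k} (edges x) < top" by (cases "inv_volume {1..k} (edges x) < top") simp_all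
  qed
qed

text \<open>Otherwise some vector would lie in the span of the others.\<close>

lemma lincomb_inject:
  fixes Y :: "'i \<Rightarrow> 'a::euclidean_space"
  assumes I: "finite I" and W: "inv_volume I Y < top" and eq: "lincomb I Y a = lincomb I Y b" and j: "j \<in> I"
  shows "a j = b j"
proof (rule ccontr)
  let ?J = "I - {j}"
  assume "a j \<noteq> b j"
  then have c: "a j - b j \<noteq> 0" by simp
  have IJ: "I = insert j ?J" and J: "finite ?J" "j \<notin> ?J" using I j by auto
  have "lincomb (insert j ?J) Y a = lincomb (insert j ?J) Y b" using eq IJ by simp
  then have "(a j - b j) *\<^sub>R Y j = lincomb ?J Y b - lincomb ?J Y a"
    unfolding lincomb_insert[OF J] by (simp add: algebra_simps)
  then have "Y j = (1 / (a j - b j)) *\<^sub>R (lincomb ?J Y b - lincomb ?J Y a)"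
    using c by (metis divide_self scaleR_one scaleR_scaleR times_divide_eq_left mult_1)
  then have "Y j \<in> span (Y ` ?J)"
    using J by (metis span_scale span_diff lincomb_in_span)
  moreover have "Y j \<notin> span (Y ` ?J)"
    using W inv_volume_insert_less_top[OF J, of Y] IJ by simp
  ultimately show False by contradiction
qed

lemma convex_hull_points_iff:
  fixes x :: "nat \<Rightarrow> 'a::euclidean_space"
  assumes W: "inv_volume {1..k} (edges x) < top"
  shows "x 0 + lincomb {1..k} (edges x) a \<in> convex hull (x ` {..k}) \<longleftrightarrow> (\<forall>i\<in>{1..k}. 0 \<le> a i) \<and> sum a {1..k} \<le> 1"
proof
  have ins: "{..k} = insert 0 {1..k}" by auto
  assume a: "(\<forall>i\<in>{1..k}. 0 \<le> a i) \<and> sum a {1..k} \<le> 1"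
  define u where "u i = (if i = 0 then 1 - sum a {1..k} else a i)" for i
  have "(\<Sum>i\<in>{..k}. u i *\<^sub>R x i) \<in> convex hull (x ` {..k})"
  proof (rule convex_sum)
    show "sum u {..k} = 1" unfolding ins by (simp add: u_def)
    show "0 \<le> u i" if "i \<in> {..k}" for i using that a by (auto simp: u_def)
    show "x i \<in> convex hull (x ` {..k})" if "i \<in> {..k}" for i using that by (intro hull_inc) auto
  qed auto
  moreover have "(\<Sum>i\<in>{..k}. u i *\<^sub>R x i) = x 0 + lincomb {1..k} (edges x) a"
  proof -
    have "(\<Sum>i\<in>{1..k}. u i *\<^sub>R x i) = (\<Sum>i\<in>{1..k}. a i *\<^sub>R x i)" by (intro sum.cong) (auto simp: u_def)
    then have "(\<Sum>i\<in>{..k}. u i *\<^sub>R x i) = (1 - sum a {1..k}) *\<^sub>R x 0 + (\<Sum>i\<in>{1..k}. a i *\<^sub>R x i)"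
      unfolding ins by (simp add: u_def)
    also have "\<dots> = x 0 + lincomb {1..k} (edges x) a"
      by (simp add: lincomb_def edges_def scaleR_diff_right sum_subtractf scaleR_diff_left scaleR_sum_left)
    finally show ?thesis .
  qed
  ultimately show "x 0 + lincomb {1..k} (edges x) a \<in> convex hull (x ` {..k})" by simp
next
  let ?C = "{x 0 + lincomb {1..k} (edges x) b | b. (\<forall>i\<in>{1..k}. 0 \<le> b i) \<and> sum b {1..k} \<le> 1}"
  have "convex hull (x ` {..k}) \<subseteq> ?C"
  proof (rule hull_minimal)
    show "x ` {..k} \<subseteq> ?C"
    proof safe
      fix j assume "j \<le> k"
      define b where "b i = (if i = j then 1 else 0 :: real)" for i
      have "(\<Sum>i\<in>{1..k}. b i *\<^sub>R edges x i) = (\<Sum>i\<in>{1..k}. if i = j then edges x i else 0)"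
        by (intro sum.cong) (auto simp: b_def)
      then have "x 0 + lincomb {1..k} (edges x) b = x j"
        using \<open>j \<le> k\<close> by (cases "j = 0") (auto simp: lincomb_def edges_def)
      moreover have "sum b {1..k} \<le> 1" by (simp add: b_def)
      ultimately show "\<exists>b. x j = x 0 + lincomb {1..k} (edges x) b \<and> (\<forall>i\<in>{1..k}. 0 \<le> b i) \<and> sum b {1..k} \<le> 1"
        by (intro exI[of _ b]) (auto simp: b_def)
    qed
    show "convex ?C"
    proof (rule convexI, clarify)
      fix b c :: "nat \<Rightarrow> real" and u v :: real
      assume uv: "0 \<le> u" "0 \<le> v" "u + v = 1" and b: "\<forall>i\<in>{1..k}. 0 \<le> b i" "sum b {1..k} \<le> 1"
        and c: "\<forall>i\<in>{1..k}. 0 \<le> c i" "sum c {1..k} \<le> 1"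
      let ?d = "\<lambda>i. u * b i + v * c i"
      have "u *\<^sub>R (x 0 + lincomb {1..k} (edges x) b) + v *\<^sub>R (x 0 + lincomb {1..k} (edges x) c) =
        (u + v) *\<^sub>R x 0 + lincomb {1..k} (edges x) ?d"
        by (simp add: lincomb_def scaleR_add_right scaleR_add_left sum.distrib scaleR_sum_right)
      moreover have "sum ?d {1..k} = u * sum b {1..k} + v * sum c {1..k}"
        by (simp add: sum.distrib sum_distrib_left)
      moreover have "u * sum b {1..k} + v * sum c {1..k} \<le> u * 1 + v * 1"
        using uv b c by (intro add_mono mult_left_mono) auto
      ultimately show "\<exists>d. u *\<^sub>R (x 0 + lincomb {1..k} (edges x) b) + v *\<^sub>R (x 0 + lincomb {1..k} (edges x) c) =
        x 0 + lincomb {1..k} (edges x) d \<and> (\<forall>i\<in>{1..k}. 0 \<le> d i) \<and> sum d {1..k} \<le> 1"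
        using uv b c by (intro exI[of _ ?d]) auto
    qed
  qed
  moreover assume "x 0 + lincomb {1..k} (edges x) a \<in> convex hull (x ` {..k})"
  ultimately obtain b where b: "x 0 + lincomb {1..k} (edges x) a = x 0 + lincomb {1..k} (edges x) b"
    "\<forall>i\<in>{1..k}. 0 \<le> b i" "sum b {1..k} \<le> 1" by blast
  have "a i = b i" if "i \<in> {1..k}" for i
    using b(1) that by (intro lincomb_inject[OF _ W]) auto
  then show "(\<forall>i\<in>{1..k}. 0 \<le> a i) \<and> sum a {1..k} \<le> 1"
    using b(2,3) by simp
qed

text \<open>In the coefficients of the edges the simplex is the standard simplex, of volume \<open>1 / k!\<close>, and
  the Jacobian is \<open>inv_volume\<close>.\<close>

lemma simplex_volume_eq:
  fixes x :: "nat \<Rightarrow> 'a::euclidean_space"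
  assumes W: "inv_volume {1..k} (edges x) < top"
  shows "simplex_volume k x = 1 / (fact k * enn2real (inv_volume {1..k} (edges x)))"
proof -
  let ?I = "{1..k}"
  let ?W = "inv_volume ?I (edges x)"
  let ?S = "span (edges x ` ?I)"
  let ?h = "convex hull (x ` {..k})"
  have S: "affine ?S" "?S \<noteq> {}" using subspace_imp_affine[OF subspace_span] span_zero[of "edges x ` ?I"] by blast+
  note A = affine_grassmannianD[OF spanned_flat_in_affine_grassmannian[OF W]]
  have h[measurable]: "?h \<in> sets borel"
    by (intro borel_compact compact_convex_hull finite_imp_compact) auto
  have "emeasure (flat_lebesgue (plane_through k x)) ?h = (\<integral>\<^sup>+y. indicator ?h y \<partial>flat_measure (spanned_flat k x))"
    by (simp add: plane_through_eq[OF W] flat_lebesgue_eq[OF A(1,3)])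
  also have "\<dots> = (\<integral>\<^sup>+y. indicator ?h (x 0 + y) \<partial>flat_measure ?S)"
    unfolding spanned_flat_eq[OF W] by (rule nn_integral_flat_measure_translation[OF S]) measurable
  finally have E: "emeasure (flat_lebesgue (plane_through k x)) ?h = (\<integral>\<^sup>+y. indicator ?h (x 0 + y) \<partial>flat_measure ?S)" .
  have "?W * emeasure (flat_lebesgue (plane_through k x)) ?h = (\<integral>\<^sup>+a. indicator ?h (x 0 + lincomb ?I (edges x) a) \<partial>Pi\<^sub>M ?I (\<lambda>_. lborel :: real measure))"
    unfolding E by (rule nn_integral_lincomb[OF _ W, of "\<lambda>y. indicator ?h (x 0 + y)", symmetric]) (simp, measurable)
  also have "\<dots> = (\<integral>\<^sup>+a. indicator ({a. (\<forall>i\<in>?I. 0 \<le> a i) \<and> sum a ?I \<le> 1} \<inter> space (Pi\<^sub>M ?I (\<lambda>_. lborel :: real measure))) a \<partial>Pi\<^sub>M ?I (\<lambda>_. lborel :: real measure))"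
    by (intro nn_integral_cong) (use convex_hull_points_iff[OF W] in \<open>simp add: indicator_def\<close>)
  also have "\<dots> = emeasure (Pi\<^sub>M ?I (\<lambda>_. lborel :: real measure)) ({a. (\<forall>i\<in>?I. 0 \<le> a i) \<and> sum a ?I \<le> 1} \<inter> space (Pi\<^sub>M ?I (\<lambda>_. lborel :: real measure)))"
  proof (rule nn_integral_indicator)
    have "{a \<in> space (Pi\<^sub>M ?I (\<lambda>_. lborel :: real measure)). (\<forall>i\<in>?I. 0 \<le> a i) \<and> sum a ?I \<le> 1} \<in> sets (Pi\<^sub>M ?I (\<lambda>_. lborel))"
      by measurable
    moreover have "{a. (\<forall>i\<in>?I. 0 \<le> a i) \<and> sum a ?I \<le> 1} \<inter> space (Pi\<^sub>M ?I (\<lambda>_. lborel)) =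
      {a \<in> space (Pi\<^sub>M ?I (\<lambda>_. lborel :: real measure)). (\<forall>i\<in>?I. 0 \<le> a i) \<and> sum a ?I \<le> 1}"
      by auto
    ultimately show "{a. (\<forall>i\<in>?I. 0 \<le> a i) \<and> sum a ?I \<le> 1} \<inter> space (Pi\<^sub>M ?I (\<lambda>_. lborel :: real measure)) \<in> sets (Pi\<^sub>M ?I (\<lambda>_. lborel))"
      by (simp only:)
  qed
  also have "\<dots> = ennreal (1 / fact k)"
    using emeasure_std_simplex_aux[of ?I 1] by simp
  finally have eq: "?W * emeasure (flat_lebesgue (plane_through k x)) ?h = ennreal (1 / fact k)" .
  obtain w where w: "?W = ennreal w" "w \<ge> 0" using W by (cases ?W) auto
  have "w \<noteq> 0" using inv_volume_nonzero[of ?I "edges x"] w by auto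
  have "enn2real ?W * simplex_volume k x = enn2real (?W * emeasure (flat_lebesgue (plane_through k x)) ?h)"
    by (simp add: simplex_volume_def measure_def enn2real_mult)
  also have "\<dots> = 1 / fact k" unfolding eq by simp
  finally show ?thesis using w \<open>w \<noteq> 0\<close> by (simp add: field_simps)
qed

section \<open>Integrable functions\<close>

text \<open>A null measure could not give \<open>gauss\<close>, centred on \<open>\<tau>\<close>, the integral one.\<close>

lemma flat_measure_UNIV_nonzero:
  fixes \<tau> :: "'a::euclidean_space set"
  assumes \<tau>: "affine \<tau>" "\<tau> \<noteq> {}"
  shows "emeasure (flat_measure \<tau>) UNIV \<noteq> 0"
proof
  assume 0: "emeasure (flat_measure \<tau>) UNIV = 0"
  obtain a where a: "a \<in> \<tau>" using \<tau> by blast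
  define S where "S = (\<lambda>y. y - a) ` \<tau>"
  have S: "subspace S" unfolding S_def by (rule affine_diffs_subspace_subtract[OF \<tau>(1) a])
  have Sa: "affine S" "S \<noteq> {}" using subspace_imp_affine[OF S] subspace_0[OF S] by auto
  have \<tau>S: "\<tau> = (+) a ` S" by (force simp: S_def image_image)
  have "1 = (\<integral>\<^sup>+y. gauss y \<partial>flat_measure S)"
    by (rule normalized_haarD(5)[OF normalized_haar_flat_measure[OF S], symmetric])
  also have "\<dots> = (\<integral>\<^sup>+y. gauss (y - a) \<partial>flat_measure \<tau>)"
    unfolding \<tau>S by (subst nn_integral_flat_measure_translation[OF Sa]) auto
  also have "\<dots> = (\<integral>\<^sup>+y. 0 \<partial>flat_measure \<tau>)"
  proof (rule nn_integral_cong_AE)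
    show "AE y in flat_measure \<tau>. gauss (y - a) = 0"
      using 0 by (intro AE_I[of _ _ UNIV]) auto
  qed
  finally show False by simp
qed

lemma flat_tuple_space_nonzero:
  fixes \<tau> :: "'a::euclidean_space set"
  assumes "finite I" and \<tau>: "affine \<tau>" "\<tau> \<noteq> {}"
  shows "emeasure (Pi\<^sub>M I (\<lambda>_. flat_measure \<tau>)) (space (Pi\<^sub>M I (\<lambda>_. flat_measure \<tau>))) \<noteq> 0"
proof -
  interpret product_sigma_finite "\<lambda>_. flat_measure \<tau>" by (rule product_sigma_finite_flat_measure[OF \<tau>])
  have "emeasure (Pi\<^sub>M I (\<lambda>_. flat_measure \<tau>)) (\<Pi>\<^sub>E i\<in>I. UNIV) = (\<Prod>i\<in>I. emeasure (flat_measure \<tau>) UNIV)"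
    by (rule emeasure_PiM) (use assms in auto)
  then show ?thesis
    using flat_measure_UNIV_nonzero[OF \<tau>] assms(1) by (simp add: space_PiM)
qed

lemma stiefel_ratio_pos: "1 \<le> k \<Longrightarrow> k \<le> n \<Longrightarrow> 0 < stiefel_ratio n k"
  unfolding stiefel_ratio_def by (rule prod_gaussian_moment_eq_stiefel(2))

text \<open>Apply the affine formula to the indicator of failure. The weights on both sides are nowhere zero:
  on the right it is a power of \<open>inv_volume\<close>, and on the left the measure of the set of tuples in \<open>\<tau>\<close>.\<close>

lemma AE_affine_flat_measure_iff:
  assumes k: "1 \<le> k" "k < DIM('a::euclidean_space)"
    and P: "Measurable.pred (flat_borel (affine_grassmannian k :: 'a set set)) P"
  shows "(AE \<tau> in affine_flat_measure k. P \<tau>) \<longleftrightarrow> (AE x in Pi\<^sub>M {..k} (\<lambda>_. lborel). P (spanned_flat k x))"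
proof -
  have kN: "k \<le> DIM('a)" using k by simp
  note [measurable] = measurable_spanned_flat[OF kN]
  let ?K = "ennreal (stiefel_ratio DIM('a) k)"
  let ?w = "\<lambda>x :: nat \<Rightarrow> 'a. ?K * inv_volume {1..k} (edges x) ^ (DIM('a) - k)"
  let ?u = "\<lambda>\<tau>. indicator {\<tau>. \<not> P \<tau>} \<tau> :: ennreal"
  have um[measurable]: "?u \<in> borel_measurable (flat_borel (affine_grassmannian k))"
    using P unfolding indicator_def by measurable
  have hm[measurable]: "(\<lambda>x. ?u (spanned_flat k x)) \<in> borel_measurable (Pi\<^sub>M {..k} (\<lambda>_. borel :: 'a measure))"
    by measurable
  define J where "J \<tau> = (\<integral>\<^sup>+x. ?u (spanned_flat k x) \<partial>Pi\<^sub>M {..k} (\<lambda>_. flat_measure \<tau>))" for \<tau> :: "'a set"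
  have Jm[measurable]: "J \<in> borel_measurable (affine_flat_measure k)"
  proof -
    have "J \<in> borel_measurable (flat_borel (affine_grassmannian k))"
      unfolding J_def by (rule measurable_nn_integral_PiM_flat_measure[OF _ flat_family_affine_grassmannian]) auto
    then show ?thesis by measurable
  qed
  have J: "J \<tau> = 0 \<longleftrightarrow> P \<tau>" if \<tau>: "\<tau> \<in> affine_grassmannian k" for \<tau>
  proof -
    have "J \<tau> = (\<integral>\<^sup>+x. ?u \<tau> \<partial>Pi\<^sub>M {..k} (\<lambda>_. flat_measure \<tau>))"
      unfolding J_def
      by (intro nn_integral_cong_AE, use AE_PiM_flat_measure_spanned_flat[OF \<tau>] in eventually_elim) simp
    then show ?thesis
      using flat_tuple_space_nonzero[of "{..k}", OF _ affine_grassmannianD(1,3)[OF \<tau>]]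
      by (cases "P \<tau>") simp_all
  qed
  have "(AE \<tau> in affine_flat_measure k. P \<tau>) \<longleftrightarrow> (AE \<tau> in affine_flat_measure k. J \<tau> = 0)"
    by (rule AE_cong) (simp add: J)
  also have "\<dots> \<longleftrightarrow> (\<integral>\<^sup>+\<tau>. J \<tau> \<partial>affine_flat_measure k) = 0"
    using nn_integral_0_iff_AE[OF Jm] by simp
  also have "(\<integral>\<^sup>+\<tau>. J \<tau> \<partial>affine_flat_measure k) = (\<integral>\<^sup>+x. ?w x * ?u (spanned_flat k x) \<partial>Pi\<^sub>M {..k} (\<lambda>_. lborel))"
    unfolding J_def by (rule affine_blaschke_petkantschin[OF k hm])
  also have "\<dots> = 0 \<longleftrightarrow> (AE x in Pi\<^sub>M {..k} (\<lambda>_. lborel). ?w x * ?u (spanned_flat k x) = 0)"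
    by (rule nn_integral_0_iff_AE) measurable
  also have "\<dots> \<longleftrightarrow> (AE x in Pi\<^sub>M {..k} (\<lambda>_. lborel). P (spanned_flat k x))"
  proof (rule AE_cong)
    fix x :: "nat \<Rightarrow> 'a"
    have "?w x \<noteq> 0" using stiefel_ratio_pos[of k "DIM('a)"] k by simp
    then show "?w x * ?u (spanned_flat k x) = 0 \<longleftrightarrow> P (spanned_flat k x)"
      by (cases "P (spanned_flat k x)") simp_all
  qed
  finally show ?thesis .
qed

lemma AE_PiM_lborel_component:
  assumes "finite I" "j \<in> I" and N: "N \<in> null_sets (lborel :: 'a::euclidean_space measure)"
  shows "AE x in Pi\<^sub>M I (\<lambda>_. lborel :: 'a measure). x j \<notin> N"
proof -
  let ?J = "I - {j}"
  have IJ: "I = insert j ?J" and J: "finite ?J" "j \<notin> ?J" using assms by auto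
  have [measurable]: "N \<in> sets borel" using N by auto
  have "AE x in Pi\<^sub>M (insert j ?J) (\<lambda>_. lborel :: 'a measure). x j \<notin> N"
    by (rule AE_PiM_insert[OF product_sigma_finite_lborel J]) (use AE_not_in[OF N] in auto)
  then show ?thesis by (simp only: IJ[symmetric])
qed

text \<open>Apply the affine formula to the indicator of \<open>x\<^sub>0 \<in> N\<close>; on the planes it integrates to
  the measure of \<open>N\<close> times a power of the positive total mass.\<close>

lemma AE_affine_flat_null:
  assumes k: "1 \<le> k" "k < DIM('a::euclidean_space)" and N: "N \<in> null_sets (lborel :: 'a measure)"
  shows "AE \<tau> in affine_flat_measure k. emeasure (flat_measure \<tau>) N = 0"
proof -
  have [measurable]: "N \<in> sets borel" using N by auto
  let ?H = "\<lambda>x :: nat \<Rightarrow> 'a. indicator N (x 0) :: ennreal"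
  have Hm[measurable]: "?H \<in> borel_measurable (Pi\<^sub>M {..k} (\<lambda>_. borel))" by measurable
  define J where "J \<tau> = (\<integral>\<^sup>+x. ?H x \<partial>Pi\<^sub>M {..k} (\<lambda>_. flat_measure \<tau>))" for \<tau> :: "'a set"
  have Jm: "J \<in> borel_measurable (affine_flat_measure k)"
  proof -
    have "J \<in> borel_measurable (flat_borel (affine_grassmannian k))"
      unfolding J_def by (rule measurable_nn_integral_PiM_flat_measure[OF _ flat_family_affine_grassmannian]) auto
    then show ?thesis by measurable
  qed
  have ae: "AE x in Pi\<^sub>M {..k} (\<lambda>_. lborel). x 0 \<notin> N"
    by (rule AE_PiM_lborel_component[OF finite_atMost _ N]) simp
  have "(\<integral>\<^sup>+\<tau>. J \<tau> \<partial>affine_flat_measure k) =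
    (\<integral>\<^sup>+x. ennreal (stiefel_ratio DIM('a) k) * inv_volume {1..k} (edges x) ^ (DIM('a) - k) * ?H x \<partial>Pi\<^sub>M {..k} (\<lambda>_. lborel))"
    unfolding J_def by (rule affine_blaschke_petkantschin[OF k Hm])
  also have "\<dots> = (\<integral>\<^sup>+x. 0 \<partial>Pi\<^sub>M {..k} (\<lambda>_. lborel :: 'a measure))"
    by (intro nn_integral_cong_AE, use ae in eventually_elim) simp
  finally have "AE \<tau> in affine_flat_measure k. J \<tau> = 0"
    using nn_integral_0_iff_AE[OF Jm] by simp
  then show ?thesis
    using AE_space
  proof eventually_elim
    fix \<tau> :: "'a set" assume J0: "J \<tau> = 0" and "\<tau> \<in> space (affine_flat_measure k)"
    then have \<tau>: "\<tau> \<in> affine_grassmannian k" by simp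
    interpret product_sigma_finite "\<lambda>_. flat_measure \<tau>"
      by (rule product_sigma_finite_flat_measure[OF affine_grassmannianD(1,3)[OF \<tau>]])
    let ?f = "\<lambda>i y. if i = (0::nat) then indicator N y else 1 :: ennreal"
    have "J \<tau> = (\<integral>\<^sup>+x. (\<Prod>i\<in>{..k}. ?f i (x i)) \<partial>Pi\<^sub>M {..k} (\<lambda>_. flat_measure \<tau>))"
      unfolding J_def by (intro nn_integral_cong) (simp add: prod.delta)
    also have "\<dots> = (\<Prod>i\<in>{..k}. \<integral>\<^sup>+y. ?f i y \<partial>flat_measure \<tau>)"
      by (rule product_nn_integral_prod) auto
    finally obtain i where "i \<le> k" "(\<integral>\<^sup>+y. ?f i y \<partial>flat_measure \<tau>) = 0"
      using J0 by (auto simp: prod_zero_iff)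
    then show "emeasure (flat_measure \<tau>) N = 0"
      using flat_measure_UNIV_nonzero[OF affine_grassmannianD(1,3)[OF \<tau>]] by (cases "i = 0") simp_all
  qed
qed

lemma integral_PiM_flat_measure:
  fixes T :: "'a::euclidean_space set" and H :: "('i \<Rightarrow> 'a) \<Rightarrow> 'b::{banach, second_countable_topology}"
  assumes I: "finite I" and T: "affine T" "T \<noteq> {}" and H[measurable]: "H \<in> borel_measurable (Pi\<^sub>M I (\<lambda>_. borel))"
  shows "(\<integral>x. H x \<partial>Pi\<^sub>M I (\<lambda>_. flat_measure T)) =
    (\<integral>x. (\<Prod>i\<in>I. exp (- pi * (norm (x i - closest_point T (x i)))\<^sup>2)) *\<^sub>R H (\<lambda>i\<in>I. closest_point T (x i)) \<partial>Pi\<^sub>M I (\<lambda>_. lborel))"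
proof -
  note [measurable] = borel_measurable_closest_point[OF T]
  have eq: "Pi\<^sub>M I (\<lambda>_. flat_measure T) =
    distr (density (Pi\<^sub>M I (\<lambda>_. lborel)) (\<lambda>x. ennreal (\<Prod>i\<in>I. exp (- pi * (norm (x i - closest_point T (x i)))\<^sup>2))))
      (Pi\<^sub>M I (\<lambda>_. flat_measure T)) (\<lambda>x. \<lambda>i\<in>I. closest_point T (x i))"
    using PiM_flat_measure[OF I T] by (simp add: gauss_def prod_ennreal)
  show ?thesis
    by (subst eq) (simp add: integral_distr integral_density prod_nonneg)
qed

text \<open>The tuples in the planes are images of Gaussian-weighted tuples in the whole space, on the fixed
  product space \<open>?M\<close> of planes and tuples. The formula for nonnegative functions says that \<open>w\<close> times
  Lebesgue measure is an image of a density of \<open>?M\<close>, and for integrable functions Fubini's theorem on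
  \<open>?M\<close> applies.\<close>

lemma affine_blaschke_petkantschin_integral:
  fixes H :: "(nat \<Rightarrow> 'a::euclidean_space) \<Rightarrow> 'b::{banach, second_countable_topology}"
  assumes k: "1 \<le> k" "k < DIM('a)" and Hm[measurable]: "H \<in> borel_measurable (Pi\<^sub>M {..k} (\<lambda>_. borel))"
  defines "w \<equiv> \<lambda>x. stiefel_ratio DIM('a) k * enn2real (inv_volume {1..k} (edges x)) ^ (DIM('a) - k)"
  assumes int: "integrable (Pi\<^sub>M {..k} (\<lambda>_. lborel)) (\<lambda>x. w x *\<^sub>R H x)"
  shows "integrable (affine_flat_measure k) (\<lambda>\<tau>. \<integral>x. H x \<partial>Pi\<^sub>M {..k} (\<lambda>_. flat_measure \<tau>))"
    and "(\<integral>\<tau>. \<integral>x. H x \<partial>Pi\<^sub>M {..k} (\<lambda>_. flat_measure \<tau>) \<partial>affine_flat_measure k) =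
      (\<integral>x. w x *\<^sub>R H x \<partial>Pi\<^sub>M {..k} (\<lambda>_. lborel))"
proof -
  let ?L = "Pi\<^sub>M {..k} (\<lambda>_. lborel :: 'a measure)" and ?A = "affine_flat_measure k :: 'a set measure"
  let ?M = "?A \<Otimes>\<^sub>M ?L"
  have kN: "k \<le> DIM('a)" using k by simp
  interpret A: sigma_finite_measure ?A by (rule sigma_finite_affine_flat_measure[OF kN])
  interpret L: sigma_finite_measure ?L by (rule lborel_PiM.sigma_finite) simp
  interpret AL: pair_sigma_finite ?A ?L ..
  define D where "D p = (\<Prod>i\<in>{..k}. exp (- pi * (norm (snd p i - closest_point (fst p) (snd p i)))\<^sup>2))" for p :: "'a set \<times> (nat \<Rightarrow> 'a)"
  define \<Theta> where "\<Theta> p = (\<lambda>i\<in>{..k}. closest_point (fst p) (snd p i))" for p :: "'a set \<times> (nat \<Rightarrow> 'a)"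
  have cp[measurable]: "(\<lambda>p. closest_point (fst p) (snd p i)) \<in> borel_measurable ?M" if "i \<in> {..k}" for i
  proof (rule measurable_closest_point_family[OF flat_family_affine_grassmannian[of k]])
    show "fst \<in> ?M \<rightarrow>\<^sub>M flat_borel (affine_grassmannian k)" by measurable
    show "(\<lambda>p. snd p i) \<in> borel_measurable ?M" using that by measurable
  qed
  have Dm[measurable]: "D \<in> borel_measurable ?M" unfolding D_def by measurable
  have \<Theta>m[measurable]: "\<Theta> \<in> ?M \<rightarrow>\<^sub>M Pi\<^sub>M {..k} (\<lambda>_. borel)" unfolding \<Theta>_def by measurable
  have D0: "0 \<le> D p" for p by (simp add: D_def prod_nonneg)
  have w0: "0 \<le> w x" for x
    unfolding w_def using stiefel_ratio_pos[OF k(1) kN] by (intro mult_nonneg_nonneg) auto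
  have wm[measurable]: "w \<in> borel_measurable ?L" unfolding w_def by measurable
  have eq: "distr (density ?M (\<lambda>p. ennreal (D p))) (Pi\<^sub>M {..k} (\<lambda>_. borel)) \<Theta> = density ?L (\<lambda>x. ennreal (w x))" (is "?E = ?R")
  proof (rule measure_eqI)
    show "sets ?E = sets ?R" by (simp, intro sets_PiM_cong) auto
    fix B assume "B \<in> sets ?E"
    then have B[measurable]: "B \<in> sets (Pi\<^sub>M {..k} (\<lambda>_. borel :: 'a measure))" by simp
    let ?b = "indicator B :: _ \<Rightarrow> ennreal"
    have bm[measurable]: "?b \<in> borel_measurable (Pi\<^sub>M {..k} (\<lambda>_. borel :: 'a measure))" by measurable
    have "emeasure ?E B = (\<integral>\<^sup>+x. ?b x \<partial>?E)" by simp
    also have "\<dots> = (\<integral>\<^sup>+p. ?b (\<Theta> p) \<partial>density ?M (\<lambda>p. ennreal (D p)))"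
      by (rule nn_integral_distr) measurable
    also have "\<dots> = (\<integral>\<^sup>+p. ennreal (D p) * ?b (\<Theta> p) \<partial>?M)"
      by (rule nn_integral_density) measurable
    also have "\<dots> = (\<integral>\<^sup>+\<tau>. \<integral>\<^sup>+x. ennreal (D (\<tau>, x)) * ?b (\<Theta> (\<tau>, x)) \<partial>?L \<partial>?A)"
      by (rule L.nn_integral_fst[symmetric]) measurable
    also have "\<dots> = (\<integral>\<^sup>+\<tau>. \<integral>\<^sup>+x. ?b x \<partial>Pi\<^sub>M {..k} (\<lambda>_. flat_measure \<tau>) \<partial>?A)"
    proof (rule nn_integral_cong)
      fix \<tau> assume "\<tau> \<in> space ?A"
      then have \<tau>: "affine \<tau>" "\<tau> \<noteq> {}" using affine_grassmannianD[of \<tau> k] by auto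
      show "(\<integral>\<^sup>+x. ennreal (D (\<tau>, x)) * ?b (\<Theta> (\<tau>, x)) \<partial>?L) = (\<integral>\<^sup>+x. ?b x \<partial>Pi\<^sub>M {..k} (\<lambda>_. flat_measure \<tau>))"
        by (subst nn_integral_PiM_flat_measure[OF _ \<tau> bm]) (simp_all add: D_def \<Theta>_def gauss_def prod_ennreal)
    qed
    also have "\<dots> = (\<integral>\<^sup>+x. ennreal (stiefel_ratio DIM('a) k) * inv_volume {1..k} (edges x) ^ (DIM('a) - k) * ?b x \<partial>?L)"
      by (rule affine_blaschke_petkantschin[OF k bm])
    also have "\<dots> = (\<integral>\<^sup>+x. ennreal (w x) * ?b x \<partial>?L)"
    proof (intro nn_integral_cong_AE, use AE_lborel_edges_independent[OF k] in eventually_elim)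
      fix x :: "nat \<Rightarrow> 'a" assume "inv_volume {1..k} (edges x) < top"
      then have "inv_volume {1..k} (edges x) = ennreal (enn2real (inv_volume {1..k} (edges x)))" by simp
      then have "inv_volume {1..k} (edges x) ^ (DIM('a) - k) = ennreal (enn2real (inv_volume {1..k} (edges x)) ^ (DIM('a) - k))"
        by (metis ennreal_power enn2real_nonneg)
      then show "ennreal (stiefel_ratio DIM('a) k) * inv_volume {1..k} (edges x) ^ (DIM('a) - k) * ?b x = ennreal (w x) * ?b x"
        using stiefel_ratio_pos[OF k(1) kN] by (simp add: w_def ennreal_mult)
    qed
    also have "\<dots> = (\<integral>\<^sup>+x. ?b x \<partial>?R)"
      by (rule nn_integral_density[symmetric]) measurable
    also have "\<dots> = emeasure ?R B" using B by (intro nn_integral_indicator) measurable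
    finally show "emeasure ?E B = emeasure ?R B" .
  qed
  have HL: "H \<in> borel_measurable ?L" by measurable
  have "integrable ?R H"
    using int w0 by (subst integrable_density[OF HL wm]) auto
  then have "integrable ?E H" by (simp only: eq)
  then have "integrable (density ?M (\<lambda>p. ennreal (D p))) (\<lambda>p. H (\<Theta> p))"
    by (subst (asm) integrable_distr_eq) auto
  then have intM: "integrable ?M (\<lambda>p. D p *\<^sub>R H (\<Theta> p))"
    using D0 by (subst (asm) integrable_density) auto
  have inner: "(\<integral>x. D (\<tau>, x) *\<^sub>R H (\<Theta> (\<tau>, x)) \<partial>?L) = (\<integral>x. H x \<partial>Pi\<^sub>M {..k} (\<lambda>_. flat_measure \<tau>))"
    if "\<tau> \<in> space ?A" for \<tau>
    using that by (subst integral_PiM_flat_measure[OF _ _ _ Hm]) (simp_all add: D_def \<Theta>_def affine_grassmannianD)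
  show "integrable ?A (\<lambda>\<tau>. \<integral>x. H x \<partial>Pi\<^sub>M {..k} (\<lambda>_. flat_measure \<tau>))"
    using AL.integrable_fst'[OF intM] inner by (subst (asm) Bochner_Integration.integrable_cong[OF refl inner])
  have "(\<integral>\<tau>. \<integral>x. H x \<partial>Pi\<^sub>M {..k} (\<lambda>_. flat_measure \<tau>) \<partial>?A) = (\<integral>\<tau>. \<integral>x. D (\<tau>, x) *\<^sub>R H (\<Theta> (\<tau>, x)) \<partial>?L \<partial>?A)"
    by (rule Bochner_Integration.integral_cong[OF refl]) (rule inner[symmetric])
  also have "\<dots> = (\<integral>p. D p *\<^sub>R H (\<Theta> p) \<partial>?M)"
    by (rule AL.integral_fst'[OF intM])
  also have "\<dots> = (\<integral>p. H (\<Theta> p) \<partial>density ?M (\<lambda>p. ennreal (D p)))"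
    using D0 by (subst integral_density) auto
  also have "\<dots> = (\<integral>x. H x \<partial>?E)" by (rule integral_distr[symmetric]) measurable
  also have "\<dots> = (\<integral>x. w x *\<^sub>R H x \<partial>?L)"
    unfolding eq using w0 by (subst integral_density[OF HL wm]) auto
  finally show "(\<integral>\<tau>. \<integral>x. H x \<partial>Pi\<^sub>M {..k} (\<lambda>_. flat_measure \<tau>) \<partial>?A) = (\<integral>x. w x *\<^sub>R H x \<partial>?L)" .
qed

lemma measurable_integral_flat_measure:
  fixes g :: "'a::euclidean_space \<Rightarrow> 'b::{banach, second_countable_topology}"
  assumes T: "flat_family M T" and [measurable]: "g \<in> borel_measurable borel"
  shows "(\<lambda>m. \<integral>y. g y \<partial>flat_measure (T m)) \<in> borel_measurable M"
proof -
  have [measurable]: "(\<lambda>p. closest_point (T (fst p)) (snd p)) \<in> borel_measurable (M \<Otimes>\<^sub>M (lborel :: 'a measure))"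
    by (intro measurable_closest_point_family[OF T]) auto
  have "(\<lambda>m. \<integral>x. exp (- pi * (norm (x - closest_point (T m) x))\<^sup>2) *\<^sub>R g (closest_point (T m) x) \<partial>lborel) \<in> borel_measurable M"
    by (rule lborel.borel_measurable_lebesgue_integral) (simp add: case_prod_beta, measurable)
  then show ?thesis
  proof (rule measurable_cong[THEN iffD1, rotated])
    fix m assume m: "m \<in> space M"
    note [measurable] = borel_measurable_closest_point[OF flat_familyD(2,3)[OF T m]]
    show "(\<integral>x. exp (- pi * (norm (x - closest_point (T m) x))\<^sup>2) *\<^sub>R g (closest_point (T m) x) \<partial>lborel) = (\<integral>y. g y \<partial>flat_measure (T m))"
      unfolding flat_measure_def gauss_def by (simp add: integral_distr integral_density)
  qed
qed

section \<open>Powers of the plane transform\<close>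

lemma integral_completion_representative:
  fixes f :: "'a \<Rightarrow> 'b::{banach, second_countable_topology}"
  assumes g: "g \<in> borel_measurable M" and ae: "AE x in M. f x = g x"
  shows "integrable (completion M) f \<longleftrightarrow> integrable M g"
    and "(\<integral>x. f x \<partial>completion M) = (\<integral>x. g x \<partial>M)"
proof -
  have f: "f \<in> borel_measurable (completion M)" by (rule borel_measurable_completion_AE[OF g ae])
  have g': "g \<in> borel_measurable (completion M)" using g by (rule measurable_completion)
  have ae': "AE x in completion M. f x = g x" using ae by (rule AE_completion)
  show "integrable (completion M) f \<longleftrightarrow> integrable M g"
    using integrable_cong_AE[OF f g' ae'] integrable_completion[OF g] by (simp only:)
  show "(\<integral>x. f x \<partial>completion M) = (\<integral>x. g x \<partial>M)"
    using integral_cong_AE[OF f g' ae'] integral_completion[OF g] by (simp only:)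
qed

lemma simplex_volume_powi:
  fixes x :: "nat \<Rightarrow> 'a::euclidean_space"
  assumes W: "inv_volume {1..k} (edges x) < top" and "k \<le> n"
  shows "simplex_volume k x powi (int k - int n) =
    fact k ^ (n - k) * enn2real (inv_volume {1..k} (edges x)) ^ (n - k)"
proof -
  have eq: "int k - int n = - int (n - k)" using assms(2) by simp
  show ?thesis
    unfolding eq simplex_volume_eq[OF W] power_int_minus power_int_of_nat power_one_over
    by (simp add: power_mult_distrib divide_inverse)
qed

theorem mainTheorem3:
  fixes f :: "real ^ 'n \<Rightarrow> 'b::{real_normed_field, banach, second_countable_topology}"
    and k l :: nat
    and F :: "(nat \<Rightarrow> real ^ 'n) \<Rightarrow> 'b"
  assumes "1 \<le> k" and "k < CARD('n)" and "1 \<le> l"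
    and "f \<in> borel_measurable lebesgue"
    and F_eq: "\<And>x. F x = (\<Prod>j\<in>{0..k}. f (x j)) *
                 (\<Prod>j\<in>{k+1..k+l}. \<integral>y. f y \<partial>flat_lebesgue (plane_through k x))"
    and "AE x in tuple_lebesgue k. integrable (flat_lebesgue (plane_through k x)) f"
    and "integrable (tuple_lebesgue k)
           (\<lambda>x. F x * of_real (simplex_volume k x powi (int k - int CARD('n))))"
  shows "(AE \<tau> in affine_grassmann_measure k. integrable (flat_lebesgue \<tau>) f) \<and>
    integrable (affine_grassmann_measure k) (\<lambda>\<tau>. plane_transform f \<tau> ^ (k + l + 1)) \<and>
    (\<integral>\<tau>. plane_transform f \<tau> ^ (k + l + 1) \<partial>affine_grassmann_measure k) =
      of_real (fact k powi (int k - int CARD('n)) * stiefel_sigma k k / stiefel_sigma CARD('n) k) *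
      (\<integral>x. F x * of_real (simplex_volume k x powi (int k - int CARD('n))) \<partial>tuple_lebesgue k)"
proof -
  let ?L = "Pi\<^sub>M {..k} (\<lambda>_. lborel :: (real ^ 'n) measure)"
  let ?A = "affine_flat_measure k :: (real ^ 'n) set measure"
  let ?G = "flat_borel (affine_grassmannian k :: (real ^ 'n) set set)"
  let ?m = "CARD('n) - k"
  let ?c = "stiefel_ratio CARD('n) k"
  have k: "1 \<le> k" "k < DIM(real ^ 'n)" and kN: "k \<le> DIM(real ^ 'n)" using assms(1,2) by auto
  have tuple: "tuple_lebesgue k = completion ?L" by (simp add: tuple_lebesgue_def)
  have grass: "affine_grassmann_measure k = completion ?A" by (rule affine_grassmann_measure_eq[OF kN])
  note [measurable] = measurable_spanned_flat[OF kN]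
  obtain g where g[measurable]: "g \<in> borel_measurable borel" and fg: "AE y in lborel. f y = g y"
    using completion_ex_borel_measurable_banach[OF assms(4)] by auto
  obtain N where N': "{y \<in> space lborel. f y \<noteq> g y} \<subseteq> N" "emeasure lborel N = 0" "N \<in> sets lborel"
    using fg by (rule AE_E)
  have N: "N \<in> null_sets lborel" using N'(2,3) by (rule null_setsI)
  have Nfg: "f y = g y" if "y \<notin> N" for y using N'(1) that by auto
  have Nm[measurable]: "N \<in> sets borel" using N'(3) by simp

  \<comment> \<open>Both \<open>null\<close> and \<open>fin\<close> are measurable in the plane, so each can be moved between tuples and planes:
    \<open>null\<close>, under which \<open>f\<close> may be replaced by \<open>g\<close>, from planes to tuples, and \<open>fin\<close>, which
    the hypothesis supplies for tuples, from tuples to planes.\<close>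
  define R where "R \<tau> = (\<integral>y. g y \<partial>flat_measure \<tau>)" for \<tau> :: "(real ^ 'n) set"
  have R[measurable]: "R \<in> borel_measurable ?G"
    unfolding R_def by (rule measurable_integral_flat_measure[OF flat_family_affine_grassmannian g])
  define null where "null \<tau> \<longleftrightarrow> emeasure (flat_measure \<tau>) N = 0" for \<tau> :: "(real ^ 'n) set"
  define fin where "fin \<tau> \<longleftrightarrow> (\<integral>\<^sup>+y. ennreal (norm (g y)) \<partial>flat_measure \<tau>) < top" for \<tau> :: "(real ^ 'n) set"
  have null: "Measurable.pred ?G null"
  proof -
    have "(\<lambda>\<tau>. \<integral>\<^sup>+y. indicator N y \<partial>flat_measure \<tau>) \<in> borel_measurable ?G"
      by (rule measurable_nn_integral_flat_measure[OF flat_family_affine_grassmannian]) measurable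
    then have [measurable]: "(\<lambda>\<tau>. emeasure (flat_measure \<tau>) N) \<in> borel_measurable ?G" by simp
    show ?thesis unfolding null_def by measurable
  qed
  have fin: "Measurable.pred ?G fin"
  proof -
    have [measurable]: "(\<lambda>\<tau>. \<integral>\<^sup>+y. ennreal (norm (g y)) \<partial>flat_measure \<tau>) \<in> borel_measurable ?G"
      by (rule measurable_nn_integral_flat_measure[OF flat_family_affine_grassmannian]) measurable
    show ?thesis unfolding fin_def by measurable
  qed
  have flat: "integrable (flat_lebesgue \<tau>) f \<longleftrightarrow> fin \<tau>" "plane_transform f \<tau> = R \<tau>"
    if \<tau>: "\<tau> \<in> affine_grassmannian k" and n: "null \<tau>" for \<tau>
  proof -
    have "N \<in> null_sets (flat_measure \<tau>)" using n unfolding null_def by (intro null_setsI) auto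
    from AE_not_in[OF this] have ae: "AE y in flat_measure \<tau>. f y = g y"
      by eventually_elim (rule Nfg)
    have g': "g \<in> borel_measurable (flat_measure \<tau>)" by measurable
    note eq = flat_lebesgue_eq[OF affine_grassmannianD(1,3)[OF \<tau>]]
    show "integrable (flat_lebesgue \<tau>) f \<longleftrightarrow> fin \<tau>"
      using integral_completion_representative(1)[OF g' ae] g'
      by (simp add: eq integrable_iff_bounded fin_def)
    show "plane_transform f \<tau> = R \<tau>"
      using integral_completion_representative(2)[OF g' ae] by (simp add: eq plane_transform_def R_def)
  qed
  have null_A: "AE \<tau> in ?A. null \<tau>" unfolding null_def by (rule AE_affine_flat_null[OF k N])
  then have null_L: "AE x in ?L. null (spanned_flat k x)"
    using AE_affine_flat_measure_iff[OF k null] by simp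
  have indep: "AE x in ?L. inv_volume {1..k} (edges x) < top" by (rule AE_lborel_edges_independent[OF k])
  have "AE x in ?L. integrable (flat_lebesgue (plane_through k x)) f"
    using assms(6) unfolding tuple AE_completion_iff .
  then have "AE x in ?L. fin (spanned_flat k x)"
    using indep null_L
  proof eventually_elim
    fix x :: "nat \<Rightarrow> real ^ 'n"
    assume "integrable (flat_lebesgue (plane_through k x)) f" and W: "inv_volume {1..k} (edges x) < top"
      and n: "null (spanned_flat k x)"
    then show "fin (spanned_flat k x)"
      using flat(1)[OF spanned_flat_in_affine_grassmannian[OF W] n] plane_through_eq[OF W] by simp
  qed
  then have fin_A: "AE \<tau> in ?A. fin \<tau>"
    using AE_affine_flat_measure_iff[OF k fin] by simp

  define H where "H x = (\<Prod>j\<in>{..k}. g (x j)) * R (spanned_flat k x) ^ l" for x :: "nat \<Rightarrow> real ^ 'n"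
  have H[measurable]: "H \<in> borel_measurable (Pi\<^sub>M {..k} (\<lambda>_. borel))" unfolding H_def by measurable
  define w where "w x = enn2real (inv_volume {1..k} (edges x)) ^ ?m" for x :: "nat \<Rightarrow> real ^ 'n"
  have w[measurable]: "w \<in> borel_measurable (Pi\<^sub>M {..k} (\<lambda>_. borel))" unfolding w_def by measurable
  have FH: "AE x in ?L. F x * of_real (simplex_volume k x powi (int k - int CARD('n))) = (fact k ^ ?m * w x) *\<^sub>R H x"
  proof -
    have "AE x in ?L. \<forall>j\<in>{..k}. x j \<notin> N"
      using AE_PiM_lborel_component[OF finite_atMost _ N, of _ k] by (intro AE_finite_allI) auto
    then show ?thesis
      using indep null_L
    proof eventually_elim
      fix x :: "nat \<Rightarrow> real ^ 'n"
      assume x: "\<forall>j\<in>{..k}. x j \<notin> N" and W: "inv_volume {1..k} (edges x) < top"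
        and n: "null (spanned_flat k x)"
      have "F x = (\<Prod>j\<in>{..k}. f (x j)) * plane_transform f (spanned_flat k x) ^ l"
        by (simp add: F_eq plane_through_eq[OF W] plane_transform_def atLeast0AtMost)
      also have "\<dots> = H x"
        using x Nfg flat(2)[OF spanned_flat_in_affine_grassmannian[OF W] n] by (simp add: H_def)
      finally show "F x * of_real (simplex_volume k x powi (int k - int CARD('n))) = (fact k ^ ?m * w x) *\<^sub>R H x"
        using simplex_volume_powi[OF W, of "CARD('n)"] kN by (simp add: scaleR_conv_of_real w_def mult.commute)
    qed
  qed
  have Hw: "(\<lambda>x. (fact k ^ ?m * w x) *\<^sub>R H x) \<in> borel_measurable ?L" by measurable
  have int: "integrable ?L (\<lambda>x. (fact k ^ ?m * w x) *\<^sub>R H x)"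
    using assms(7) integral_completion_representative(1)[OF Hw FH] unfolding tuple by simp
  have rhs: "(\<integral>x. F x * of_real (simplex_volume k x powi (int k - int CARD('n))) \<partial>tuple_lebesgue k) =
    (\<integral>x. (fact k ^ ?m * w x) *\<^sub>R H x \<partial>?L)"
    unfolding tuple by (rule integral_completion_representative(2)[OF Hw FH])
  have w_eq: "stiefel_ratio DIM(real ^ 'n) k * enn2real (inv_volume {1..k} (edges x)) ^ (DIM(real ^ 'n) - k) =
    (?c / fact k ^ ?m) * (fact k ^ ?m * w x)" for x :: "nat \<Rightarrow> real ^ 'n"
    by (simp add: w_def)
  have int': "integrable ?L (\<lambda>x. (stiefel_ratio DIM(real ^ 'n) k *
      enn2real (inv_volume {1..k} (edges x)) ^ (DIM(real ^ 'n) - k)) *\<^sub>R H x)"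
    unfolding w_eq scaleR_scaleR[symmetric, of "?c / fact k ^ ?m"] by (rule integrable_scaleR_right) (rule int)
  note BP = affine_blaschke_petkantschin_integral[OF k H int']

  let ?I = "\<lambda>\<tau>. \<integral>x. H x \<partial>Pi\<^sub>M {..k} (\<lambda>_. flat_measure \<tau>)"
  have slice: "AE \<tau> in ?A. plane_transform f \<tau> ^ (k + l + 1) = ?I \<tau>"
    using null_A fin_A AE_space
  proof eventually_elim
    fix \<tau> :: "(real ^ 'n) set" assume n: "null \<tau>" and "fin \<tau>" and "\<tau> \<in> space ?A"
    then have \<tau>: "\<tau> \<in> affine_grassmannian k" and gi: "integrable (flat_measure \<tau>) g"
      by (simp_all add: integrable_iff_bounded fin_def)
    interpret product_sigma_finite "\<lambda>_. flat_measure \<tau>"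
      by (rule product_sigma_finite_flat_measure[OF affine_grassmannianD(1,3)[OF \<tau>]])
    have "?I \<tau> = (\<integral>x. (\<Prod>j\<in>{..k}. g (x j)) * R \<tau> ^ l \<partial>Pi\<^sub>M {..k} (\<lambda>_. flat_measure \<tau>))"
    proof (rule integral_cong_AE)
      show "AE x in Pi\<^sub>M {..k} (\<lambda>_. flat_measure \<tau>). H x = (\<Prod>j\<in>{..k}. g (x j)) * R \<tau> ^ l"
        using AE_PiM_flat_measure_spanned_flat[OF \<tau>] by eventually_elim (simp add: H_def)
    qed measurable
    also have "\<dots> = (\<integral>x. (\<Prod>j\<in>{..k}. g (x j)) \<partial>Pi\<^sub>M {..k} (\<lambda>_. flat_measure \<tau>)) * R \<tau> ^ l"
      by (rule Bochner_Integration.integral_mult_left) (use product_integrable_prod[OF finite_atMost, of k "\<lambda>_. g"] gi in simp)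
    also have "(\<integral>x. (\<Prod>j\<in>{..k}. g (x j)) \<partial>Pi\<^sub>M {..k} (\<lambda>_. flat_measure \<tau>)) = R \<tau> ^ (k + 1)"
      using product_integral_prod[OF finite_atMost, of k "\<lambda>_. g"] gi by (simp add: R_def)
    finally show "plane_transform f \<tau> ^ (k + l + 1) = ?I \<tau>"
      by (simp add: flat(2)[OF \<tau> n] power_add mult_ac)
  qed
  have I: "?I \<in> borel_measurable ?A" by (rule borel_measurable_integrable[OF BP(1)])
  have "AE \<tau> in ?A. integrable (flat_lebesgue \<tau>) f"
    using null_A fin_A AE_space
  proof eventually_elim
    fix \<tau> :: "(real ^ 'n) set" assume "null \<tau>" "fin \<tau>" "\<tau> \<in> space ?A"
    then show "integrable (flat_lebesgue \<tau>) f" using flat(1)[of \<tau>] by simp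
  qed
  then have 1: "AE \<tau> in affine_grassmann_measure k. integrable (flat_lebesgue \<tau>) f"
    unfolding grass by (rule AE_completion)
  have 2: "integrable (affine_grassmann_measure k) (\<lambda>\<tau>. plane_transform f \<tau> ^ (k + l + 1))"
    using BP(1) integral_completion_representative(1)[OF I slice] unfolding grass by simp
  have "(\<integral>\<tau>. plane_transform f \<tau> ^ (k + l + 1) \<partial>affine_grassmann_measure k) = (\<integral>\<tau>. ?I \<tau> \<partial>?A)"
    unfolding grass by (rule integral_completion_representative(2)[OF I slice])
  also have "\<dots> = (\<integral>x. (?c / fact k ^ ?m) *\<^sub>R (fact k ^ ?m * w x) *\<^sub>R H x \<partial>?L)"
    unfolding BP(2) w_eq scaleR_scaleR ..
  also have "\<dots> = (?c / fact k ^ ?m) *\<^sub>R (\<integral>x. (fact k ^ ?m * w x) *\<^sub>R H x \<partial>?L)"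
    by (rule integral_scaleR_right)
  also have "?c / fact k ^ ?m = fact k powi (int k - int CARD('n)) * stiefel_sigma k k / stiefel_sigma CARD('n) k"
  proof -
    have eq: "int k - int CARD('n) = - int ?m" using kN by simp
    show ?thesis unfolding eq power_int_minus power_int_of_nat stiefel_ratio_def by (simp add: field_simps)
  qed
  finally show ?thesis
    using 1 2 unfolding rhs scaleR_conv_of_real by simp
qed

end
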